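(* Let $r\ge 1$, let $m_1,\dots,m_r\ge 1$ be integers with $n=m_1+\dots+m_r\ge 2$, and let $\epsilon_1,\dots,\epsilon_r$ be arbitrary constants. On the open set $U$ of points of the coordinate space with coordinates $u^{i(\alpha)}$ ($1\le\alpha\le r$, $1\le i\le m_\alpha$) where $u^{1(\alpha)}\neq 0$ for all $\alpha$, $u^{1(\alpha)}\neq u^{1(\beta)}$ for $\alpha\ne\beta$, and $u^{2(\alpha)}\neq 0$ whenever $m_\alpha\ge 2$, consider: the product $\circ$ with structure constants $c^{k(\gamma)}_{i(\alpha)j(\beta)}=\delta^\gamma_\alpha\delta^\gamma_\beta\delta^k_{i+j-1}$; the vector field $e=\sum_{\alpha=1}^r\partial_{1(\alpha)}$; the vector field $E=\sum_{\sigma=1}^r\sum_{s=1}^{m_\sigma}u^{s(\sigma)}\partial_{s(\sigma)}$; the connection $\nabla$ whose Christoffel symbols $\Gamma$ are given by formulas (1)-(4) of the context; the dual product $*$ with structure constants $c^{*\,i(\alpha)}_{\ j(\beta)k(\gamma)}=\delta^\alpha_\beta\delta^\alpha_\gamma (E^{-1})^{(i-j-k+2)(\alpha)}$; and the dual connection $\nabla^*$ with Christoffel symbols $$\Gamma^{*\,k(\alpha)}_{\ i(\beta)j(\gamma)}=\Gamma^{k(\alpha)}_{i(\beta)j(\gamma)}-\delta^\alpha_\beta\delta^\alpha_\gamma (E^{-1})^{(k-i-j+2)(\alpha)}\Big[\delta^k_1\Big(1-\sum_{\sigma\ne\alpha}m_\sigma\epsilon_\sigma\Big)+(1-\delta^k_1)\Big(1-\sum_{\tau=1}^r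 m_\tau\epsilon_\tau\Big)\Big]-(1-\delta^\alpha_\beta)\delta_{\beta\gamma}\delta^1_i\delta^1_j\delta^k_1\frac{m_\beta\epsilon_\beta}{u^{1(\beta)}}.$$ Let $L=E\circ$ and $a_0=\sum_{\alpha=1}^r m_\alpha\epsilon_\alpha u^{1(\alpha)}$ (that is, $a_0=\sum_\alpha\epsilon_\alpha\operatorname{Tr}(L_\alpha)$, with $L_\alpha$ the $\alpha$-th diagonal block of $L$). Then $(\nabla,\nabla^*,\circ,*,e,E)$ is a bi-flat F-manifold structure on $U$ satisfying $d_\nabla(L-a_0 I)=0$, and it is the unique bi-flat structure with these $\circ,e,E$ satisfying $d_\nabla(L-a_0I)=0$.
   Context: Everything is smooth (real case) or holomorphic (complex case). The coordinates $u^1,\dots,u^n$ are relabelled as $u^{j(\alpha)}=u^{m_1+\dots+m_{\alpha-1}+j}$, $1\le j\le m_\alpha$, and $\partial_{j(\alpha)}=\partial/\partial u^{j(\alpha)}$. Any symbol carrying an index $k(\alpha)$ with $k\le 0$ or $k>m_\alpha$ is zero. $E^{-1}$ is the vector field with $E^{-1}\circ E=e$, with components $(E^{-1})^{k(\alpha)}$. Christoffel symbols of $\nabla$ (symmetric in lower indices; $\alpha,\beta,\gamma$ pairwise distinct): (1) $\Gamma^{k(\gamma)}_{i(\alpha)j(\beta)}=0$. (2) $\Gamma^{k(\alpha)}_{i(\beta)j(\alpha)}=0$ if $i\ge2$; $\Gamma^{k(\alpha)}_{1(\beta)j(\alpha)}=\Gamma^{(k-j+1)(\alpha)}_{1(\beta)1(\alpha)}$,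 equal to $0$ if $k<j$, to $\frac{m_\beta\epsilon_\beta}{u^{1(\alpha)}-u^{1(\beta)}}$ if $k=j$, and to $-\frac{1}{u^{1(\alpha)}-u^{1(\beta)}}\sum_{s=2}^{k-j+1}\Gamma^{(k-j-s+2)(\alpha)}_{1(\beta)1(\alpha)}u^{s(\alpha)}$ if $k>j$. (3) $\Gamma^{k(\alpha)}_{i(\beta)j(\beta)}=0$ if $i+j\ge3$; $\Gamma^{k(\alpha)}_{1(\beta)1(\beta)}=-\Gamma^{k(\alpha)}_{1(\beta)1(\alpha)}$. (4) $\Gamma^{k(\alpha)}_{1(\alpha)j(\alpha)}=\Gamma^{k(\alpha)}_{j(\alpha)1(\alpha)}=-\sum_{\sigma\ne\alpha}\Gamma^{k(\alpha)}_{1(\sigma)j(\alpha)}$; for $i,j\ge2$, $\Gamma^{k(\alpha)}_{i(\alpha)j(\alpha)}=\Gamma^{(k-i-j+4)(\alpha)}_{2(\alpha)2(\alpha)}$ if $k-i-j\ge-2$ and $0$ if $k-i-j\le-3$, where $\Gamma^{2(\alpha)}_{2(\alpha)2(\alpha)}=-\frac{m_\alpha\epsilon_\alpha}{u^{2(\alpha)}}$ and, for $3\le p\le m_\alpha$, $\Gamma^{p(\alpha)}_{2(\alpha)2(\alpha)}=\Gamma^{(p-2)(\alpha)}_{1(\alpha)1(\alpha)}-\Gamma^{2(\alpha)}_{2(\alpha)2(\alpha)}\frac{u^{p(\alpha)}}{u^{2(\alpha)}}-\frac1{u^{2(\alpha)}}\sum_{l=1}^{p-3}\big(\Gamma^{(l+2)(\alpha)}_{2(\alpha)2(\alpha)}-\Gamma^{l(\alpha)}_{1(\alpha)1(\alpha)}\big)u^{(p-l)(\alpha)}$.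 For a $(1,1)$-tensor $V$ and a torsionless connection, $(d_\nabla V)^i_{jk}=\partial_jV^i_k+\Gamma^i_{jm}V^m_k-\partial_kV^i_j-\Gamma^i_{km}V^m_j$. For a vector field $X$, $X\circ$ denotes the $(1,1)$-tensor $Y\mapsto X\circ Y$. F-manifold: a manifold with a commutative associative product $\circ$ on vector fields (bilinear over functions), with unit $e$, satisfying for all vector fields $[X\circ Y,W\circ Z]-[X\circ Y,Z]\circ W-[X\circ Y,W]\circ Z-X\circ[Y,Z\circ W]+X\circ[Y,Z]\circ W+X\circ[Y,W]\circ Z-Y\circ[X,Z\circ W]+Y\circ[X,Z]\circ W+Y\circ[X,W]\circ Z=0$. Flat F-manifold (flat structure) $(\nabla,\circ,e)$: an F-manifold with a connection $\nabla$ such that $\nabla e=0$ and, for every constant $\lambda$, the connection $(X,Y)\mapsto\nabla_XY-\lambda X\circ Y$ is flat and torsionless. Bi-flat F-manifold $(\nabla,\nabla^*,\circ,*,e,E)$: $(\nabla,\circ,e)$ and $(\nabla^*,*,E)$ are both flat structures, $E\circ$ is invertible, and $X*Y=(E\circ)^{-1}(X\circ Y)$, $[e,E]=e$, $\mathrm{Lie}_E\circ=\circ$, $(d_\nabla-d_{\nabla^*})(X\circ)=0$ for all vector fields $X,Y$. *)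

theory Defs
  imports "HOL-Analysis.Analysis"
begin

section \<open>Tensor calculus on an open subset of a coordinate space\<close>

text \<open>
  The scalars form a type \<open>'k\<close> of class \<open>real_normed_field\<close>; the instances are the real case
  (\<open>'k = real\<close>) and the complex case (\<open>'k = complex\<close>). For a finite set \<open>I\<close> of coordinate
  labels, a point is an element of \<open>extensional I\<close>, i.e. a function \<open>u\<close> with all values outside
  \<open>I\<close> fixed, so that \<open>extensional I\<close> is a copy of the \<open>card I\<close>-dimensional coordinate space; its
  topology is induced by the product topology. Fields on \<open>U \<subseteq> extensional I\<close> are given by their
  components: a component counts only at labels in \<open>I\<close> and at points of \<open>U\<close>.
  Upper indices come first: \<open>\<Gamma> k i j\<close> is \<open>\<Gamma>\<^sup>k\<^sub>i\<^sub>j\<close>.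
\<close>

type_synonym ('i, 'k) scalar_field = "('i \<Rightarrow> 'k) \<Rightarrow> 'k"
type_synonym ('i, 'k) vfield = "'i \<Rightarrow> ('i, 'k) scalar_field"
type_synonym ('i, 'k) tensor11 = "'i \<Rightarrow> 'i \<Rightarrow> ('i, 'k) scalar_field"
type_synonym ('i, 'k) symbols = "'i \<Rightarrow> 'i \<Rightarrow> 'i \<Rightarrow> ('i, 'k) scalar_field"

definition coord_domain :: "'i set \<Rightarrow> ('i \<Rightarrow> 'k::real_normed_field) set \<Rightarrow> bool" where
  "coord_domain I U \<longleftrightarrow> finite I \<and> openin (top_of_set (extensional I)) U"

definition pd :: "'i \<Rightarrow> ('i, 'k::real_normed_field) scalar_field \<Rightarrow> ('i, 'k) scalar_field" where
  "pd p f u = deriv (\<lambda>t. f (u(p := t))) (u p)"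

text \<open>
  All partial derivatives of order at most \<open>n\<close> exist and are continuous. Differentiation is over
  \<open>'k\<close>, so for all \<open>n\<close> together this is smoothness over the reals and holomorphy over the complex
  numbers.
\<close>

fun Ck_on :: "nat \<Rightarrow> 'i set \<Rightarrow> ('i \<Rightarrow> 'k::real_normed_field) set \<Rightarrow> ('i, 'k) scalar_field \<Rightarrow> bool"
where
  "Ck_on 0 I U f \<longleftrightarrow> continuous_on U f"
| "Ck_on (Suc n) I U f \<longleftrightarrow> continuous_on U f \<and>
     (\<forall>p\<in>I. (\<forall>u\<in>U. (\<lambda>t. f (u(p := t))) field_differentiable at (u p)) \<and> Ck_on n I U (pd p f))"

definition smooth_fn :: "'i set \<Rightarrow> ('i \<Rightarrow> 'k::real_normed_field) set \<Rightarrow> ('i, 'k) scalar_field \<Rightarrow> bool"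
where "smooth_fn I U f \<longleftrightarrow> (\<forall>n. Ck_on n I U f)"

definition is_vfield :: "'i set \<Rightarrow> ('i \<Rightarrow> 'k::real_normed_field) set \<Rightarrow> ('i, 'k) vfield \<Rightarrow> bool" where
  "is_vfield I U X \<longleftrightarrow> (\<forall>i\<in>I. smooth_fn I U (X i))"

definition is_tensor11 :: "'i set \<Rightarrow> ('i \<Rightarrow> 'k::real_normed_field) set \<Rightarrow> ('i, 'k) tensor11 \<Rightarrow> bool"
where "is_tensor11 I U V \<longleftrightarrow> (\<forall>i\<in>I. \<forall>k\<in>I. smooth_fn I U (V i k))"

definition is_symbols :: "'i set \<Rightarrow> ('i \<Rightarrow> 'k::real_normed_field) set \<Rightarrow> ('i, 'k) symbols \<Rightarrow> bool"
where "is_symbols I U c \<longleftrightarrow> (\<forall>k\<in>I. \<forall>i\<in>I. \<forall>j\<in>I. smooth_fn I U (c k i j))"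

definition vf_eq :: "'i set \<Rightarrow> ('i \<Rightarrow> 'k::real_normed_field) set \<Rightarrow>
    ('i, 'k) vfield \<Rightarrow> ('i, 'k) vfield \<Rightarrow> bool" where
  "vf_eq I U X Y \<longleftrightarrow> (\<forall>i\<in>I. \<forall>u\<in>U. X i u = Y i u)"

definition symbols_eq :: "'i set \<Rightarrow> ('i \<Rightarrow> 'k::real_normed_field) set \<Rightarrow>
    ('i, 'k) symbols \<Rightarrow> ('i, 'k) symbols \<Rightarrow> bool" where
  "symbols_eq I U c d \<longleftrightarrow> (\<forall>k\<in>I. \<forall>i\<in>I. \<forall>j\<in>I. \<forall>u\<in>U. c k i j u = d k i j u)"

definition bracket :: "'i set \<Rightarrow> ('i, 'k::real_normed_field) vfield \<Rightarrow> ('i, 'k) vfield \<Rightarrow> ('i, 'k) vfield"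
where "bracket I X Y k u = (\<Sum>i\<in>I. X i u * pd i (Y k) u - Y i u * pd i (X k) u)"

text \<open>The product of vector fields with structure constants \<open>c\<close>; bilinearity over functions is built in.\<close>

definition vprod :: "'i set \<Rightarrow> ('i, 'k::real_normed_field) symbols \<Rightarrow>
    ('i, 'k) vfield \<Rightarrow> ('i, 'k) vfield \<Rightarrow> ('i, 'k) vfield" where
  "vprod I c X Y k u = (\<Sum>i\<in>I. \<Sum>j\<in>I. c k i j u * X i u * Y j u)"

definition mult_tensor :: "'i set \<Rightarrow> ('i, 'k::real_normed_field) symbols \<Rightarrow>
    ('i, 'k) vfield \<Rightarrow> ('i, 'k) tensor11" where
  "mult_tensor I c X i k u = (\<Sum>j\<in>I. c i j k u * X j u)"

definition tensor_app :: "'i set \<Rightarrow> ('i, 'k::real_normed_field) tensor11 \<Rightarrow>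
    ('i, 'k) vfield \<Rightarrow> ('i, 'k) vfield" where
  "tensor_app I V X i u = (\<Sum>k\<in>I. V i k u * X k u)"

definition tensor_inverse :: "'i set \<Rightarrow> ('i \<Rightarrow> 'k::real_normed_field) set \<Rightarrow>
    ('i, 'k) tensor11 \<Rightarrow> ('i, 'k) tensor11 \<Rightarrow> bool" where
  "tensor_inverse I U V W \<longleftrightarrow> (\<forall>X. is_vfield I U X \<longrightarrow>
     vf_eq I U (tensor_app I V (tensor_app I W X)) X \<and>
     vf_eq I U (tensor_app I W (tensor_app I V X)) X)"

definition cov :: "'i set \<Rightarrow> ('i, 'k::real_normed_field) symbols \<Rightarrow>
    ('i, 'k) vfield \<Rightarrow> ('i, 'k) vfield \<Rightarrow> ('i, 'k) vfield" where
  "cov I \<Gamma> X Y k u = (\<Sum>i\<in>I. X i u * (pd i (Y k) u + (\<Sum>j\<in>I. \<Gamma> k i j u * Y j u)))"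

definition deformed_cov :: "'i set \<Rightarrow> ('i, 'k::real_normed_field) symbols \<Rightarrow> ('i, 'k) symbols \<Rightarrow> 'k \<Rightarrow>
    ('i, 'k) vfield \<Rightarrow> ('i, 'k) vfield \<Rightarrow> ('i, 'k) vfield" where
  "deformed_cov I \<Gamma> c l X Y k u = cov I \<Gamma> X Y k u - l * vprod I c X Y k u"

definition torsionless :: "'i set \<Rightarrow> ('i \<Rightarrow> 'k::real_normed_field) set \<Rightarrow>
    (('i, 'k) vfield \<Rightarrow> ('i, 'k) vfield \<Rightarrow> ('i, 'k) vfield) \<Rightarrow> bool" where
  "torsionless I U D \<longleftrightarrow> (\<forall>X Y. is_vfield I U X \<longrightarrow> is_vfield I U Y \<longrightarrow>
     (\<forall>k\<in>I. \<forall>u\<in>U. D X Y k u - D Y X k u - bracket I X Y k u = 0))"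

definition flat :: "'i set \<Rightarrow> ('i \<Rightarrow> 'k::real_normed_field) set \<Rightarrow>
    (('i, 'k) vfield \<Rightarrow> ('i, 'k) vfield \<Rightarrow> ('i, 'k) vfield) \<Rightarrow> bool" where
  "flat I U D \<longleftrightarrow> (\<forall>X Y Z. is_vfield I U X \<longrightarrow> is_vfield I U Y \<longrightarrow> is_vfield I U Z \<longrightarrow>
     (\<forall>k\<in>I. \<forall>u\<in>U. D X (D Y Z) k u - D Y (D X Z) k u - D (bracket I X Y) Z k u = 0))"

definition d_nabla :: "'i set \<Rightarrow> ('i, 'k::real_normed_field) symbols \<Rightarrow> ('i, 'k) tensor11 \<Rightarrow>
    ('i, 'k) symbols" where
  "d_nabla I \<Gamma> V i j k u =
     pd j (V i k) u + (\<Sum>m\<in>I. \<Gamma> i j m u * V m k u)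
     - pd k (V i j) u - (\<Sum>m\<in>I. \<Gamma> i k m u * V m j u)"


section \<open>F-manifolds, flat and bi-flat structures\<close>

definition hertling_manin :: "'i set \<Rightarrow> ('i \<Rightarrow> 'k::real_normed_field) set \<Rightarrow> ('i, 'k) symbols \<Rightarrow> bool"
where
  "hertling_manin I U c \<longleftrightarrow>
    (let pr = vprod I c; br = bracket I in
     \<forall>X Y Z W. is_vfield I U X \<longrightarrow> is_vfield I U Y \<longrightarrow> is_vfield I U Z \<longrightarrow> is_vfield I U W \<longrightarrow>
     (\<forall>k\<in>I. \<forall>u\<in>U.
        br (pr X Y) (pr W Z) k u - pr (br (pr X Y) Z) W k u - pr (br (pr X Y) W) Z k u
        - pr X (br Y (pr Z W)) k u + pr X (pr (br Y Z) W) k u + pr X (pr (br Y W) Z) k u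
        - pr Y (br X (pr Z W)) k u + pr Y (pr (br X Z) W) k u + pr Y (pr (br X W) Z) k u = 0))"

definition F_manifold :: "'i set \<Rightarrow> ('i \<Rightarrow> 'k::real_normed_field) set \<Rightarrow>
    ('i, 'k) symbols \<Rightarrow> ('i, 'k) vfield \<Rightarrow> bool" where
  "F_manifold I U c e \<longleftrightarrow>
     coord_domain I U \<and> is_symbols I U c \<and> is_vfield I U e \<and>
     (\<forall>X Y. is_vfield I U X \<longrightarrow> is_vfield I U Y \<longrightarrow>
        vf_eq I U (vprod I c X Y) (vprod I c Y X)) \<and>
     (\<forall>X Y Z. is_vfield I U X \<longrightarrow> is_vfield I U Y \<longrightarrow> is_vfield I U Z \<longrightarrow>
        vf_eq I U (vprod I c (vprod I c X Y) Z) (vprod I c X (vprod I c Y Z))) \<and>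
     (\<forall>X. is_vfield I U X \<longrightarrow> vf_eq I U (vprod I c e X) X) \<and>
     hertling_manin I U c"

definition flat_F_manifold :: "'i set \<Rightarrow> ('i \<Rightarrow> 'k::real_normed_field) set \<Rightarrow>
    ('i, 'k) symbols \<Rightarrow> ('i, 'k) symbols \<Rightarrow> ('i, 'k) vfield \<Rightarrow> bool" where
  "flat_F_manifold I U \<Gamma> c e \<longleftrightarrow>
     F_manifold I U c e \<and> is_symbols I U \<Gamma> \<and>
     (\<forall>X. is_vfield I U X \<longrightarrow> vf_eq I U (cov I \<Gamma> X e) (\<lambda>k u. 0)) \<and>
     (\<forall>l. flat I U (deformed_cov I \<Gamma> c l) \<and> torsionless I U (deformed_cov I \<Gamma> c l))"

text \<open>In the last but one clause of the following definition the left hand side is \<open>(Lie\<^sub>E \<circ>)(X, Y)\<close>.\<close>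

definition bi_flat_F_manifold :: "'i set \<Rightarrow> ('i \<Rightarrow> 'k::real_normed_field) set \<Rightarrow>
    ('i, 'k) symbols \<Rightarrow> ('i, 'k) symbols \<Rightarrow> ('i, 'k) symbols \<Rightarrow> ('i, 'k) symbols \<Rightarrow>
    ('i, 'k) vfield \<Rightarrow> ('i, 'k) vfield \<Rightarrow> bool" where
  "bi_flat_F_manifold I U \<Gamma> \<Gamma>s c cs e E \<longleftrightarrow>
     flat_F_manifold I U \<Gamma> c e \<and>
     flat_F_manifold I U \<Gamma>s cs E \<and>
     (\<exists>W. is_tensor11 I U W \<and> tensor_inverse I U (mult_tensor I c E) W \<and>
        (\<forall>X Y. is_vfield I U X \<longrightarrow> is_vfield I U Y \<longrightarrow>
           vf_eq I U (vprod I cs X Y) (tensor_app I W (vprod I c X Y)))) \<and>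
     vf_eq I U (bracket I e E) e \<and>
     (\<forall>X Y. is_vfield I U X \<longrightarrow> is_vfield I U Y \<longrightarrow>
        vf_eq I U
          (\<lambda>k u. bracket I E (vprod I c X Y) k u - vprod I c (bracket I E X) Y k u
                 - vprod I c X (bracket I E Y) k u)
          (vprod I c X Y)) \<and>
     (\<forall>X. is_vfield I U X \<longrightarrow>
        symbols_eq I U (d_nabla I \<Gamma> (mult_tensor I c X)) (d_nabla I \<Gamma>s (mult_tensor I c X)))"


section \<open>The data of the structure\<close>

text \<open>
  The label \<open>(\<alpha>, i)\<close> stands for \<open>i(\<alpha>)\<close>. Index arithmetic below is on natural numbers, with
  truncated subtraction and all additions first: a difference such as \<open>k + 2 - i - j\<close> is \<open>0\<close>
  when the true value is at most \<open>0\<close>, and every symbol vanishes at the index \<open>0\<close>.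
\<close>

definition idx :: "nat \<Rightarrow> (nat \<Rightarrow> nat) \<Rightarrow> (nat \<times> nat) set" where
  "idx r m = (SIGMA \<alpha>:{1..r}. {1..m \<alpha>})"

definition dom_U :: "nat \<Rightarrow> (nat \<Rightarrow> nat) \<Rightarrow> (nat \<times> nat \<Rightarrow> 'k::real_normed_field) set" where
  "dom_U r m = {u \<in> extensional (idx r m).
     (\<forall>\<alpha>\<in>{1..r}. u (\<alpha>, 1) \<noteq> 0) \<and>
     (\<forall>\<alpha>\<in>{1..r}. \<forall>\<beta>\<in>{1..r}. \<alpha> \<noteq> \<beta> \<longrightarrow> u (\<alpha>, 1) \<noteq> u (\<beta>, 1)) \<and>
     (\<forall>\<alpha>\<in>{1..r}. m \<alpha> \<ge> 2 \<longrightarrow> u (\<alpha>, 2) \<noteq> 0)}"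

fun prod_c :: "(nat \<times> nat, 'k::real_normed_field) symbols" where
  "prod_c (\<gamma>, k) (\<alpha>, i) (\<beta>, j) u = (if \<gamma> = \<alpha> \<and> \<gamma> = \<beta> \<and> k = i + j - 1 then 1 else 0)"

fun unit_e :: "(nat \<times> nat, 'k::real_normed_field) vfield" where
  "unit_e (\<alpha>, i) u = (if i = 1 then 1 else 0)"

definition euler_E :: "(nat \<times> nat, 'k::real_normed_field) vfield" where
  "euler_E p u = u p"

text \<open>The vector field \<open>E\<^sup>-\<^sup>1\<close> with \<open>E\<^sup>-\<^sup>1 \<circ> E = e\<close>, its symbols with an index out of range being zero.\<close>

definition inv_E :: "nat \<Rightarrow> (nat \<Rightarrow> nat) \<Rightarrow> (nat \<times> nat, 'k::real_normed_field) vfield" where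
  "inv_E r m p u =
     (THE w. (\<forall>q. q \<notin> idx r m \<longrightarrow> w q = 0) \<and>
        (\<forall>q\<in>idx r m. vprod (idx r m) prod_c (\<lambda>s _. w s) euler_E q u = unit_e q u)) p"

text \<open>\<open>gam_mixed m \<epsilon> \<alpha> \<beta> k u\<close> is \<open>\<Gamma>\<^sup>k\<^sup>(\<^sup>\<alpha>\<^sup>)\<close> with lower indices \<open>1(\<beta>)\<close> and \<open>1(\<alpha>)\<close>, for \<open>\<alpha> \<noteq> \<beta>\<close>.\<close>

fun gam_mixed :: "(nat \<Rightarrow> nat) \<Rightarrow> (nat \<Rightarrow> 'k::real_normed_field) \<Rightarrow> nat \<Rightarrow> nat \<Rightarrow> nat \<Rightarrow>
    (nat \<times> nat, 'k) scalar_field" where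
  "gam_mixed m \<epsilon> \<alpha> \<beta> k u =
     (if k = 0 then 0
      else if k = 1 then of_nat (m \<beta>) * \<epsilon> \<beta> / (u (\<alpha>, 1) - u (\<beta>, 1))
      else - (1 / (u (\<alpha>, 1) - u (\<beta>, 1))) *
             (\<Sum>s\<in>{2..k}. gam_mixed m \<epsilon> \<alpha> \<beta> (k + 1 - s) u * u (\<alpha>, s)))"

declare gam_mixed.simps [simp del]

text \<open>\<open>gam_11 r m \<epsilon> \<alpha> k u\<close> is \<open>\<Gamma>\<^sup>k\<^sup>(\<^sup>\<alpha>\<^sup>)\<close> with both lower indices \<open>1(\<alpha>)\<close>.\<close>

definition gam_11 :: "nat \<Rightarrow> (nat \<Rightarrow> nat) \<Rightarrow> (nat \<Rightarrow> 'k::real_normed_field) \<Rightarrow> nat \<Rightarrow> nat \<Rightarrow>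
    (nat \<times> nat, 'k) scalar_field" where
  "gam_11 r m \<epsilon> \<alpha> k u = - (\<Sum>\<sigma>\<in>{1..r} - {\<alpha>}. gam_mixed m \<epsilon> \<alpha> \<sigma> k u)"

text \<open>\<open>gam_22 r m \<epsilon> \<alpha> p u\<close> is \<open>\<Gamma>\<^sup>p\<^sup>(\<^sup>\<alpha>\<^sup>)\<close> with both lower indices \<open>2(\<alpha>)\<close>.\<close>

fun gam_22 :: "nat \<Rightarrow> (nat \<Rightarrow> nat) \<Rightarrow> (nat \<Rightarrow> 'k::real_normed_field) \<Rightarrow> nat \<Rightarrow> nat \<Rightarrow>
    (nat \<times> nat, 'k) scalar_field" where
  "gam_22 r m \<epsilon> \<alpha> p u =
     (if p < 2 then 0
      else if p = 2 then - (of_nat (m \<alpha>) * \<epsilon> \<alpha> / u (\<alpha>, 2))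
      else gam_11 r m \<epsilon> \<alpha> (p - 2) u - gam_22 r m \<epsilon> \<alpha> 2 u * (u (\<alpha>, p) / u (\<alpha>, 2))
           - 1 / u (\<alpha>, 2) *
             (\<Sum>l\<in>{1..p - 3}. (gam_22 r m \<epsilon> \<alpha> (l + 2) u - gam_11 r m \<epsilon> \<alpha> l u) * u (\<alpha>, p - l)))"

declare gam_22.simps [simp del]

text \<open>
  The Christoffel symbols of \<open>\<nabla>\<close>, upper index \<open>k(\<gamma>)\<close>, lower indices \<open>i(\<alpha>)\<close> and \<open>j(\<beta>)\<close>.
\<close>

fun Gam :: "nat \<Rightarrow> (nat \<Rightarrow> nat) \<Rightarrow> (nat \<Rightarrow> 'k::real_normed_field) \<Rightarrow> (nat \<times> nat, 'k) symbols" where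
  "Gam r m \<epsilon> (\<gamma>, k) (\<alpha>, i) (\<beta>, j) u =
     (if \<alpha> \<noteq> \<beta> then
        (if \<gamma> = \<beta> then (if i = 1 then gam_mixed m \<epsilon> \<gamma> \<alpha> (k + 1 - j) u else 0)
         else if \<gamma> = \<alpha> then (if j = 1 then gam_mixed m \<epsilon> \<gamma> \<beta> (k + 1 - i) u else 0)
         else 0)
      else if \<gamma> \<noteq> \<alpha> then (if i = 1 \<and> j = 1 then - gam_mixed m \<epsilon> \<gamma> \<alpha> k u else 0)
      else if i = 1 then - (\<Sum>\<sigma>\<in>{1..r} - {\<alpha>}. gam_mixed m \<epsilon> \<alpha> \<sigma> (k + 1 - j) u)
      else if j = 1 then - (\<Sum>\<sigma>\<in>{1..r} - {\<alpha>}. gam_mixed m \<epsilon> \<alpha> \<sigma> (k + 1 - i) u)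
      else if k + 2 \<ge> i + j then gam_22 r m \<epsilon> \<alpha> (k + 4 - i - j) u
      else 0)"

fun prod_cs :: "nat \<Rightarrow> (nat \<Rightarrow> nat) \<Rightarrow> (nat \<times> nat, 'k::real_normed_field) symbols" where
  "prod_cs r m (\<alpha>, i) (\<beta>, j) (\<gamma>, k) u =
     (if \<alpha> = \<beta> \<and> \<alpha> = \<gamma> then inv_E r m (\<alpha>, i + 2 - j - k) u else 0)"

fun Gam_s :: "nat \<Rightarrow> (nat \<Rightarrow> nat) \<Rightarrow> (nat \<Rightarrow> 'k::real_normed_field) \<Rightarrow> (nat \<times> nat, 'k) symbols" where
  "Gam_s r m \<epsilon> (\<alpha>, k) (\<beta>, i) (\<gamma>, j) u =
     Gam r m \<epsilon> (\<alpha>, k) (\<beta>, i) (\<gamma>, j) u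
     - (if \<alpha> = \<beta> \<and> \<alpha> = \<gamma> then
          inv_E r m (\<alpha>, k + 2 - i - j) u *
          (if k = 1 then 1 - (\<Sum>\<sigma>\<in>{1..r} - {\<alpha>}. of_nat (m \<sigma>) * \<epsilon> \<sigma>)
           else 1 - (\<Sum>\<tau>\<in>{1..r}. of_nat (m \<tau>) * \<epsilon> \<tau>))
        else 0)
     - (if \<alpha> \<noteq> \<beta> \<and> \<beta> = \<gamma> \<and> i = 1 \<and> j = 1 \<and> k = 1
        then of_nat (m \<beta>) * \<epsilon> \<beta> / u (\<beta>, 1) else 0)"

definition tensor_L :: "nat \<Rightarrow> (nat \<Rightarrow> nat) \<Rightarrow> (nat \<times> nat, 'k::real_normed_field) tensor11" where
  "tensor_L r m = mult_tensor (idx r m) prod_c euler_E"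

definition a0 :: "nat \<Rightarrow> (nat \<Rightarrow> nat) \<Rightarrow> (nat \<Rightarrow> 'k::real_normed_field) \<Rightarrow>
    (nat \<times> nat, 'k) scalar_field" where
  "a0 r m \<epsilon> u = (\<Sum>\<alpha>\<in>{1..r}. of_nat (m \<alpha>) * \<epsilon> \<alpha> * u (\<alpha>, 1))"

definition tensor_L_a0 :: "nat \<Rightarrow> (nat \<Rightarrow> nat) \<Rightarrow> (nat \<Rightarrow> 'k::real_normed_field) \<Rightarrow>
    (nat \<times> nat, 'k) tensor11" where
  "tensor_L_a0 r m \<epsilon> i k u = tensor_L r m i k u - a0 r m \<epsilon> u * (if i = k then 1 else 0)"

end

theory Submission
  imports Defs
begin

text \<open>
  Write block \<open>a\<close> of a tangent vector \<open>y\<close> as a power series modulo \<open>X\<close> to the power \<open>m a\<close>, with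
  leading coefficient \<open>y\<^sub>a\<close>, and put \<open>c\<^sub>b = m\<^sub>b \<epsilon>\<^sub>b\<close> and \<open>Q\<^sub>b(y) = (y - y\<^sub>b) / (u - u\<^sub>b)\<close>. The recursions for
  the Christoffel symbols are those for reciprocals of power series, and they amount to
  \<open>\<Gamma>(y, z) = - \<Sum>\<^sub>b c\<^sub>b Q\<^sub>b(y) (z - z\<^sub>b)\<close>; for \<open>\<Gamma>\<^sup>*\<close> one adds a multiple of \<open>y z / u\<close> and of
  \<open>\<Sum>\<^sub>b c\<^sub>b y\<^sub>b z\<^sub>b / u\<^sub>b\<close>. Since \<open>\<partial>\<^sub>x Q\<^sub>b(y) = - Q\<^sub>b(x) Q\<^sub>b(y)\<close>, the derivative terms of the curvature
  cancel, and the quadratic terms cancel pairwise in the two summation indices.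

  For uniqueness, let \<open>T\<close> be the difference of two connections with the required properties. It is
  symmetric, \<open>T(x, e) = 0\<close>, the condition on \<open>L - a\<^sub>0 I\<close> gives \<open>T(x, E y) = T(y, E x)\<close>, and
  flatness of the whole pencil gives \<open>T(x, y z) + x T(y, z) = T(y, x z) + y T(x, z)\<close>. Hence
  \<open>T(x, E) = 0\<close> and \<open>T(x, E z) = E T(x, z)\<close>, so \<open>T\<close> vanishes because \<open>E\<close> generates the algebra.
\<close>

section \<open>Partial derivatives and smooth functions\<close>

text \<open>On \<open>U\<close> the field \<open>E\<close> is regular: its blocks have distinct
  leading coefficients and, as \<open>u (a, 2)\<close> is nonzero when \<open>m a \<ge> 2\<close>,
  each is a single Jordan block. Hence the quotients Q_b make sense, even for b = a, where numerator
  and denominator are both divisible by the variable; and \<open>E\<close> generates.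

  Both connections and all their deformations form one family: on a block the product is kappa y z
  with kappa = 1 or 1/u, and to the sum over b one adds mu kappa y z and subtracts nu sum_b c_b y_b
  z_b / u_b, with nu = 0 or 1. The parameter of the pencil changes only mu, so one identity valid
  for every mu gives all the flatness. The value of mu for the dual connection comes from the
  condition that \<open>E\<close> be parallel: in - sum_b c_b Q_b(y) (u - u_b) the quotients cancel,
  the nu term removes the constants sum_b c_b y_b, and the required - y is left exactly for mu =
  sum_b c_b - 1.

  The dual connection is tied to the first one: its difference T from another candidate satisfies
  T(x, w y) = T(y, w x) for all w, and T(x, E) = 0; taking y = \<open>E\<close> shows that T
  vanishes, since \<open>E\<close> is invertible.\<close>

definition has_pd :: "'i \<Rightarrow> ('i, 'k::real_normed_field) scalar_field \<Rightarrow> ('i \<Rightarrow> 'k) \<Rightarrow> 'k \<Rightarrow> bool" where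
  "has_pd p f u D \<longleftrightarrow> ((\<lambda>t. f (u(p := t))) has_field_derivative D) (at (u p))"

lemma has_pd_imp_pd: "has_pd p f u D \<Longrightarrow> pd p f u = D"
  unfolding has_pd_def pd_def by (rule DERIV_imp_deriv)

lemma has_pd_const: "has_pd p (\<lambda>u. c) u 0"
  by (simp add: has_pd_def)

lemma has_pd_coord: "has_pd p (\<lambda>u. u q) u (if q = p then 1 else 0)"
  by (simp add: has_pd_def)

lemma has_pd_add:
  "has_pd p f u D \<Longrightarrow> has_pd p g u D' \<Longrightarrow> has_pd p (\<lambda>u. f u + g u) u (D + D')"
  unfolding has_pd_def by (rule DERIV_add)

lemma has_pd_diff:
  "has_pd p f u D \<Longrightarrow> has_pd p g u D' \<Longrightarrow> has_pd p (\<lambda>u. f u - g u) u (D - D')"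
  unfolding has_pd_def by (rule DERIV_diff)

lemma has_pd_minus: "has_pd p f u D \<Longrightarrow> has_pd p (\<lambda>u. - f u) u (- D)"
  unfolding has_pd_def by (rule DERIV_minus)

lemma has_pd_mult:
  assumes "has_pd p f u D" "has_pd p g u D'"
  shows "has_pd p (\<lambda>u. f u * g u) u (D * g u + f u * D')"
  using DERIV_mult[OF assms[unfolded has_pd_def]] by (simp add: has_pd_def mult.commute)

lemma has_pd_sum:
  assumes "\<And>i. i \<in> A \<Longrightarrow> has_pd p (f i) u (D i)"
  shows "has_pd p (\<lambda>u. \<Sum>i\<in>A. f i u) u (\<Sum>i\<in>A. D i)"
  using assms unfolding has_pd_def by (intro DERIV_sum) auto

lemma has_pd_inverse:
  assumes "has_pd p f u D" "f u \<noteq> 0"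
  shows "has_pd p (\<lambda>u. inverse (f u)) u (- (inverse (f u) * D * inverse (f u)))"
  using DERIV_inverse'[OF assms(1)[unfolded has_pd_def]] assms(2)
  by (simp add: has_pd_def)

section \<open>Coordinate lines in the domain and locality of partial derivatives\<close>

lemma coord_domain_finite: "coord_domain I U \<Longrightarrow> finite I"
  by (simp add: coord_domain_def)

lemma coord_domain_extensional: "coord_domain I U \<Longrightarrow> u \<in> U \<Longrightarrow> u \<in> extensional I"
  using openin_imp_subset by (fastforce simp: coord_domain_def)

lemma open_upd2:
  assumes "coord_domain I U" "u \<in> extensional I" "p \<in> I" "q \<in> I"
  shows "open {st. u(p := u p + fst st, q := u q + snd st) \<in> U}"
proof -
  obtain V where V: "open V" "U = extensional I \<inter> V"
    using assms(1) by (auto simp: coord_domain_def openin_open)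
  have cont: "continuous_on UNIV (\<lambda>st. u(p := u p + fst st, q := u q + snd st))"
  proof (rule continuous_on_coordinatewise_then_product)
    fix i
    show "continuous_on UNIV (\<lambda>st. (u(p := u p + fst st, q := u q + snd st)) i)"
      by (cases "i = q"; cases "i = p") (auto intro!: continuous_intros)
  qed
  have ext: "u(p := s, q := t) \<in> extensional I" for s t
    using assms by (auto simp: extensional_def)
  have "{st. u(p := u p + fst st, q := u q + snd st) \<in> U} =
     (\<lambda>st. u(p := u p + fst st, q := u q + snd st)) -` V"
    using V ext by auto
  then show ?thesis
    using open_vimage[OF V(1) cont] by simp
qed

lemma eventually_upd_in:
  assumes "coord_domain I U" "u \<in> U" "p \<in> I"
  shows "\<forall>\<^sub>F t in nhds (u p). u(p := t) \<in> U"
proof -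
  obtain V where V: "open V" "U = extensional I \<inter> V"
    using assms(1) by (auto simp: coord_domain_def openin_open)
  have cont: "continuous_on UNIV (\<lambda>t. u(p := t))"
  proof (rule continuous_on_coordinatewise_then_product)
    fix i
    show "continuous_on UNIV (\<lambda>t. (u(p := t)) i)"
      by (cases "i = p") (auto intro!: continuous_intros)
  qed
  have ext: "u(p := s) \<in> extensional I" for s
    using assms V by (auto simp: extensional_def)
  have "\<forall>\<^sub>F t in nhds (u p). u(p := t) \<in> V"
    using open_vimage[OF V(1) cont] assms V
    by (intro eventually_nhds[THEN iffD2] exI[of _ "(\<lambda>t. u(p := t)) -` V"]) auto
  then show ?thesis
    by eventually_elim (use V ext in auto)
qed

lemma has_pd_cong:
  assumes "coord_domain I U" "u \<in> U" "p \<in> I" "\<And>v. v \<in> U \<Longrightarrow> f v = g v"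
  shows "has_pd p f u D \<longleftrightarrow> has_pd p g u D"
  unfolding has_pd_def
  by (intro DERIV_cong_ev refl eventually_mono[OF eventually_upd_in[OF assms(1-3)]] assms(4))

lemma pd_cong:
  assumes "coord_domain I U" "u \<in> U" "p \<in> I" "\<And>v. v \<in> U \<Longrightarrow> f v = g v"
  shows "pd p f u = pd p g u"
  unfolding pd_def
  by (intro deriv_cong_ev refl eventually_mono[OF eventually_upd_in[OF assms(1-3)]] assms(4))

lemma field_differentiable_cong_upd:
  assumes "coord_domain I U" "u \<in> U" "p \<in> I" "\<And>v. v \<in> U \<Longrightarrow> f v = g v"
  shows "(\<lambda>t. f (u(p := t))) field_differentiable at (u p) \<longleftrightarrow>
    (\<lambda>t. g (u(p := t))) field_differentiable at (u p)"
  using has_pd_cong[OF assms(1-3), of f g] assms(4) by (simp add: field_differentiable_def has_pd_def)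

section \<open>Classes of differentiability and smooth functions\<close>

lemma Ck_on_cong:
  assumes "coord_domain I U" "\<And>v. v \<in> U \<Longrightarrow> f v = g v" "Ck_on n I U f"
  shows "Ck_on n I U g"
  using assms(2,3)
proof (induction n arbitrary: f g)
  case 0
  then show ?case using continuous_on_cong[of U U f g] by simp
next
  case (Suc n)
  have "Ck_on n I U (pd p g)" if "p \<in> I" for p
    by (rule Suc.IH[of "pd p f"]) (use Suc.prems that pd_cong[OF assms(1) _ that Suc.prems(1)] in auto)
  moreover have "continuous_on U g"
    using continuous_on_cong[of U U f g] Suc.prems by simp
  ultimately show ?case
    using Suc.prems field_differentiable_cong_upd[OF assms(1), of _ _ f g] by auto
qed

lemma Ck_on_Suc_D: "Ck_on (Suc n) I U f \<Longrightarrow> Ck_on n I U f"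
proof (induction n arbitrary: f)
  case (Suc n)
  then have "Ck_on n I U (pd p f)" if "p \<in> I" for p
    using that by auto
  then show ?case using Suc.prems by auto
qed simp

lemma Ck_on_const:
  fixes U :: "('a \<Rightarrow> 'b::real_normed_field) set"
  shows "Ck_on n I U (\<lambda>u. c)"
proof (induction n arbitrary: c)
  case (Suc n)
  have "pd p (\<lambda>u::'a \<Rightarrow> 'b. c) = (\<lambda>u. 0)" for p c
    by (rule ext, rule has_pd_imp_pd, rule has_pd_const)
  then show ?case using Suc by auto
qed simp

lemma Ck_on_coord:
  fixes U :: "('a \<Rightarrow> 'b::real_normed_field) set"
  shows "Ck_on n I U (\<lambda>u. u q)"
proof (cases n)
  case (Suc k)
  have "pd p (\<lambda>u::'a \<Rightarrow> 'b. u q) = (\<lambda>u. if q = p then 1 else 0)" for p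
    by (rule ext, rule has_pd_imp_pd, rule has_pd_coord)
  moreover have "(\<lambda>t. (u(p := t)) q) field_differentiable at (u p)" for u :: "'a \<Rightarrow> 'b" and p
    using has_pd_coord[of p q u] unfolding field_differentiable_def has_pd_def by blast
  moreover have "continuous_on U (\<lambda>u::'a \<Rightarrow> 'b. u q)"
    by (rule continuous_on_product_coordinates[THEN continuous_on_subset]) auto
  moreover have "Ck_on k I U (\<lambda>u. if q = p then 1 else 0)" for p
    by (rule Ck_on_const)
  ultimately show ?thesis using Suc by simp
next
  case 0
  then show ?thesis
    using continuous_on_product_coordinates[THEN continuous_on_subset] by auto
qed

lemma Ck_on_Suc_has_pd:
  "Ck_on (Suc n) I U f \<Longrightarrow> u \<in> U \<Longrightarrow> p \<in> I \<Longrightarrow> has_pd p f u (pd p f u)"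
  by (simp add: has_pd_def pd_def field_differentiable_derivI)

text \<open>On an open set any functions \<open>D p\<close> that are the derivatives there may stand
  in for the total function \<open>pd p f\<close>, so the closure rules below only need explicit
  derivative formulas.\<close>

lemma Ck_on_SucI:
  assumes "coord_domain I U" "continuous_on U f"
    "\<And>p u. p \<in> I \<Longrightarrow> u \<in> U \<Longrightarrow> has_pd p f u (D p u)" "\<And>p. p \<in> I \<Longrightarrow> Ck_on n I U (D p)"
  shows "Ck_on (Suc n) I U f"
proof -
  have "Ck_on n I U (pd p f)" if "p \<in> I" for p
    by (rule Ck_on_cong[OF assms(1) _ assms(4)[OF that]])
      (use has_pd_imp_pd[OF assms(3)[OF that]] in auto)
  moreover have "(\<lambda>t. f (u(p := t))) field_differentiable at (u p)" if "p \<in> I" "u \<in> U" for p u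
    using assms(3)[OF that] unfolding has_pd_def field_differentiable_def by blast
  ultimately show ?thesis using assms(2) by simp
qed

lemma Ck_on_continuous: "Ck_on n I U f \<Longrightarrow> continuous_on U f"
  by (cases n) auto

lemma Ck_on_pd: "Ck_on (Suc n) I U f \<Longrightarrow> p \<in> I \<Longrightarrow> Ck_on n I U (pd p f)"
  by simp

lemma Ck_on_add:
  assumes "coord_domain I U" "Ck_on n I U f" "Ck_on n I U g"
  shows "Ck_on n I U (\<lambda>u. f u + g u)"
  using assms(2,3)
proof (induction n arbitrary: f g)
  case (Suc n)
  show ?case
    by (rule Ck_on_SucI[OF assms(1), where D = "\<lambda>p u. pd p f u + pd p g u"])
      (use Suc in \<open>auto intro!: continuous_on_add has_pd_add Ck_on_Suc_has_pd
        simp del: Ck_on.simps(2) intro: Ck_on_continuous Ck_on_pd\<close>)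
qed (auto intro: continuous_on_add)

lemma Ck_on_mult:
  assumes "coord_domain I U" "Ck_on n I U f" "Ck_on n I U g"
  shows "Ck_on n I U (\<lambda>u. f u * g u)"
  using assms(2,3)
proof (induction n arbitrary: f g)
  case (Suc n)
  show ?case
    by (rule Ck_on_SucI[OF assms(1), where D = "\<lambda>p u. pd p f u * g u + f u * pd p g u"])
      (use Suc in \<open>auto intro!: continuous_on_mult has_pd_mult Ck_on_Suc_has_pd Ck_on_add assms(1)
        simp del: Ck_on.simps(2) intro: Ck_on_continuous Ck_on_pd Ck_on_Suc_D\<close>)
qed (auto intro: continuous_on_mult)

lemma Ck_on_inverse:
  assumes "coord_domain I U" "Ck_on n I U f" "\<And>u. u \<in> U \<Longrightarrow> f u \<noteq> 0"
  shows "Ck_on n I U (\<lambda>u. inverse (f u))"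
  using assms(2,3)
proof (induction n)
  case 0
  then show ?case by (auto intro: continuous_on_inverse)
next
  case (Suc n)
  \<comment> \<open>The derivative of the reciprocal contains the reciprocal again, so its
    regularity of order \<open>n\<close> is needed before that of order
    \<open>Suc n\<close>.\<close>
  have *: "Ck_on n I U (\<lambda>u. inverse (f u))"
    using Suc by (intro Suc.IH) (auto simp del: Ck_on.simps(2) intro: Ck_on_Suc_D)
  show ?case
  proof (rule Ck_on_SucI[OF assms(1), where D = "\<lambda>p u. (- 1) * ((inverse (f u) * pd p f u) * inverse (f u))"])
    show "continuous_on U (\<lambda>u. inverse (f u))"
      using Ck_on_continuous[OF *] .
    show "has_pd p (\<lambda>u. inverse (f u)) u (- 1 * (inverse (f u) * pd p f u * inverse (f u)))"
      if "p \<in> I" "u \<in> U" for p u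
      using has_pd_inverse[where f = f, OF Ck_on_Suc_has_pd[where f = f, OF Suc.prems(1) that(2,1)] Suc.prems(2)[OF that(2)]]
      by simp
    show "Ck_on n I U (\<lambda>u. - 1 * (inverse (f u) * pd p f u * inverse (f u)))" if "p \<in> I" for p
      using that Suc.prems(1) by (intro Ck_on_mult assms(1) * Ck_on_const Ck_on_pd)
  qed
qed

lemma smooth_const: "smooth_fn I U (\<lambda>u. c)"
  by (simp add: smooth_fn_def Ck_on_const)

lemma smooth_coord: "smooth_fn I U (\<lambda>u. u q)"
  by (simp add: smooth_fn_def Ck_on_coord)

lemma smooth_add:
  "coord_domain I U \<Longrightarrow> smooth_fn I U f \<Longrightarrow> smooth_fn I U g \<Longrightarrow> smooth_fn I U (\<lambda>u. f u + g u)"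
  by (simp add: smooth_fn_def Ck_on_add)

lemma smooth_mult:
  "coord_domain I U \<Longrightarrow> smooth_fn I U f \<Longrightarrow> smooth_fn I U g \<Longrightarrow> smooth_fn I U (\<lambda>u. f u * g u)"
  by (simp add: smooth_fn_def Ck_on_mult)

lemma smooth_minus: "coord_domain I U \<Longrightarrow> smooth_fn I U f \<Longrightarrow> smooth_fn I U (\<lambda>u. - f u)"
  using smooth_mult[OF _ smooth_const[of I U "-1"], of f] by simp

lemma smooth_diff:
  "coord_domain I U \<Longrightarrow> smooth_fn I U f \<Longrightarrow> smooth_fn I U g \<Longrightarrow> smooth_fn I U (\<lambda>u. f u - g u)"
  using smooth_add[OF _ _ smooth_minus, of I U f g] by simp

lemma smooth_sum:
  assumes "coord_domain I U" "\<And>i. i \<in> A \<Longrightarrow> smooth_fn I U (f i)"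
  shows "smooth_fn I U (\<lambda>u. \<Sum>i\<in>A. f i u)"
  using assms(2)
  by (induction A rule: infinite_finite_induct) (auto intro!: smooth_const smooth_add assms(1))

lemma smooth_inverse:
  "coord_domain I U \<Longrightarrow> smooth_fn I U f \<Longrightarrow> (\<And>u. u \<in> U \<Longrightarrow> f u \<noteq> 0) \<Longrightarrow>
    smooth_fn I U (\<lambda>u. inverse (f u))"
  by (simp add: smooth_fn_def Ck_on_inverse)

lemma smooth_pd: "smooth_fn I U f \<Longrightarrow> p \<in> I \<Longrightarrow> smooth_fn I U (pd p f)"
  by (auto simp: smooth_fn_def intro!: Ck_on_pd simp del: Ck_on.simps)

lemma smooth_cong:
  "coord_domain I U \<Longrightarrow> smooth_fn I U f \<Longrightarrow> (\<And>v. v \<in> U \<Longrightarrow> f v = g v) \<Longrightarrow> smooth_fn I U g"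
  by (auto simp: smooth_fn_def simp del: Ck_on.simps intro: Ck_on_cong[of I U f g])

lemma smooth_has_pd: "smooth_fn I U f \<Longrightarrow> u \<in> U \<Longrightarrow> p \<in> I \<Longrightarrow> has_pd p f u (pd p f u)"
  by (rule Ck_on_Suc_has_pd[of 0]) (simp_all add: smooth_fn_def del: Ck_on.simps)

lemma smooth_continuous: "smooth_fn I U f \<Longrightarrow> continuous_on U f"
  by (rule Ck_on_continuous[of 0 I]) (simp_all add: smooth_fn_def del: Ck_on.simps)

text \<open>The second difference of \<open>f\<close> in the directions \<open>p, q\<close> is symmetric and, to second
  order, equals \<open>h\<^sup>2\<close> times either mixed partial derivative.\<close>

lemma second_difference:
  fixes f :: "('i, 'k::real_normed_field) scalar_field"
  assumes dom: "coord_domain I U" and f: "smooth_fn I U f" and u: "u \<in> U"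
    and p: "p \<in> I" and q: "q \<in> I" and pq: "p \<noteq> q" and \<epsilon>: "\<epsilon> > 0"
  shows "\<exists>d>0. \<forall>h. norm h < d \<longrightarrow>
    norm (f (u(p := u p + h, q := u q + h)) - f (u(p := u p + h)) - f (u(q := u q + h)) + f u
      - h * h * pd q (pd p f) u) \<le> \<epsilon> * norm h * norm h"
proof -
  define c where "c s t = u(p := u p + s, q := u q + t)" for s t
  have c0: "c 0 0 = u" by (simp add: c_def)
  have cp: "(c s t)(p := x) = c (x - u p) t" "(c s t)(q := x) = c s (x - u q)" for s t x
    using pq by (auto simp: c_def fun_upd_twist)
  have cc: "c s t p = u p + s" "c s t q = u q + t" for s t
    using pq by (auto simp: c_def)
  define S where "S = {st. c (fst st) (snd st) \<in> U}"
  have S: "open S"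
    using open_upd2[OF dom coord_domain_extensional[OF dom u] p q] by (simp add: S_def c_def)
  have "continuous_on S (\<lambda>st. c (fst st) (snd st))"
    unfolding c_def
  proof (rule continuous_on_coordinatewise_then_product)
    fix i
    show "continuous_on S (\<lambda>st. (u(p := u p + fst st, q := u q + snd st)) i)"
      by (cases "i = q"; cases "i = p") (auto intro!: continuous_intros)
  qed
  then have "continuous_on S (\<lambda>st. pd q (pd p f) (c (fst st) (snd st)))"
    by (rule continuous_on_compose2[where g = "pd q (pd p f)" and t = U and s = S and
        f = "\<lambda>st. c (fst st) (snd st)", OF smooth_continuous[OF smooth_pd[OF smooth_pd[OF f p] q]]])
      (auto simp: S_def)
  then have "isCont (\<lambda>st. pd q (pd p f) (c (fst st) (snd st))) (0, 0)"
    using S c0 u by (simp add: continuous_on_eq_continuous_at S_def)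
  then have "\<exists>d>0. \<forall>st. dist st (0, 0) < d \<longrightarrow>
      dist (pd q (pd p f) (c (fst st) (snd st))) (pd q (pd p f) u) < \<epsilon>"
    using \<epsilon> c0 by (simp add: continuous_at_eps_delta)
  then obtain d1 where d1: "d1 > 0" and d1': "\<And>st. dist st (0, 0) < d1 \<Longrightarrow>
      dist (pd q (pd p f) (c (fst st) (snd st))) (pd q (pd p f) u) < \<epsilon>"
    by auto
  have "(0, 0) \<in> S" using c0 u by (simp add: S_def)
  then obtain d2 where d2: "d2 > 0" and d2': "\<And>st. dist st (0, 0) < d2 \<Longrightarrow> st \<in> S"
    using S unfolding open_dist by blast
  \<comment> \<open>Half the radius, because the norm of a pair is at most the sum of the two
    norms.\<close>
  define d where "d = min d1 d2 / 2"
  have near: "c s t \<in> U" "norm (pd q (pd p f) (c s t) - pd q (pd p f) u) \<le> \<epsilon>"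
    if "norm s < d" "norm t < d" for s t
  proof -
    have "dist (s, t) (0, 0) < min d1 d2"
      using norm_Pair_le[of s t] that by (simp add: dist_norm d_def zero_prod_def)
    then show "c s t \<in> U" "norm (pd q (pd p f) (c s t) - pd q (pd p f) u) \<le> \<epsilon>"
      using d1'[of "(s, t)"] d2'[of "(s, t)"] by (auto simp: S_def dist_norm)
  qed
  have der: "((\<lambda>s. g (c s t)) has_field_derivative pd p g (c s t)) (at s)"
    "((\<lambda>t. g (c s t)) has_field_derivative pd q g (c s t)) (at t)"
    if "smooth_fn I U g" "norm s < d" "norm t < d" for g s t
  proof -
    have "((\<lambda>x. g (c (x - u p) t)) has_field_derivative pd p g (c s t)) (at (s + u p))"
      using smooth_has_pd[OF that(1) near(1)[OF that(2,3)] p] by (simp add: has_pd_def cp cc add.commute)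
    then show "((\<lambda>s. g (c s t)) has_field_derivative pd p g (c s t)) (at s)"
      unfolding DERIV_shift by simp
    have "((\<lambda>x. g (c s (x - u q))) has_field_derivative pd q g (c s t)) (at (t + u q))"
      using smooth_has_pd[OF that(1) near(1)[OF that(2,3)] q] by (simp add: has_pd_def cp cc add.commute)
    then show "((\<lambda>t. g (c s t)) has_field_derivative pd q g (c s t)) (at t)"
      unfolding DERIV_shift by simp
  qed
  let ?A = "pd q (pd p f) u"
  show ?thesis
  proof (intro exI[of _ d] conjI allI impI)
    show "d > 0" using d1 d2 by (simp add: d_def)
    fix h :: 'k assume h: "norm h < d"
    let ?S = "cball (0::'k) (norm h)"
    have inS: "norm s < d" if "s \<in> ?S" for s using that h by auto
    \<comment> \<open>Subtracting \<open>t * ?A\<close> leaves a derivative of norm at most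
      \<open>\<epsilon>\<close> in \<open>t\<close>, hence an increment of at most
      \<open>\<epsilon> * norm h\<close>; the same device in \<open>s\<close> below supplies the
      second factor \<open>norm h\<close>.\<close>
    have in1: "norm (pd p f (c s h) - pd p f (c s 0) - h * ?A) \<le> \<epsilon> * norm h" if s: "norm s < d" for s
    proof -
      have "norm ((pd p f (c s h) - h * ?A) - (pd p f (c s 0) - 0 * ?A)) \<le> \<epsilon> * norm (h - 0)"
      proof (rule field_differentiable_bound[where S = ?S and f' = "\<lambda>t. pd q (pd p f) (c s t) - ?A"
            and f = "\<lambda>t. pd p f (c s t) - t * ?A"])
        fix t assume t: "t \<in> ?S"
        show "((\<lambda>t. pd p f (c s t) - t * ?A) has_field_derivative pd q (pd p f) (c s t) - ?A) (at t within ?S)"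
        proof (rule DERIV_diff)
          show "((\<lambda>t. pd p f (c s t)) has_field_derivative pd q (pd p f) (c s t)) (at t within ?S)"
            by (rule has_field_derivative_at_within, rule der(2)[OF smooth_pd[OF f p] s inS[OF t]])
          show "((\<lambda>t. t * ?A) has_field_derivative ?A) (at t within ?S)"
            by (auto intro!: derivative_eq_intros)
        qed
        show "norm (pd q (pd p f) (c s t) - ?A) \<le> \<epsilon>"
          using near(2)[OF s inS[OF t]] .
      qed (simp_all add: dist_norm)
      then show ?thesis by (simp add: algebra_simps)
    qed
    have "norm ((f (c h h) - f (c h 0) - h * (h * ?A)) - (f (c 0 h) - f (c 0 0) - 0 * (h * ?A)))
      \<le> (\<epsilon> * norm h) * norm (h - 0)"
    proof (rule field_differentiable_bound[where S = ?S
          and f' = "\<lambda>s. pd p f (c s h) - pd p f (c s 0) - h * ?A"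
          and f = "\<lambda>s. f (c s h) - f (c s 0) - s * (h * ?A)"])
      fix s assume s: "s \<in> ?S"
      have 0: "norm (0::'k) < d" using h by (simp add: le_less_trans[OF norm_ge_zero])
      show "((\<lambda>s. f (c s h) - f (c s 0) - s * (h * ?A)) has_field_derivative
          pd p f (c s h) - pd p f (c s 0) - h * ?A) (at s within ?S)"
      proof (intro DERIV_diff)
        show "((\<lambda>s. f (c s h)) has_field_derivative pd p f (c s h)) (at s within ?S)"
          by (rule has_field_derivative_at_within, rule der(1)[OF f inS[OF s] h])
        show "((\<lambda>s. f (c s 0)) has_field_derivative pd p f (c s 0)) (at s within ?S)"
          by (rule has_field_derivative_at_within, rule der(1)[OF f inS[OF s] 0])
        show "((\<lambda>s. s * (h * ?A)) has_field_derivative h * ?A) (at s within ?S)"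
          by (auto intro!: derivative_eq_intros)
      qed
      show "norm (pd p f (c s h) - pd p f (c s 0) - h * ?A) \<le> \<epsilon> * norm h"
        using in1[OF inS[OF s]] .
    qed (simp_all add: dist_norm)
    then have "norm (f (c h h) - f (c h 0) - f (c 0 h) + f (c 0 0) - h * h * ?A) \<le> \<epsilon> * norm h * norm h"
      by (simp add: algebra_simps)
    moreover have "c h 0 = u(p := u p + h)" "c 0 h = u(q := u q + h)"
      using pq by (simp_all add: c_def fun_eq_iff)
    ultimately show "norm (f (u(p := u p + h, q := u q + h)) - f (u(p := u p + h)) - f (u(q := u q + h)) + f u
      - h * h * ?A) \<le> \<epsilon> * norm h * norm h"
      by (simp only: c0) (simp only: c_def)
  qed
qed

text \<open>Both mixed derivatives are approximated by the same second difference divided by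
  \<open>h * h\<close>, and that difference does not see the order of the directions.\<close>

lemma pd_commute:
  fixes f :: "('i, 'k::real_normed_field) scalar_field"
  assumes dom: "coord_domain I U" and f: "smooth_fn I U f" and u: "u \<in> U" and p: "p \<in> I" and q: "q \<in> I"
  shows "pd p (pd q f) u = pd q (pd p f) u"
proof (cases "p = q")
  case False
  let ?A = "pd q (pd p f) u" and ?B = "pd p (pd q f) u"
  have "norm (?A - ?B) \<le> e" if e: "e > 0" for e
  proof -
    obtain d1 where d1: "d1 > 0" "\<And>h. norm h < d1 \<Longrightarrow>
      norm (f (u(p := u p + h, q := u q + h)) - f (u(p := u p + h)) - f (u(q := u q + h)) + f u
      - h * h * ?A) \<le> e / 2 * norm h * norm h"
      using second_difference[OF dom f u p q False, of "e / 2"] e by auto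
    obtain d2 where d2: "d2 > 0" "\<And>h. norm h < d2 \<Longrightarrow>
      norm (f (u(q := u q + h, p := u p + h)) - f (u(q := u q + h)) - f (u(p := u p + h)) + f u
      - h * h * ?B) \<le> e / 2 * norm h * norm h"
      using second_difference[OF dom f u q p, of "e / 2"] e False by auto
    \<comment> \<open>A real multiple of 1 has any prescribed norm in every
      \<open>real_normed_field\<close>.\<close>
    define h :: 'k where "h = of_real (min d1 d2 / 2)"
    have h: "norm h < d1" "norm h < d2" "norm h > 0" using d1(1) d2(1) by (auto simp: h_def)
    let ?D = "f (u(p := u p + h, q := u q + h)) - f (u(p := u p + h)) - f (u(q := u q + h)) + f u"
    have sw: "f (u(q := u q + h, p := u p + h)) = f (u(p := u p + h, q := u q + h))"
      using False by (simp add: fun_upd_twist)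
    have 1: "norm (?D - h * h * ?A) \<le> e / 2 * norm h * norm h"
      using d1(2)[OF h(1)] by simp
    have 2: "norm (?D - h * h * ?B) \<le> e / 2 * norm h * norm h"
      using d2(2)[OF h(2)] unfolding sw by (simp add: algebra_simps)
    have "norm ((?D - h * h * ?B) - (?D - h * h * ?A)) \<le> e * norm h * norm h"
      using norm_triangle_ineq4[of "?D - h * h * ?B" "?D - h * h * ?A"] 1 2 by simp
    moreover have "(?D - h * h * ?B) - (?D - h * h * ?A) = h * h * (?A - ?B)"
      by (simp add: algebra_simps)
    ultimately have "norm (?A - ?B) * (norm h * norm h) \<le> e * (norm h * norm h)"
      by (simp add: norm_mult mult_ac)
    then show ?thesis using h(3) by (simp add: mult_le_cancel_right)
  qed
  then have "norm (?A - ?B) \<le> 0" by (rule field_le_epsilon[of _ 0, simplified])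
  then show ?thesis by simp
qed simp

section \<open>Curvature and torsion in coordinates\<close>

definition curv :: "'i set \<Rightarrow> ('i, 'k::real_normed_field) symbols \<Rightarrow> 'i \<Rightarrow> 'i \<Rightarrow> 'i \<Rightarrow> 'i \<Rightarrow>
    ('i \<Rightarrow> 'k) \<Rightarrow> 'k" where
  "curv I \<Gamma> k i j s u = pd i (\<Gamma> k j s) u - pd j (\<Gamma> k i s) u
     + (\<Sum>l\<in>I. \<Gamma> k i l u * \<Gamma> l j s u) - (\<Sum>l\<in>I. \<Gamma> k j l u * \<Gamma> l i s u)"

text \<open>The deformation is again given by symbols, so the coordinate criteria for flatness and
  torsion apply to the whole pencil.\<close>

lemma deformed_cov_eq_cov:
  "deformed_cov I \<Gamma> c l = cov I (\<lambda>k i j u. \<Gamma> k i j u - l * c k i j u)"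
proof (intro ext)
  fix X Y k u
  have "cov I (\<lambda>k i j u. \<Gamma> k i j u - l * c k i j u) X Y k u =
    (\<Sum>i\<in>I. X i u * (pd i (Y k) u + (\<Sum>j\<in>I. \<Gamma> k i j u * Y j u)) - (\<Sum>j\<in>I. l * (c k i j u * X i u * Y j u)))"
    unfolding cov_def
    by (intro sum.cong refl) (simp add: algebra_simps sum_subtractf sum_distrib_left)
  also have "\<dots> = deformed_cov I \<Gamma> c l X Y k u"
    unfolding deformed_cov_def cov_def vprod_def sum_subtractf by (simp add: sum_distrib_left)
  finally show "deformed_cov I \<Gamma> c l X Y k u = cov I (\<lambda>k i j u. \<Gamma> k i j u - l * c k i j u) X Y k u"
    by simp
qed

lemma is_symbols_deformed:
  assumes "coord_domain I U" "is_symbols I U \<Gamma>" "is_symbols I U c"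
  shows "is_symbols I U (\<lambda>k i j u. \<Gamma> k i j u - l * c k i j u)"
  unfolding is_symbols_def
proof (intro ballI)
  fix k i j assume "k \<in> I" "i \<in> I" "j \<in> I"
  then show "smooth_fn I U (\<lambda>u. \<Gamma> k i j u - l * c k i j u)"
    using assms(2,3) by (intro smooth_diff smooth_mult smooth_const assms(1)) (auto simp: is_symbols_def)
qed

lemma pd_cov:
  assumes "coord_domain I U" "is_symbols I U \<Gamma>" "is_vfield I U Y" "is_vfield I U Z"
    "k \<in> I" "i \<in> I" "u \<in> U"
  shows "pd i (cov I \<Gamma> Y Z k) u = (\<Sum>j\<in>I. pd i (Y j) u * (pd j (Z k) u + (\<Sum>l\<in>I. \<Gamma> k j l u * Z l u)))
    + (\<Sum>j\<in>I. Y j u * (pd i (pd j (Z k)) u + (\<Sum>l\<in>I. pd i (\<Gamma> k j l) u * Z l u + \<Gamma> k j l u * pd i (Z l) u)))"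
proof -
  have Y: "has_pd i (Y j) u (pd i (Y j) u)" if "j \<in> I" for j
    using assms that by (auto simp: is_vfield_def intro: smooth_has_pd)
  have Z: "has_pd i (Z j) u (pd i (Z j) u)" if "j \<in> I" for j
    using assms that by (auto simp: is_vfield_def intro: smooth_has_pd)
  have G: "has_pd i (\<Gamma> k j l) u (pd i (\<Gamma> k j l) u)" if "j \<in> I" "l \<in> I" for j l
    using assms that by (auto simp: is_symbols_def intro: smooth_has_pd)
  have Z2: "has_pd i (pd j (Z k)) u (pd i (pd j (Z k)) u)" if "j \<in> I" for j
    using assms that by (intro smooth_has_pd[of I U] smooth_pd) (auto simp: is_vfield_def)
  have "has_pd i (cov I \<Gamma> Y Z k) u (\<Sum>j\<in>I. pd i (Y j) u * (pd j (Z k) u + (\<Sum>l\<in>I. \<Gamma> k j l u * Z l u))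
    + Y j u * (pd i (pd j (Z k)) u + (\<Sum>l\<in>I. pd i (\<Gamma> k j l) u * Z l u + \<Gamma> k j l u * pd i (Z l) u)))"
    unfolding cov_def[abs_def]
    by (rule has_pd_sum, rule has_pd_mult, erule Y, rule has_pd_add, erule Z2,
        rule has_pd_sum, rule has_pd_mult, erule (1) G, erule Z)
  then show ?thesis by (simp add: has_pd_imp_pd sum.distrib)
qed

text \<open>Tensoriality: derivatives of \<open>Z\<close> cancel by symmetry, using that second
  derivatives commute, and derivatives of \<open>X\<close> and \<open>Y\<close> cancel against the
  bracket.\<close>

lemma curvature_fields:
  assumes dom: "coord_domain I U" and G: "is_symbols I U \<Gamma>" and X: "is_vfield I U X"
    and Y: "is_vfield I U Y" and Z: "is_vfield I U Z" and k: "k \<in> I" and u: "u \<in> U"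
  shows "cov I \<Gamma> X (cov I \<Gamma> Y Z) k u - cov I \<Gamma> Y (cov I \<Gamma> X Z) k u - cov I \<Gamma> (bracket I X Y) Z k u
    = (\<Sum>i\<in>I. \<Sum>j\<in>I. \<Sum>s\<in>I. X i u * Y j u * Z s u * curv I \<Gamma> k i j s u)"
proof -
  \<comment> \<open>\<open>H\<close> collects what is free of derivatives of the direction fields in
    an iterated derivative; \<open>F\<close> is the factor of the remaining terms.\<close>
  define H where "H i j = pd i (pd j (Z k)) u
      + (\<Sum>l\<in>I. pd i (\<Gamma> k j l) u * Z l u + \<Gamma> k j l u * pd i (Z l) u)
      + (\<Sum>l\<in>I. \<Gamma> k i l u * (pd j (Z l) u + (\<Sum>s\<in>I. \<Gamma> l j s u * Z s u)))" for i j
  define F where "F j = pd j (Z k) u + (\<Sum>l\<in>I. \<Gamma> k j l u * Z l u)" for j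
  have cc: "cov I \<Gamma> X (cov I \<Gamma> Y Z) k u = (\<Sum>i\<in>I. \<Sum>j\<in>I. X i u * pd i (Y j) u * F j)
      + (\<Sum>i\<in>I. \<Sum>j\<in>I. X i u * Y j u * H i j)" if X: "is_vfield I U X" and Y: "is_vfield I U Y" for X Y
  proof -
    have "X i u * (pd i (cov I \<Gamma> Y Z k) u + (\<Sum>l\<in>I. \<Gamma> k i l u * cov I \<Gamma> Y Z l u)) =
      (\<Sum>j\<in>I. X i u * pd i (Y j) u * F j) + (\<Sum>j\<in>I. X i u * Y j u * H i j)" if i: "i \<in> I" for i
    proof -
      have "(\<Sum>l\<in>I. \<Gamma> k i l u * cov I \<Gamma> Y Z l u) =
          (\<Sum>j\<in>I. Y j u * (\<Sum>l\<in>I. \<Gamma> k i l u * (pd j (Z l) u + (\<Sum>s\<in>I. \<Gamma> l j s u * Z s u))))"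
        unfolding cov_def sum_distrib_left by (subst sum.swap) (simp add: mult_ac)
      then have "pd i (cov I \<Gamma> Y Z k) u + (\<Sum>l\<in>I. \<Gamma> k i l u * cov I \<Gamma> Y Z l u) =
          (\<Sum>j\<in>I. pd i (Y j) u * F j) + (\<Sum>j\<in>I. Y j u * H i j)"
        unfolding pd_cov[OF dom G Y Z k i u] F_def H_def
        by (simp only: distrib_left sum.distrib add.assoc)
      then show ?thesis by (simp add: distrib_left sum_distrib_left mult.assoc)
    qed
    then show ?thesis unfolding cov_def[of I \<Gamma> X "cov I \<Gamma> Y Z"] by (simp add: sum.distrib)
  qed
  have br: "cov I \<Gamma> (bracket I X Y) Z k u = (\<Sum>i\<in>I. \<Sum>j\<in>I. X i u * pd i (Y j) u * F j)
      - (\<Sum>i\<in>I. \<Sum>j\<in>I. Y i u * pd i (X j) u * F j)"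
    unfolding cov_def F_def[symmetric] bracket_def sum_distrib_right left_diff_distrib sum_subtractf
    by (subst sum.swap, subst (2) sum.swap) (rule refl)
  have HH: "H i j - H j i = (\<Sum>s\<in>I. Z s u * curv I \<Gamma> k i j s u)" if "i \<in> I" "j \<in> I" for i j
  proof -
    have Zk: "smooth_fn I U (Z k)" using Z k by (simp add: is_vfield_def)
    have sw: "(\<Sum>l\<in>I. \<Gamma> k i l u * (\<Sum>s\<in>I. \<Gamma> l j s u * Z s u)) =
        (\<Sum>s\<in>I. Z s u * (\<Sum>l\<in>I. \<Gamma> k i l u * \<Gamma> l j s u))" for i j
      unfolding sum_distrib_left by (subst sum.swap) (simp add: mult_ac)
    show ?thesis
      unfolding H_def curv_def pd_commute[OF dom Zk u that]
      by (simp only: distrib_left right_diff_distrib sum.distrib sum_subtractf sw) (simp add: mult_ac)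
  qed
  have "(\<Sum>i\<in>I. \<Sum>j\<in>I. X i u * Y j u * H i j) - (\<Sum>i\<in>I. \<Sum>j\<in>I. Y i u * X j u * H i j) =
     (\<Sum>i\<in>I. \<Sum>j\<in>I. X i u * Y j u * (H i j - H j i))"
    by (subst (2) sum.swap) (simp add: right_diff_distrib sum_subtractf mult_ac)
  also have "\<dots> = (\<Sum>i\<in>I. \<Sum>j\<in>I. \<Sum>s\<in>I. X i u * Y j u * Z s u * curv I \<Gamma> k i j s u)"
    by (intro sum.cong refl) (simp add: HH sum_distrib_left mult.assoc)
  finally show ?thesis unfolding cc[OF X Y] cc[OF Y X] br by simp
qed

lemma is_vfield_const: "is_vfield I U (\<lambda>i u. x i)"
  by (simp add: is_vfield_def smooth_const)

lemma sum_delta_left: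
  fixes f :: "'i \<Rightarrow> 'k::comm_ring_1"
  assumes "finite I" "p \<in> I"
  shows "(\<Sum>i\<in>I. (if i = p then 1 else 0) * f i) = f p" "(\<Sum>i\<in>I. f i * (if i = p then 1 else 0)) = f p"
  using assms by (simp_all add: if_distribR sum.delta mult_delta_left mult_delta_right)

lemma flat_cov_iff:
  assumes dom: "coord_domain I U" and G: "is_symbols I U \<Gamma>"
  shows "flat I U (cov I \<Gamma>) \<longleftrightarrow> (\<forall>k\<in>I. \<forall>i\<in>I. \<forall>j\<in>I. \<forall>s\<in>I. \<forall>u\<in>U. curv I \<Gamma> k i j s u = 0)"
proof
  assume f: "flat I U (cov I \<Gamma>)"
  show "\<forall>k\<in>I. \<forall>i\<in>I. \<forall>j\<in>I. \<forall>s\<in>I. \<forall>u\<in>U. curv I \<Gamma> k i j s u = 0"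
  proof (intro ballI)
    fix k p q r u assume *: "k \<in> I" "p \<in> I" "q \<in> I" "r \<in> I" "u \<in> U"
    let ?d = "\<lambda>p i (u::'a \<Rightarrow> 'b). if i = p then 1 else 0 :: 'b"
    have v: "is_vfield I U (?d p)" for p by (rule is_vfield_const)
    have fin: "finite I" by (rule coord_domain_finite[OF dom])
    have "0 = (\<Sum>i\<in>I. \<Sum>j\<in>I. \<Sum>s\<in>I. ?d p i u * ?d q j u * ?d r s u * curv I \<Gamma> k i j s u)"
      using f v * unfolding curvature_fields[OF dom G v v v *(1,5), symmetric] flat_def by simp
    also have "\<dots> = (\<Sum>i\<in>I. ?d p i u * (\<Sum>j\<in>I. ?d q j u * (\<Sum>s\<in>I. ?d r s u * curv I \<Gamma> k i j s u)))"
      by (simp add: sum_distrib_left mult.assoc)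
    also have "\<dots> = curv I \<Gamma> k p q r u"
      using * by (simp only: sum_delta_left[OF fin])
    finally show "curv I \<Gamma> k p q r u = 0" by simp
  qed
next
  assume *: "\<forall>k\<in>I. \<forall>i\<in>I. \<forall>j\<in>I. \<forall>s\<in>I. \<forall>u\<in>U. curv I \<Gamma> k i j s u = 0"
  show "flat I U (cov I \<Gamma>)"
    unfolding flat_def
  proof (intro allI impI ballI)
    fix X Y Z k u
    assume "is_vfield I U X" "is_vfield I U Y" "is_vfield I U Z" "k \<in> I" "u \<in> U"
    then show "cov I \<Gamma> X (cov I \<Gamma> Y Z) k u - cov I \<Gamma> Y (cov I \<Gamma> X Z) k u - cov I \<Gamma> (bracket I X Y) Z k u = 0"
      using * by (simp add: curvature_fields[OF dom G])
  qed
qed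

lemma torsion_fields:
  "cov I \<Gamma> X Y k u - cov I \<Gamma> Y X k u - bracket I X Y k u =
    (\<Sum>i\<in>I. \<Sum>j\<in>I. X i u * Y j u * (\<Gamma> k i j u - \<Gamma> k j i u))"
proof -
  have c: "cov I \<Gamma> X Y k u = (\<Sum>i\<in>I. X i u * pd i (Y k) u) + (\<Sum>i\<in>I. \<Sum>j\<in>I. X i u * Y j u * \<Gamma> k i j u)" for X Y
    unfolding cov_def by (simp add: distrib_left sum.distrib sum_distrib_left mult_ac)
  have "(\<Sum>i\<in>I. \<Sum>j\<in>I. Y i u * X j u * \<Gamma> k i j u) = (\<Sum>i\<in>I. \<Sum>j\<in>I. X i u * Y j u * \<Gamma> k j i u)"
    by (subst sum.swap) (simp add: mult_ac)
  then show ?thesis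
    unfolding c bracket_def by (simp add: sum_subtractf right_diff_distrib)
qed

lemma torsionless_cov_iff:
  assumes "finite I"
  shows "torsionless I U (cov I \<Gamma>) \<longleftrightarrow> (\<forall>k\<in>I. \<forall>i\<in>I. \<forall>j\<in>I. \<forall>u\<in>U. \<Gamma> k i j u = \<Gamma> k j i u)"
proof
  assume f: "torsionless I U (cov I \<Gamma>)"
  show "\<forall>k\<in>I. \<forall>i\<in>I. \<forall>j\<in>I. \<forall>u\<in>U. \<Gamma> k i j u = \<Gamma> k j i u"
  proof (intro ballI)
    fix k p q u assume *: "k \<in> I" "p \<in> I" "q \<in> I" "u \<in> U"
    let ?d = "\<lambda>p i (u::'a \<Rightarrow> 'b). if i = p then 1 else 0 :: 'b"
    have v: "is_vfield I U (?d p)" for p by (rule is_vfield_const)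
    have "cov I \<Gamma> (?d p) (?d q) k u - cov I \<Gamma> (?d q) (?d p) k u - bracket I (?d p) (?d q) k u = 0"
      using f v * unfolding torsionless_def by simp
    then have "0 = (\<Sum>i\<in>I. \<Sum>j\<in>I. ?d p i u * ?d q j u * (\<Gamma> k i j u - \<Gamma> k j i u))"
      unfolding torsion_fields by (rule sym)
    also have "\<dots> = (\<Sum>i\<in>I. ?d p i u * (\<Sum>j\<in>I. ?d q j u * (\<Gamma> k i j u - \<Gamma> k j i u)))"
      by (simp add: sum_distrib_left mult.assoc)
    also have "\<dots> = \<Gamma> k p q u - \<Gamma> k q p u"
      using * by (simp only: sum_delta_left[OF assms])
    finally show "\<Gamma> k p q u = \<Gamma> k q p u" by simp
  qed
next
  assume "\<forall>k\<in>I. \<forall>i\<in>I. \<forall>j\<in>I. \<forall>u\<in>U. \<Gamma> k i j u = \<Gamma> k j i u"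
  then show "torsionless I U (cov I \<Gamma>)"
    unfolding torsionless_def torsion_fields by simp
qed

section \<open>Products of tangent vectors\<close>

text \<open>Set to zero outside \<open>I\<close>, so that identities between tangent vectors are
  equalities of functions and rewrite inside further products. It also serves for connection
  symbols, as the bilinear map that they define.\<close>

definition tmult :: "'i set \<Rightarrow> ('i, 'k::real_normed_field) symbols \<Rightarrow> ('i \<Rightarrow> 'k) \<Rightarrow> ('i \<Rightarrow> 'k) \<Rightarrow> ('i \<Rightarrow> 'k) \<Rightarrow> 'i \<Rightarrow> 'k"
  where "tmult I c u x y k = (if k \<in> I then \<Sum>i\<in>I. \<Sum>j\<in>I. c k i j u * x i * y j else 0)"

definition tvec :: "'i set \<Rightarrow> ('i \<Rightarrow> 'k::real_normed_field) \<Rightarrow> ('i, 'k) vfield \<Rightarrow> 'i \<Rightarrow> 'k" where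
  "tvec I u X i = (if i \<in> I then X i u else 0)"

definition tder :: "'i set \<Rightarrow> ('i \<Rightarrow> 'k::real_normed_field) \<Rightarrow> ('i, 'k) vfield \<Rightarrow> ('i, 'k) vfield \<Rightarrow> 'i \<Rightarrow> 'k" where
  "tder I u X Y k = (if k \<in> I then \<Sum>i\<in>I. X i u * pd i (Y k) u else 0)"

definition basis_vec :: "'i \<Rightarrow> 'i \<Rightarrow> 'k::zero_neq_one" where
  "basis_vec p i = (if i = p then 1 else 0)"

lemma tmult_add:
  "tmult I c u (\<lambda>i. x i + x' i) y = (\<lambda>k. tmult I c u x y k + tmult I c u x' y k)"
  "tmult I c u x (\<lambda>i. y i + y' i) = (\<lambda>k. tmult I c u x y k + tmult I c u x y' k)"
  by (auto simp: tmult_def fun_eq_iff algebra_simps sum.distrib)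

lemma tmult_diff:
  "tmult I c u (\<lambda>i. x i - x' i) y = (\<lambda>k. tmult I c u x y k - tmult I c u x' y k)"
  "tmult I c u x (\<lambda>i. y i - y' i) = (\<lambda>k. tmult I c u x y k - tmult I c u x y' k)"
  by (auto simp: tmult_def fun_eq_iff algebra_simps sum_subtractf)

lemma tmult_scale:
  "tmult I c u (\<lambda>i. a * x i) y = (\<lambda>k. a * tmult I c u x y k)"
  "tmult I c u x (\<lambda>i. a * y i) = (\<lambda>k. a * tmult I c u x y k)"
  by (auto simp: tmult_def fun_eq_iff sum_distrib_left mult_ac)

lemma tmult_cong:
  "(\<And>i. i \<in> I \<Longrightarrow> x i = x' i) \<Longrightarrow> (\<And>i. i \<in> I \<Longrightarrow> y i = y' i) \<Longrightarrow> tmult I c u x y = tmult I c u x' y'"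
  by (auto simp: tmult_def fun_eq_iff intro!: sum.cong)

lemma tvec_vprod: "tvec I u (vprod I c X Y) = tmult I c u (tvec I u X) (tvec I u Y)"
  by (auto simp: tvec_def tmult_def vprod_def fun_eq_iff intro!: sum.cong)

lemma tvec_bracket: "tvec I u (bracket I X Y) = (\<lambda>k. tder I u X Y k - tder I u Y X k)"
  by (auto simp: tvec_def tder_def bracket_def fun_eq_iff sum_subtractf)

lemma tmult_sum_left: "tmult I c u (\<lambda>i. \<Sum>p\<in>A. x p i) y k = (\<Sum>p\<in>A. tmult I c u (x p) y k)"
proof (cases "k \<in> I")
  case True
  have "(\<Sum>i\<in>I. \<Sum>j\<in>I. c k i j u * (\<Sum>p\<in>A. x p i) * y j) =
    (\<Sum>i\<in>I. \<Sum>p\<in>A. \<Sum>j\<in>I. c k i j u * x p i * y j)"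
    by (simp add: sum_distrib_left sum_distrib_right) (intro sum.cong refl sum.swap)
  also have "\<dots> = (\<Sum>p\<in>A. \<Sum>i\<in>I. \<Sum>j\<in>I. c k i j u * x p i * y j)" by (rule sum.swap)
  finally show ?thesis using True by (simp add: tmult_def)
qed (simp add: tmult_def)

lemma tmult_sum_right: "tmult I c u x (\<lambda>i. \<Sum>p\<in>A. y p i) k = (\<Sum>p\<in>A. tmult I c u x (y p) k)"
proof (cases "k \<in> I")
  case True
  have "(\<Sum>i\<in>I. \<Sum>j\<in>I. c k i j u * x i * (\<Sum>p\<in>A. y p j)) =
    (\<Sum>i\<in>I. \<Sum>p\<in>A. \<Sum>j\<in>I. c k i j u * x i * y p j)"
    by (simp add: sum_distrib_left) (intro sum.cong refl sum.swap)
  also have "\<dots> = (\<Sum>p\<in>A. \<Sum>i\<in>I. \<Sum>j\<in>I. c k i j u * x i * y p j)" by (rule sum.swap)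
  finally show ?thesis using True by (simp add: tmult_def)
qed (simp add: tmult_def)

lemma basis_expand:
  fixes x :: "'i \<Rightarrow> 'k::comm_ring_1"
  assumes "finite I" "i \<in> I"
  shows "x i = (\<Sum>p\<in>I. x p * basis_vec p i)"
  using assms by (simp add: basis_vec_def mult_delta_right if_distrib sum.delta' cong: if_cong)

lemma tmult_expand:
  assumes "finite I"
  shows "tmult I c u x y k = (\<Sum>i\<in>I. \<Sum>j\<in>I. x i * y j * tmult I c u (basis_vec i) (basis_vec j) k)"
proof -
  have "tmult I c u x y = tmult I c u (\<lambda>i. \<Sum>p\<in>I. x p * basis_vec p i) (\<lambda>i. \<Sum>p\<in>I. y p * basis_vec p i)"
    by (rule tmult_cong) (rule basis_expand[OF assms], assumption)+
  then show ?thesis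
    by (simp add: tmult_sum_left tmult_sum_right tmult_scale sum_distrib_left mult_ac)
qed

text \<open>The hypothesis \<open>dc\<close> says that the product depends on the point through
  \<open>\<partial>\<^sub>x (y z) = \<rho> x y z\<close>.\<close>

lemma tder_vprod:
  assumes dom: "coord_domain I U" and c: "is_symbols I U c" and u: "u \<in> U"
    and Y: "is_vfield I U Y" and Z: "is_vfield I U Z"
    and dc: "\<And>p k i j. p \<in> I \<Longrightarrow> k \<in> I \<Longrightarrow> i \<in> I \<Longrightarrow> j \<in> I \<Longrightarrow>
      pd p (c k i j) u = \<rho> * tmult I c u (basis_vec p) (tmult I c u (basis_vec i) (basis_vec j)) k"
  shows "tder I u X (vprod I c Y Z) = (\<lambda>k. tmult I c u (tder I u X Y) (tvec I u Z) k +
    tmult I c u (tvec I u Y) (tder I u X Z) k +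
    \<rho> * tmult I c u (tvec I u X) (tmult I c u (tvec I u Y) (tvec I u Z)) k)"
proof
  fix k
  show "tder I u X (vprod I c Y Z) k = tmult I c u (tder I u X Y) (tvec I u Z) k +
    tmult I c u (tvec I u Y) (tder I u X Z) k +
    \<rho> * tmult I c u (tvec I u X) (tmult I c u (tvec I u Y) (tvec I u Z)) k"
  proof (cases "k \<in> I")
    case k: True
    have fin: "finite I" by (rule coord_domain_finite[OF dom])
    have Yd: "has_pd i (Y j) u (pd i (Y j) u)" if "i \<in> I" "j \<in> I" for i j
      using Y u that by (auto simp: is_vfield_def intro: smooth_has_pd)
    have Zd: "has_pd i (Z j) u (pd i (Z j) u)" if "i \<in> I" "j \<in> I" for i j
      using Z u that by (auto simp: is_vfield_def intro: smooth_has_pd)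
    have cd: "has_pd p (c k i j) u (pd p (c k i j) u)" if "i \<in> I" "j \<in> I" "p \<in> I" for i j p
      using c u k that by (auto simp: is_symbols_def intro: smooth_has_pd)
    have d: "pd p (vprod I c Y Z k) u = (\<Sum>i\<in>I. \<Sum>j\<in>I. (pd p (c k i j) u * Y i u + c k i j u * pd p (Y i) u) * Z j u
        + c k i j u * Y i u * pd p (Z j) u)" if p: "p \<in> I" for p
      unfolding vprod_def[abs_def]
      by (rule has_pd_imp_pd, rule has_pd_sum, rule has_pd_sum, rule has_pd_mult, rule has_pd_mult)
        (use p in \<open>auto intro: Yd Zd cd\<close>)
    define T where "T p = tmult I c u (basis_vec p) (tmult I c u (tvec I u Y) (tvec I u Z)) k" for p
    have T: "(\<Sum>i\<in>I. \<Sum>j\<in>I. pd p (c k i j) u * Y i u * Z j u) = \<rho> * T p" if p: "p \<in> I" for p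
    proof -
      have "T p = tmult I c u (basis_vec p) (\<lambda>l. \<Sum>i\<in>I. \<Sum>j\<in>I.
          (Y i u * Z j u) * tmult I c u (basis_vec i) (basis_vec j) l) k"
        unfolding T_def by (rule fun_cong[OF tmult_cong], rule refl, subst tmult_expand[OF fin])
          (auto simp: tvec_def intro!: sum.cong)
      also have "\<dots> = (\<Sum>i\<in>I. \<Sum>j\<in>I. (Y i u * Z j u) * tmult I c u (basis_vec p) (tmult I c u (basis_vec i) (basis_vec j)) k)"
        by (simp only: tmult_sum_right tmult_scale)
      finally show ?thesis using dc[OF p k] by (simp add: sum_distrib_left mult_ac)
    qed
    have "tder I u X (vprod I c Y Z) k = (\<Sum>p\<in>I. X p u * ((\<Sum>i\<in>I. \<Sum>j\<in>I. c k i j u * pd p (Y i) u * Z j u)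
        + (\<Sum>i\<in>I. \<Sum>j\<in>I. c k i j u * Y i u * pd p (Z j) u) + \<rho> * T p))"
      using k by (simp add: tder_def d T[symmetric] algebra_simps sum.distrib)
    also have "\<dots> = (\<Sum>p\<in>I. X p u * (\<Sum>i\<in>I. \<Sum>j\<in>I. c k i j u * pd p (Y i) u * Z j u))
       + (\<Sum>p\<in>I. X p u * (\<Sum>i\<in>I. \<Sum>j\<in>I. c k i j u * Y i u * pd p (Z j) u)) + \<rho> * (\<Sum>p\<in>I. X p u * T p)"
      by (simp add: distrib_left sum.distrib sum_distrib_left mult_ac)
    also have "(\<Sum>p\<in>I. X p u * (\<Sum>i\<in>I. \<Sum>j\<in>I. c k i j u * pd p (Y i) u * Z j u)) =
        tmult I c u (\<lambda>i. \<Sum>p\<in>I. X p u * pd p (Y i) u) (tvec I u Z) k"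
      using k by (simp add: tmult_sum_left tmult_scale) (simp add: tmult_def tvec_def)
    also have "tmult I c u (\<lambda>i. \<Sum>p\<in>I. X p u * pd p (Y i) u) (tvec I u Z) = tmult I c u (tder I u X Y) (tvec I u Z)"
      by (rule tmult_cong) (simp_all add: tder_def)
    also have "(\<Sum>p\<in>I. X p u * (\<Sum>i\<in>I. \<Sum>j\<in>I. c k i j u * Y i u * pd p (Z j) u)) =
        tmult I c u (tvec I u Y) (\<lambda>i. \<Sum>p\<in>I. X p u * pd p (Z i) u) k"
      using k by (simp add: tmult_sum_right tmult_scale) (simp add: tmult_def tvec_def)
    also have "tmult I c u (tvec I u Y) (\<lambda>i. \<Sum>p\<in>I. X p u * pd p (Z i) u) = tmult I c u (tvec I u Y) (tder I u X Z)"
      by (rule tmult_cong) (simp_all add: tder_def)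
    also have "(\<Sum>p\<in>I. X p u * T p) = tmult I c u (tvec I u X) (tmult I c u (tvec I u Y) (tvec I u Z)) k"
    proof -
      have "tmult I c u (tvec I u X) V k = tmult I c u (\<lambda>i. \<Sum>p\<in>I. X p u * basis_vec p i) V k" for V
        by (rule fun_cong[OF tmult_cong]) (simp_all add: tvec_def basis_expand[OF fin, of _ "\<lambda>i. X i u"])
      then show ?thesis by (simp add: T_def tmult_sum_left tmult_scale)
    qed
    finally show ?thesis .
  qed (simp add: tder_def tmult_def)
qed

text \<open>In the Hertling-Manin identity the derivatives of the fields cancel as for constant
  structure constants. What \<open>dc\<close> adds are multiples by \<open>\<rho>\<close> of the
  product of all four fields: none in total from the first bracket, two with plus and two with minus
  from the others.\<close>

lemma F_manifoldI:
  assumes dom: "coord_domain I U" and c: "is_symbols I U c" and e: "is_vfield I U e"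
    and comm: "\<And>u x y. u \<in> U \<Longrightarrow> tmult I c u x y = tmult I c u y x"
    and assoc: "\<And>u x y z. u \<in> U \<Longrightarrow> tmult I c u (tmult I c u x y) z = tmult I c u x (tmult I c u y z)"
    and unit: "\<And>u x k. u \<in> U \<Longrightarrow> k \<in> I \<Longrightarrow> tmult I c u (tvec I u e) x k = x k"
    and dc: "\<And>u p k i j. u \<in> U \<Longrightarrow> p \<in> I \<Longrightarrow> k \<in> I \<Longrightarrow> i \<in> I \<Longrightarrow> j \<in> I \<Longrightarrow>
      pd p (c k i j) u = \<rho> * tmult I c u (basis_vec p) (tmult I c u (basis_vec i) (basis_vec j)) k"
  shows "F_manifold I U c e"
proof -
  have tv: "vprod I c X Y k u = tmult I c u (tvec I u X) (tvec I u Y) k" if "k \<in> I" for X Y k u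
    using fun_cong[OF tvec_vprod[of I u c X Y], of k] that by (simp add: tvec_def[of I u "vprod I c X Y"])
  have tb: "bracket I X Y k u = tder I u X Y k - tder I u Y X k" if "k \<in> I" for X Y k u
    using tvec_bracket[of I u X Y] that by (auto simp: tvec_def fun_eq_iff split: if_splits)
  have "hertling_manin I U c"
    unfolding hertling_manin_def Let_def
  proof (intro allI impI ballI)
    fix X Y Z W k u
    assume f: "is_vfield I U X" "is_vfield I U Y" "is_vfield I U Z" "is_vfield I U W" and k: "k \<in> I" and u: "u \<in> U"
    have lcomm: "tmult I c u x (tmult I c u y z) = tmult I c u y (tmult I c u x z)" for x y z
      using assoc[OF u] comm[OF u] by metis
    note d = tder_vprod[OF dom c u _ _ dc[OF u]]
    \<comment> \<open>The identity contains both orders of the product of \<open>Z\<close> and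
      \<open>W\<close> as directions of differentiation.\<close>
    have "tder I u (vprod I c Z W) = tder I u (vprod I c W Z)"
      using comm[OF u] by (intro ext) (simp add: tder_def tv)
    show "bracket I (vprod I c X Y) (vprod I c W Z) k u - vprod I c (bracket I (vprod I c X Y) Z) W k u
        - vprod I c (bracket I (vprod I c X Y) W) Z k u
        - vprod I c X (bracket I Y (vprod I c Z W)) k u + vprod I c X (vprod I c (bracket I Y Z) W) k u
        + vprod I c X (vprod I c (bracket I Y W) Z) k u
        - vprod I c Y (bracket I X (vprod I c Z W)) k u + vprod I c Y (vprod I c (bracket I X Z) W) k u
        + vprod I c Y (vprod I c (bracket I X W) Z) k u = 0"
      using k f
      by (simp add: tv tb tvec_vprod tvec_bracket d tmult_add tmult_diff tmult_scale assoc[OF u] comm[OF u] lcomm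
          \<open>tder I u (vprod I c Z W) = tder I u (vprod I c W Z)\<close>)
  qed
  moreover have "vf_eq I U (vprod I c X Y) (vprod I c Y X)" for X Y
    using comm by (simp add: vf_eq_def tv)
  moreover have "vf_eq I U (vprod I c (vprod I c X Y) Z) (vprod I c X (vprod I c Y Z))" for X Y Z
    using assoc by (simp add: vf_eq_def tv tvec_vprod)
  moreover have "vf_eq I U (vprod I c e X) X" for X
    using unit by (simp add: vf_eq_def tv) (simp add: tvec_def)
  ultimately show ?thesis using dom c e by (simp add: F_manifold_def)
qed

section \<open>The algebraic identity behind flatness\<close>

text \<open>Doubling the sum pairs each summand with the one for exchanged indices. The first
  assumption replaces division by two.\<close>

lemma double_sum_pair_eq:
  fixes T T' :: "'i \<Rightarrow> 'i \<Rightarrow> 'r::ab_group_add"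
  assumes "\<And>x::'r. x + x = 0 \<Longrightarrow> x = 0"
    "\<And>g b. g \<in> R \<Longrightarrow> b \<in> R \<Longrightarrow> T g b + T b g = T' g b + T' b g"
  shows "(\<Sum>g\<in>R. \<Sum>b\<in>R. T g b) = (\<Sum>g\<in>R. \<Sum>b\<in>R. T' g b)"
proof -
  have d: "(\<Sum>g\<in>R. \<Sum>b\<in>R. S g b) + (\<Sum>g\<in>R. \<Sum>b\<in>R. S g b) = (\<Sum>g\<in>R. \<Sum>b\<in>R. S g b + S b g)"
    for S :: "'i \<Rightarrow> 'i \<Rightarrow> 'r"
    by (subst (2) sum.swap) (simp add: sum.distrib)
  have "(\<Sum>g\<in>R. \<Sum>b\<in>R. T g b) + (\<Sum>g\<in>R. \<Sum>b\<in>R. T g b) =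
      (\<Sum>g\<in>R. \<Sum>b\<in>R. T' g b) + (\<Sum>g\<in>R. \<Sum>b\<in>R. T' g b)"
    unfolding d by (intro sum.cong refl assms(2))
  then have "((\<Sum>g\<in>R. \<Sum>b\<in>R. T g b) - (\<Sum>g\<in>R. \<Sum>b\<in>R. T' g b)) +
      ((\<Sum>g\<in>R. \<Sum>b\<in>R. T g b) - (\<Sum>g\<in>R. \<Sum>b\<in>R. T' g b)) = 0"
    by (simp add: algebra_simps)
  from assms(1)[OF this] show ?thesis by simp
qed

text \<open>Here \<open>p b\<close> and \<open>q b\<close> are the quotients of \<open>X - x b\<close> and \<open>Y - y b\<close> by \<open>W b\<close>, and
  \<open>V g b\<close> is the inverse of \<open>W b - W g\<close>. After antisymmetrization in the first two arguments
  the double sums vanish pair by pair.\<close>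

locale quotient_data =
  fixes R :: "'i set" and C x y z p q W \<kappa>' :: "'i \<Rightarrow> 'r::comm_ring_1" and V :: "'i \<Rightarrow> 'i \<Rightarrow> 'r"
    and X Y Z \<kappa> \<mu> \<nu> :: 'r
  assumes two: "\<And>x::'r. x + x = 0 \<Longrightarrow> x = 0"
    and X: "\<And>b. b \<in> R \<Longrightarrow> X = x b + W b * p b"
    and Y: "\<And>b. b \<in> R \<Longrightarrow> Y = y b + W b * q b"
    and V_anti: "\<And>g b. V b g = - V g b"
    and V: "\<And>g b. g \<in> R \<Longrightarrow> b \<in> R \<Longrightarrow> g \<noteq> b \<Longrightarrow> V g b * (W b - W g) = 1"
    and \<kappa>: "\<And>b. b \<in> R \<Longrightarrow> \<kappa>' b - \<kappa> = \<nu> * \<kappa> * \<kappa>' b * W b"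
    and V\<kappa>: "\<And>g b. g \<in> R \<Longrightarrow> b \<in> R \<Longrightarrow> g \<noteq> b \<Longrightarrow> \<nu> * V g b * (\<kappa>' b - \<kappa>' g) = \<nu> * \<nu> * \<kappa>' g * \<kappa>' b"
begin

lemma swap: "quotient_data R y x q p W \<kappa>' V Y X \<kappa> \<nu>"
  by unfold_locales (fact two Y X V_anti V \<kappa> V\<kappa>)+

text \<open>One block of \<open>\<Gamma>(y, z)\<close>. Below, \<open>inner0 g\<close> is the
  leading coefficient in block \<open>g\<close>, where Q_b(y) turns into
  \<open>V g b * (y g - y b)\<close>, and \<open>outer\<close> is
  \<open>\<Gamma>(x, \<Gamma>(y, z))\<close>.\<close>

definition inner where
  "inner = - (\<Sum>b\<in>R. C b * q b * (Z - z b)) + \<mu> * \<kappa> * Y * Z - \<nu> * (\<Sum>b\<in>R. C b * \<kappa>' b * y b * z b)"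

definition inner0 where
  "inner0 g = - (\<Sum>b\<in>R. C b * (V g b * (y g - y b)) * (z g - z b)) + \<mu> * \<kappa>' g * y g * z g
     - \<nu> * (\<Sum>b\<in>R. C b * \<kappa>' b * y b * z b)"

definition outer where
  "outer = - (\<Sum>g\<in>R. C g * p g * (inner - inner0 g)) + \<mu> * \<kappa> * X * inner
     - \<nu> * (\<Sum>g\<in>R. C g * \<kappa>' g * x g * inner0 g)"

definition S1 where
  "S1 g b = C g * C b * p g * (q b * (Z - z b) - V g b * (y g - y b) * (z g - z b))"

definition S2 where
  "S2 g = C g * (p g * (\<kappa> * Y * Z - \<kappa>' g * y g * z g) + \<kappa> * X * q g * (Z - z g)
     + \<nu> * \<kappa> * \<kappa>' g * X * y g * z g)"

definition S3 where
  "S3 g b = C g * C b * \<nu> * \<kappa>' g * x g * (V g b * (y g - y b) * (z g - z b) + \<nu> * \<kappa>' b * y b * z b)"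

text \<open>Isolates the parts that need an argument: the two terms beside \<open>S1\<close>,
  \<open>S2\<close> and \<open>S3\<close> are symmetric in \<open>x\<close> and \<open>y\<close> at
  sight.\<close>

lemma outer_eq:
  "outer = (\<Sum>g\<in>R. \<Sum>b\<in>R. S1 g b) - \<mu> * (\<Sum>g\<in>R. S2 g) + (\<Sum>g\<in>R. \<Sum>b\<in>R. S3 g b)
     + \<mu> * \<mu> * \<kappa> * \<kappa> * X * Y * Z - \<nu> * \<mu> * (\<Sum>g\<in>R. C g * \<kappa>' g * \<kappa>' g * x g * y g * z g)"
proof -
  have 1: "C g * p g * (inner - inner0 g) = - (\<Sum>b\<in>R. S1 g b)
      + \<mu> * (C g * (p g * (\<kappa> * Y * Z - \<kappa>' g * y g * z g)))" if "g \<in> R" for g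
    unfolding inner_def inner0_def S1_def
    by (simp add: algebra_simps sum_distrib_left sum.distrib sum_subtractf sum_negf)
  have 2: "\<mu> * \<kappa> * X * inner = - \<mu> * (\<Sum>g\<in>R. C g * (\<kappa> * X * q g * (Z - z g)))
      - \<mu> * (\<Sum>g\<in>R. C g * (\<nu> * \<kappa> * \<kappa>' g * X * y g * z g)) + \<mu> * \<mu> * \<kappa> * \<kappa> * X * Y * Z"
    unfolding inner_def
    by (simp add: algebra_simps sum_distrib_left sum.distrib sum_subtractf sum_negf)
  have 3: "\<nu> * (C g * \<kappa>' g * x g * inner0 g) = - (\<Sum>b\<in>R. S3 g b)
      + \<nu> * \<mu> * (C g * \<kappa>' g * \<kappa>' g * x g * y g * z g)" for g
    unfolding inner0_def S3_def
    by (simp add: algebra_simps sum_distrib_left sum.distrib sum_subtractf sum_negf)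
  have "outer = - (\<Sum>g\<in>R. C g * p g * (inner - inner0 g)) + \<mu> * \<kappa> * X * inner
     - (\<Sum>g\<in>R. \<nu> * (C g * \<kappa>' g * x g * inner0 g))"
    by (simp add: outer_def sum_distrib_left)
  also have "(\<Sum>g\<in>R. C g * p g * (inner - inner0 g)) = (\<Sum>g\<in>R. - (\<Sum>b\<in>R. S1 g b)
      + \<mu> * (C g * (p g * (\<kappa> * Y * Z - \<kappa>' g * y g * z g))))"
    by (intro sum.cong refl 1)
  finally show ?thesis
    unfolding 2 3 S2_def
    by (simp add: sum.distrib sum_subtractf sum_negf distrib_left sum_distrib_left mult.assoc) 
qed

end

text \<open>This is the cancellation of the quadratic terms of the curvature. \<open>S2\<close> is
  symmetric summand by summand; \<open>S1\<close> and \<open>S3\<close> become so only after adding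
  the summands for (g, b) and (b, g).\<close>

lemma (in quotient_data) outer_sym:
  "outer = quotient_data.outer R C y x z q p \<kappa>' V Y X Z \<kappa> \<mu> \<nu>"
proof -
  interpret sw: quotient_data R C y x z q p W \<kappa>' V Y X Z \<kappa> \<mu> \<nu> by (rule swap)
  have "(\<Sum>g\<in>R. \<Sum>b\<in>R. S1 g b) = (\<Sum>g\<in>R. \<Sum>b\<in>R. sw.S1 g b)"
  proof (rule double_sum_pair_eq[OF two])
    fix g b assume gb: "g \<in> R" "b \<in> R"
    show "S1 g b + S1 b g = sw.S1 g b + sw.S1 b g"
    proof (cases "g = b")
      case True
      then show ?thesis by (simp add: S1_def sw.S1_def algebra_simps)
    next
      case False
      have xg: "x g - x b = W b * p b - W g * p g" "y g - y b = W b * q b - W g * q g"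
        using X[OF gb(1)] X[OF gb(2)] Y[OF gb(1)] Y[OF gb(2)] by (simp_all add: algebra_simps)
      let ?K = "p g * q b - q g * p b"
      have "S1 g b + S1 b g - (sw.S1 g b + sw.S1 b g) = C g * C b * (z g - z b) *
         (?K - (p g - p b) * V g b * (y g - y b) + (q g - q b) * V g b * (x g - x b))"
        unfolding S1_def sw.S1_def V_anti[of b g] by (simp add: algebra_simps)
      \<comment> \<open>Inserting the factor 1 in the form \<open>V g b * (W b - W g)\<close> gives
        all three terms the common factor \<open>V g b\<close>; by the relations \<open>xg\<close>
        the rest is a polynomial identity.\<close>
      also have "?K = V g b * (W b - W g) * ?K" using V[OF gb False] by simp
      also have "V g b * (W b - W g) * ?K - (p g - p b) * V g b * (y g - y b) + (q g - q b) * V g b * (x g - x b) = 0"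
        unfolding xg by (simp add: algebra_simps)
      finally show ?thesis by simp
    qed
  qed
  moreover have "S2 g = sw.S2 g" if "g \<in> R" for g
  proof -
    have "S2 g - sw.S2 g = C g * z g * (p g * y g - q g * x g) * (\<kappa> - \<kappa>' g + \<nu> * \<kappa> * \<kappa>' g * W g)"
      unfolding S2_def sw.S2_def unfolding X[OF that] Y[OF that] by (simp add: algebra_simps)
    also have "\<kappa> - \<kappa>' g + \<nu> * \<kappa> * \<kappa>' g * W g = 0"
      using \<kappa>[OF that] by (simp add: algebra_simps)
    finally show ?thesis by simp
  qed
  moreover have "(\<Sum>g\<in>R. \<Sum>b\<in>R. S3 g b) = (\<Sum>g\<in>R. \<Sum>b\<in>R. sw.S3 g b)"
  proof (rule double_sum_pair_eq[OF two])
    fix g b assume gb: "g \<in> R" "b \<in> R"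
    show "S3 g b + S3 b g = sw.S3 g b + sw.S3 b g"
    proof (cases "g = b")
      case True
      then show ?thesis by (simp add: S3_def sw.S3_def algebra_simps)
    next
      case False
      have "S3 g b + S3 b g - (sw.S3 g b + sw.S3 b g) = C g * C b * (z g - z b) * (x g * y b - x b * y g) *
         (\<nu> * V g b * (\<kappa>' b - \<kappa>' g) - \<nu> * \<nu> * \<kappa>' g * \<kappa>' b)"
        unfolding S3_def sw.S3_def V_anti[of b g] by (simp add: algebra_simps)
      then show ?thesis using V\<kappa>[OF gb False] by simp
    qed
  qed
  ultimately show ?thesis
    unfolding outer_eq sw.outer_eq by (simp add: mult_ac cong: sum.cong)
qed

unbundle no vec_syntax and fps_syntax

section \<open>Derivatives of families of power series\<close>

definition has_fps_pd :: "'i \<Rightarrow> (('i \<Rightarrow> 'k::real_normed_field) \<Rightarrow> 'k fps) \<Rightarrow> ('i \<Rightarrow> 'k) \<Rightarrow> 'k fps \<Rightarrow> bool" where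
  "has_fps_pd p F u D \<longleftrightarrow> (\<forall>n. has_pd p (\<lambda>u. F u $ n) u (D $ n))"

lemma has_fps_pd_nth: "has_fps_pd p F u D \<Longrightarrow> has_pd p (\<lambda>u. F u $ n) u (D $ n)"
  by (simp add: has_fps_pd_def)

lemma has_fps_pd_const: "has_fps_pd p (\<lambda>u. f) u 0"
  by (simp add: has_fps_pd_def has_pd_const)

lemma has_fps_pd_fps_const: "has_pd p f u D \<Longrightarrow> has_fps_pd p (\<lambda>u. fps_const (f u)) u (fps_const D)"
  by (simp add: has_fps_pd_def has_pd_const)

lemma has_fps_pd_add:
  "has_fps_pd p F u D \<Longrightarrow> has_fps_pd p G u D' \<Longrightarrow> has_fps_pd p (\<lambda>u. F u + G u) u (D + D')"
  by (simp add: has_fps_pd_def has_pd_add)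

lemma has_fps_pd_diff:
  "has_fps_pd p F u D \<Longrightarrow> has_fps_pd p G u D' \<Longrightarrow> has_fps_pd p (\<lambda>u. F u - G u) u (D - D')"
  by (simp add: has_fps_pd_def has_pd_diff)

lemma has_fps_pd_minus: "has_fps_pd p F u D \<Longrightarrow> has_fps_pd p (\<lambda>u. - F u) u (- D)"
  by (simp add: has_fps_pd_def has_pd_minus)

lemma has_fps_pd_sum:
  assumes "\<And>i. i \<in> A \<Longrightarrow> has_fps_pd p (F i) u (D i)"
  shows "has_fps_pd p (\<lambda>u. \<Sum>i\<in>A. F i u) u (\<Sum>i\<in>A. D i)"
  unfolding has_fps_pd_def fps_sum_nth
  by (intro allI has_pd_sum has_fps_pd_nth assms)

lemma has_fps_pd_mult:
  assumes "has_fps_pd p F u D" "has_fps_pd p G u D'"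
  shows "has_fps_pd p (\<lambda>u. F u * G u) u (D * G u + F u * D')"
  unfolding has_fps_pd_def fps_mult_nth fps_add_nth sum.distrib[symmetric]
  by (intro allI has_pd_sum has_pd_mult has_fps_pd_nth assms)

lemma fps_inverse_nth_Suc:
  "inverse (f::'k::field fps) $ Suc n = - inverse (f $ 0) * (\<Sum>i = 1..Suc n. f $ i * inverse f $ (Suc n - i))"
  by (simp add: fps_inverse_def)

text \<open>Existence and value are treated separately: the recursion for the coefficients of a
  reciprocal shows that derivatives exist, and differentiating the product of \<open>F\<close> with
  its reciprocal determines them.\<close>

lemma has_fps_pd_inverse:
  assumes F: "has_fps_pd p F u D" and nz: "F u $ 0 \<noteq> 0"
  shows "has_fps_pd p (\<lambda>u. inverse (F u)) u (- (inverse (F u) * D * inverse (F u)))"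
proof -
  have i0: "has_pd p (\<lambda>u. inverse (F u $ 0)) u (- (inverse (F u $ 0) * D $ 0 * inverse (F u $ 0)))"
    by (rule has_pd_inverse[OF has_fps_pd_nth[OF F] nz])
  have "\<exists>d. has_pd p (\<lambda>u. inverse (F u) $ n) u d" for n
  proof (induction n rule: less_induct)
    case (less n)
    show ?case
    proof (cases n)
      case 0
      then show ?thesis using i0 by auto
    next
      case (Suc k)
      have "\<forall>j\<in>{..k}. \<exists>d. has_pd p (\<lambda>u. inverse (F u) $ j) u d"
        using less.IH Suc by auto
      then obtain d where d: "\<And>j. j \<in> {..k} \<Longrightarrow> has_pd p (\<lambda>u. inverse (F u) $ j) u (d j)"
        by (metis bchoice)
      show ?thesis
        unfolding Suc fps_inverse_nth_Suc
      proof (rule exI, rule has_pd_mult[OF has_pd_minus[OF i0]], rule has_pd_sum)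
        fix i assume "i \<in> {1..Suc k}"
        then show "has_pd p (\<lambda>u. F u $ i * inverse (F u) $ (Suc k - i)) u
            (D $ i * inverse (F u) $ (Suc k - i) + F u $ i * d (Suc k - i))"
          by (intro has_pd_mult has_fps_pd_nth[OF F] d) auto
      qed
    qed
  qed
  then obtain d where "\<And>n. has_pd p (\<lambda>u. inverse (F u) $ n) u (d n)" by metis
  then have I: "has_fps_pd p (\<lambda>u. inverse (F u)) u (Abs_fps d)"
    by (simp add: has_fps_pd_def)
  \<comment> \<open>The product is 1 only where the leading coefficient of \<open>F\<close> is
    nonzero, hence at least near the given point.\<close>
  have "isCont (\<lambda>t. F (u(p := t)) $ 0) (u p)"
    using has_fps_pd_nth[OF F, of 0] unfolding has_pd_def by (rule DERIV_isCont)
  then have ev: "\<forall>\<^sub>F t in nhds (u p). F (u(p := t)) $ 0 \<noteq> 0"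
    using nz by (simp add: tendsto_imp_eventually_ne isCont_def continuous_at eventually_nhds_conv_at)
  have "D * inverse (F u) + F u * Abs_fps d = 0"
  proof (rule fps_ext)
    fix n
    have "has_pd p (\<lambda>u. (F u * inverse (F u)) $ n) u ((D * inverse (F u) + F u * Abs_fps d) $ n)"
      by (rule has_fps_pd_nth[OF has_fps_pd_mult[OF F I]])
    then have "((\<lambda>t. 1 $ n) has_field_derivative (D * inverse (F u) + F u * Abs_fps d) $ n) (at (u p))"
      unfolding has_pd_def
      by (rule DERIV_cong_ev[THEN iffD1, rotated -1])
        (use ev in \<open>auto elim!: eventually_mono simp: inverse_mult_eq_1'\<close>)
    then show "(D * inverse (F u) + F u * Abs_fps d) $ n = 0 $ n"
      using DERIV_unique[OF _ DERIV_const] by fastforce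
  qed
  then have "inverse (F u) * (F u * Abs_fps d) = - (inverse (F u) * D * inverse (F u))"
    by (simp add: add_eq_0_iff mult.assoc)
  then have "Abs_fps d = - (inverse (F u) * D * inverse (F u))"
    using nz by (simp add: mult.assoc[symmetric] inverse_mult_eq_1)
  then show ?thesis using I by simp
qed

lemma fps_cutoff_mult_left: "fps_cutoff n (fps_cutoff n f * g) = fps_cutoff n (f * g)"
  by (simp add: fps_cutoff_eq_fps_cutoff_iff fps_cutoff_left_mult_nth)

lemma fps_cutoff_mult_right: "fps_cutoff n (f * fps_cutoff n g) = fps_cutoff n (f * g)"
  by (simp add: fps_cutoff_eq_fps_cutoff_iff fps_cutoff_right_mult_nth)

text \<open>The form in which symbols that depend only on k - i - j are contracted with two vectors,
  with both indices running over a whole block of size \<open>M\<close>.\<close>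

lemma fps_triple_mult_nth:
  fixes f g h :: "'k::comm_ring_1 fps"
  assumes "k < M"
  shows "(h * f * g) $ k = (\<Sum>i<M. \<Sum>j<M. if i + j \<le> k then h $ (k - i - j) * f $ i * g $ j else 0)"
proof -
  have "(h * f * g) $ k = (f * (g * h)) $ k" by (simp add: mult_ac)
  also have "\<dots> = (\<Sum>i=0..k. \<Sum>j=0..k-i. h $ (k - i - j) * f $ i * g $ j)"
    unfolding fps_mult_nth sum_distrib_left by (intro sum.cong refl) (simp add: mult_ac)
  also have "\<dots> = (\<Sum>i=0..k. \<Sum>j<M. if i + j \<le> k then h $ (k - i - j) * f $ i * g $ j else 0)"
    by (intro sum.cong refl sum.mono_neutral_cong_left) (use assms in auto)
  also have "\<dots> = (\<Sum>i<M. \<Sum>j<M. if i + j \<le> k then h $ (k - i - j) * f $ i * g $ j else 0)"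
    by (intro sum.mono_neutral_left) (use assms in \<open>auto intro!: sum.neutral\<close>)
  finally show ?thesis .
qed

section \<open>Tangent vectors as tuples of truncated power series\<close>

text \<open>The block \<open>a\<close> of a tangent vector \<open>v\<close> is the power series with coefficients
  \<open>v\<^sup>1\<^sup>(\<^sup>a\<^sup>), v\<^sup>2\<^sup>(\<^sup>a\<^sup>), \<dots>\<close>, so that the product of the F-manifold is multiplication of
  power series modulo \<open>X\<close> to the power \<open>m a\<close>.\<close>

definition blk :: "(nat \<Rightarrow> nat) \<Rightarrow> (nat \<times> nat \<Rightarrow> 'k::real_normed_field) \<Rightarrow> nat \<Rightarrow> 'k fps" where
  "blk m v a = Abs_fps (\<lambda>n. if n < m a then v (a, n + 1) else 0)"

text \<open>On the diagonal the difference is divisible by the variable, and the quotient is taken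
  instead; as this happens in numerator and denominator alike, \<open>quo\<close> still is the
  quotient of the differences.\<close>

definition sep :: "(nat \<Rightarrow> nat) \<Rightarrow> (nat \<times> nat \<Rightarrow> 'k::real_normed_field) \<Rightarrow> nat \<Rightarrow> nat \<Rightarrow> 'k fps" where
  "sep m v a b = (if a = b then fps_shift 1 (blk m v a) else blk m v a - fps_const (v (b, 1)))"

text \<open>The quotient of \<open>blk m y a - y\<^sup>1\<^sup>(\<^sup>b\<^sup>)\<close> by \<open>blk m u a - u\<^sup>1\<^sup>(\<^sup>b\<^sup>)\<close>. For \<open>m a = 1\<close> and
  \<open>b = a\<close> it is the quotient of zero by zero, which is zero.\<close>

definition quo :: "(nat \<Rightarrow> nat) \<Rightarrow> (nat \<times> nat \<Rightarrow> 'k::real_normed_field) \<Rightarrow> (nat \<times> nat \<Rightarrow> 'k) \<Rightarrow> nat \<Rightarrow> nat \<Rightarrow> 'k fps"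
  where "quo m u y a b = sep m y a b * inverse (sep m u a b)"

text \<open>On block \<open>a\<close> the product is \<open>kap m s u a * y * z\<close>; the flag \<open>s\<close> distinguishes the dual
  product and the dual connection from the original ones.\<close>

definition kap :: "(nat \<Rightarrow> nat) \<Rightarrow> bool \<Rightarrow> (nat \<times> nat \<Rightarrow> 'k::real_normed_field) \<Rightarrow> nat \<Rightarrow> 'k fps" where
  "kap m s u a = (if s then inverse (blk m u a) else 1)"

lemma blk_nth [simp]: "blk m v a $ n = (if n < m a then v (a, n + 1) else 0)"
  by (simp add: blk_def)

lemma cutoff_blk [simp]: "fps_cutoff (m a) (blk m v a) = blk m v a"
  by (simp add: fps_eq_iff)

lemma has_pd_basis: "has_pd p (\<lambda>u. u q) u (basis_vec p q)"
  unfolding basis_vec_def by (rule has_pd_coord)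

lemma has_fps_pd_blk: "has_fps_pd p (\<lambda>u. blk m u a) u (blk m (basis_vec p) a)"
  unfolding has_fps_pd_def
proof
  fix n
  show "has_pd p (\<lambda>u. blk m u a $ n) u (blk m (basis_vec p) a $ n)"
    using has_pd_basis[of p "(a, Suc n)" u] by (cases "n < m a") (simp_all add: has_pd_const)
qed

lemma has_fps_pd_sep: "has_fps_pd p (\<lambda>u. sep m u a b) u (sep m (basis_vec p) a b)"
proof (cases "a = b")
  case True
  then show ?thesis
    using has_fps_pd_blk[of p m a u] by (simp add: sep_def has_fps_pd_def)
next
  case False
  then show ?thesis
    unfolding sep_def using has_fps_pd_diff[OF has_fps_pd_blk has_fps_pd_fps_const[OF has_pd_basis]] by simp
qed

section \<open>The index set, the domain and the two products in terms of blocks\<close>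

locale block_data =
  fixes r :: nat and m :: "nat \<Rightarrow> nat" and \<epsilon> :: "nat \<Rightarrow> 'k::real_normed_field"
  assumes m_pos: "a \<in> {1..r} \<Longrightarrow> m a \<ge> 1"
begin

abbreviation I where "I \<equiv> idx r m"
abbreviation U :: "(nat \<times> nat \<Rightarrow> 'k) set" where "U \<equiv> dom_U r m"
abbreviation R where "R \<equiv> {1..r}"

definition c :: "nat \<Rightarrow> 'k" where "c b = of_nat (m b) * \<epsilon> b"

lemma finite_I [simp]: "finite I"
  by (simp add: idx_def)

lemma mem_I: "(a, k) \<in> I \<longleftrightarrow> a \<in> R \<and> 1 \<le> k \<and> k \<le> m a"
  by (auto simp: idx_def)

lemma idx_cases:
  assumes "q \<in> I" obtains a k where "q = (a, Suc k)" "a \<in> R" "k < m a"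
proof -
  obtain a j where "q = (a, j)" by fastforce
  with assms have "q = (a, Suc (j - 1))" "a \<in> R" "j - 1 < m a" by (auto simp: mem_I)
  then show ?thesis by (rule that)
qed

lemma sum_I: "(\<Sum>i\<in>I. f i) = (\<Sum>a\<in>R. \<Sum>k<m a. f (a, Suc k))"
proof -
  have "(\<Sum>i\<in>I. f i) = (\<Sum>a\<in>R. \<Sum>k\<in>{1..m a}. f (a, k))"
    unfolding idx_def by (subst sum.Sigma) auto
  also have "\<dots> = (\<Sum>a\<in>R. \<Sum>k<m a. f (a, Suc k))"
    by (rule sum.cong[OF refl]) (rule sum.reindex_bij_witness[of _ Suc "\<lambda>k. k - 1"], auto)
  finally show ?thesis .
qed

lemma coord_domain_U: "coord_domain I U"
proof -
  let ?V = "(\<Inter>a\<in>R. {u::nat \<times> nat \<Rightarrow> 'k. u (a, 1) \<noteq> 0}) \<inter>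
    (\<Inter>a\<in>R. \<Inter>b\<in>R. {u. a \<noteq> b \<longrightarrow> u (a, 1) \<noteq> u (b, 1)}) \<inter> (\<Inter>a\<in>R. {u. m a \<ge> 2 \<longrightarrow> u (a, 2) \<noteq> 0})"
  have o: "open {u::nat \<times> nat \<Rightarrow> 'k. P \<longrightarrow> u i \<noteq> f u}" if "continuous_on UNIV f" for P i f
    using that by (cases P) (auto intro!: open_Collect_neq continuous_intros)
  have "open ?V"
    using o[of "\<lambda>u. 0" True] o[of "\<lambda>u. u _" "_ \<noteq> _"] o[of "\<lambda>u. 0" "_ \<ge> _"]
    by (intro open_Int open_INT finite_atLeastAtMost ballI) auto
  moreover have "U = extensional I \<inter> ?V" by (auto simp: dom_U_def)
  ultimately show ?thesis by (auto simp: coord_domain_def openin_open)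
qed

lemma U_nonzero: "u \<in> U \<Longrightarrow> a \<in> R \<Longrightarrow> u (a, Suc 0) \<noteq> 0"
  by (simp add: dom_U_def)

lemma U_distinct: "u \<in> U \<Longrightarrow> a \<in> R \<Longrightarrow> b \<in> R \<Longrightarrow> a \<noteq> b \<Longrightarrow> u (a, Suc 0) \<noteq> u (b, Suc 0)"
  by (simp add: dom_U_def)

text \<open>The leading coefficient is the difference of two coordinates \<open>u (_, 1)\<close> off
  the diagonal and \<open>u (a, 2)\<close> on it, which the definition of the domain keeps away from
  zero.\<close>

lemma sep_unit:
  assumes "u \<in> U" "a \<in> R" "b \<in> R"
  shows "sep m u a b $ 0 \<noteq> 0 \<or> (a = b \<and> m a = 1)"
  using assms m_pos[of a] by (auto simp: sep_def dom_U_def numeral_2_eq_2)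

lemma sep_degenerate: "m a = 1 \<Longrightarrow> sep m v a a = 0"
  by (simp add: sep_def fps_eq_iff)

text \<open>Exact as an identity of power series, not merely modulo the block size, and also in the
  degenerate case of a block of size one. Truncation is thereby confined to products of
  vectors.\<close>

lemma blk_eq_quo:
  assumes "u \<in> U" "a \<in> R" "b \<in> R"
  shows "blk m y a = fps_const (y (b, 1)) + (blk m u a - fps_const (u (b, 1))) * quo m u y a b"
proof (cases "a = b")
  case False
  then have "sep m u a b * inverse (sep m u a b) = 1"
    using sep_unit[OF assms] by (simp add: inverse_mult_eq_1')
  then have "sep m u a b * quo m u y a b = sep m y a b"
    by (simp add: quo_def mult.left_commute)
  then show ?thesis using False by (simp add: sep_def algebra_simps)
next
  case True
  have X: "blk m v a - fps_const (v (a, 1)) = fps_X * sep m v a a" for v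
    using m_pos[OF assms(2)] by (auto simp: fps_eq_iff sep_def)
  have "sep m u a a * quo m u y a a = sep m y a a"
  proof (cases "m a = 1")
    case True
    then show ?thesis by (simp add: sep_degenerate)
  next
    case False
    then have "sep m u a a * inverse (sep m u a a) = 1"
      using sep_unit[OF assms] True by (simp add: inverse_mult_eq_1')
    then show ?thesis by (simp add: quo_def mult.left_commute)
  qed
  then have "blk m y a - fps_const (y (a, 1)) = (blk m u a - fps_const (u (a, 1))) * quo m u y a a"
    unfolding X by (simp add: mult.assoc)
  then show ?thesis using True by (simp add: algebra_simps)
qed

text \<open>Only the denominator depends on the point, and its derivative is \<open>sep\<close> of
  the direction. The result is symmetric in the direction and \<open>y\<close>, which is the source
  of the cancellation of derivative terms in the curvature.\<close>

lemma has_fps_pd_quo: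
  assumes "u \<in> U" "a \<in> R" "b \<in> R"
  shows "has_fps_pd p (\<lambda>u. quo m u y a b) u (- (quo m u (basis_vec p) a b * quo m u y a b))"
proof (cases "sep m u a b $ 0 = 0")
  case True
  then have "a = b" "m a = 1" using sep_unit[OF assms] by auto
  then show ?thesis by (simp add: quo_def sep_degenerate has_fps_pd_const)
next
  case False
  show ?thesis
    unfolding quo_def
    using has_fps_pd_mult[OF has_fps_pd_const has_fps_pd_inverse[OF has_fps_pd_sep False]]
    by (simp add: mult_ac)
qed

lemma has_fps_pd_kap:
  assumes "u \<in> U" "a \<in> R"
  shows "has_fps_pd p (\<lambda>u. kap m s u a) u
    (- (of_bool s * kap m s u a * blk m (basis_vec p) a * kap m s u a))"
proof (cases s)
  case True
  have "blk m u a $ 0 \<noteq> 0" using U_nonzero[OF assms] m_pos[OF assms(2)] by simp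
  from has_fps_pd_inverse[OF has_fps_pd_blk this] show ?thesis
    using True by (simp add: kap_def)
qed (simp add: kap_def has_fps_pd_const)

text \<open>Symbols that stay in one block and depend only on k - i - j act as multiplication by a
  fixed series \<open>\<kappa>\<close>: 1 for the first product, the reciprocal of the block of
  \<open>u\<close> for the dual one.\<close>

lemma blk_tmult:
  assumes a: "a \<in> R"
    and c: "\<And>k i b d j. k < m a \<Longrightarrow> b \<in> R \<Longrightarrow> d \<in> R \<Longrightarrow> i < m b \<Longrightarrow> j < m d \<Longrightarrow> cc (a, Suc k) (b, Suc i) (d, Suc j) u =
      (if a = b \<and> a = d \<and> i + j \<le> k then \<kappa> $ (k - i - j) else 0)"
  shows "blk m (tmult I cc u x y) a = fps_cutoff (m a) (\<kappa> * blk m x a * blk m y a)"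
proof (rule fps_ext)
  fix k
  show "blk m (tmult I cc u x y) a $ k = fps_cutoff (m a) (\<kappa> * blk m x a * blk m y a) $ k"
  proof (cases "k < m a")
    case k: True
    have "tmult I cc u x y (a, Suc k) = (\<Sum>b\<in>R. \<Sum>i<m b. \<Sum>d\<in>R. \<Sum>j<m d.
        cc (a, Suc k) (b, Suc i) (d, Suc j) u * x (b, Suc i) * y (d, Suc j))"
      using a k by (simp add: tmult_def sum_I mem_I)
    also have "\<dots> = (\<Sum>b\<in>R. if b = a then (\<Sum>i<m a. \<Sum>j<m a.
        if i + j \<le> k then \<kappa> $ (k - i - j) * x (a, Suc i) * y (a, Suc j) else 0) else 0)"
    proof (rule sum.cong[OF refl])
      fix b assume b: "b \<in> R"
      have "(\<Sum>d\<in>R. \<Sum>j<m d. cc (a, Suc k) (b, Suc i) (d, Suc j) u * x (b, Suc i) * y (d, Suc j)) =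
          (if b = a then \<Sum>j<m a. if i + j \<le> k then \<kappa> $ (k - i - j) * x (a, Suc i) * y (a, Suc j) else 0 else 0)"
        if i: "i < m b" for i
      proof -
        have "(\<Sum>j<m d. cc (a, Suc k) (b, Suc i) (d, Suc j) u * x (b, Suc i) * y (d, Suc j)) =
          (if d = a then if b = a then \<Sum>j<m a. if i + j \<le> k then \<kappa> $ (k - i - j) * x (a, Suc i) * y (a, Suc j) else 0 else 0 else 0)"
          if "d \<in> R" for d
          using c[OF k b that i] by (auto intro!: sum.cong sum.neutral)
        then show ?thesis using a by (simp add: sum.delta)
      qed
      then show "(\<Sum>i<m b. \<Sum>d\<in>R. \<Sum>j<m d. cc (a, Suc k) (b, Suc i) (d, Suc j) u * x (b, Suc i) * y (d, Suc j)) =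
        (if b = a then (\<Sum>i<m a. \<Sum>j<m a.
        if i + j \<le> k then \<kappa> $ (k - i - j) * x (a, Suc i) * y (a, Suc j) else 0) else 0)"
        by simp
    qed
    also have "\<dots> = (\<Sum>i<m a. \<Sum>j<m a. if i + j \<le> k then \<kappa> $ (k - i - j) * x (a, Suc i) * y (a, Suc j) else 0)"
      using a by (simp add: sum.delta)
    also have "\<dots> = (\<kappa> * blk m x a * blk m y a) $ k"
      unfolding fps_triple_mult_nth[OF k] by (intro sum.cong refl) auto
    finally show ?thesis using k by simp
  qed simp
qed

lemma blk_tmult_prod_c:
  "a \<in> R \<Longrightarrow> blk m (tmult I prod_c u x y) a = fps_cutoff (m a) (kap m False u a * blk m x a * blk m y a)"
  by (rule blk_tmult) (auto simp: kap_def)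

lemma vec_eqI:
  assumes "\<And>a. a \<in> R \<Longrightarrow> blk m v a = blk m w a" "q \<in> I"
  shows "v q = w q"
  using assms(2)
proof (cases rule: idx_cases)
  case (1 a k)
  then have "blk m v a $ k = blk m w a $ k" using assms(1) by simp
  then show ?thesis using 1 by simp
qed

lemma blk_cong: "(\<And>q. q \<in> I \<Longrightarrow> v q = w q) \<Longrightarrow> a \<in> R \<Longrightarrow> blk m v a = blk m w a"
  by (auto simp: fps_eq_iff mem_I)

lemma blk_unit: "a \<in> R \<Longrightarrow> blk m (\<lambda>q. unit_e q u) a = 1"
  using m_pos by (fastforce simp: fps_eq_iff)

lemma inverse_blk:
  "u \<in> U \<Longrightarrow> a \<in> R \<Longrightarrow> blk m u a * inverse (blk m u a) = 1"
  using U_nonzero m_pos by (fastforce intro!: inverse_mult_eq_1')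

text \<open>Each block of \<open>u\<close> has a nonzero leading coefficient, so the equation
  defining \<open>inv_E\<close> has the truncated reciprocal as its only solution. Index
  \<open>k\<close> is coefficient \<open>k - 1\<close>; the value zero at index 0 is what makes
  truncated subtraction of indices harmless.\<close>

lemma inv_E_nth:
  assumes u: "u \<in> U" and a: "a \<in> R"
  shows "inv_E r m (a, k) u = (if 1 \<le> k \<and> k \<le> m a then inverse (blk m u a) $ (k - 1) else 0)"
proof -
  define w where "w = (\<lambda>q. if q \<in> I then inverse (blk m u (fst q)) $ (snd q - 1) else 0)"
  have vp: "vprod I prod_c (\<lambda>s _. v s) euler_E q u = tmult I prod_c u v u q" if "q \<in> I" for v q
    using that by (simp add: vprod_def tmult_def euler_E_def)
  have bw: "blk m w a = fps_cutoff (m a) (inverse (blk m u a))" if "a \<in> R" for a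
    using that by (auto simp: fps_eq_iff w_def mem_I)
  have one: "fps_cutoff (m a) (1::'k fps) = 1" if "a \<in> R" for a
    using m_pos[OF that] by (simp add: fps_cutoff_one)
  have "(THE w. (\<forall>q. q \<notin> I \<longrightarrow> w q = 0) \<and>
        (\<forall>q\<in>I. vprod I prod_c (\<lambda>s _. w s) euler_E q u = unit_e q u)) = w"
  proof (rule the_equality, intro conjI allI impI ballI)
    show "w q = 0" if "q \<notin> I" for q using that by (simp add: w_def)
    show "vprod I prod_c (\<lambda>s _. w s) euler_E q u = unit_e q u" if q: "q \<in> I" for q
      unfolding vp[OF q]
    proof (rule vec_eqI[OF _ q])
      fix a assume a: "a \<in> R"
      show "blk m (tmult I prod_c u w u) a = blk m (\<lambda>q. unit_e q u) a"
        unfolding blk_tmult_prod_c[OF a] blk_unit[OF a] bw[OF a]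
        using inverse_blk[OF u a] one[OF a]
        by (simp add: kap_def fps_cutoff_mult_left mult.commute[of "inverse _"])
    qed
  next
    fix v assume v: "(\<forall>q. q \<notin> I \<longrightarrow> v q = 0) \<and> (\<forall>q\<in>I. vprod I prod_c (\<lambda>s _. v s) euler_E q u = unit_e q u)"
    have "v q = w q" if q: "q \<in> I" for q
    proof (rule vec_eqI[OF _ q])
      fix a assume a: "a \<in> R"
      have "blk m (tmult I prod_c u v u) a = blk m (\<lambda>q. unit_e q u) a"
        by (rule blk_cong[OF _ a]) (use v vp in auto)
      then have *: "fps_cutoff (m a) (blk m v a * blk m u a) = fps_cutoff (m a) 1"
        using a by (simp add: blk_tmult_prod_c kap_def blk_unit one)
      have "blk m v a = fps_cutoff (m a) ((blk m v a * blk m u a) * inverse (blk m u a))"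
        using inverse_blk[OF u a] by (simp add: mult.assoc)
      also have "\<dots> = fps_cutoff (m a) (fps_cutoff (m a) (blk m v a * blk m u a) * inverse (blk m u a))"
        by (simp only: fps_cutoff_mult_left)
      also have "\<dots> = blk m w a"
        unfolding * by (simp add: fps_cutoff_mult_left bw[OF a])
      finally show "blk m v a = blk m w a" .
    qed
    then show "v = w" using v by (auto simp: w_def)
  qed
  then have "inv_E r m (a, k) u = w (a, k)" unfolding inv_E_def by (rule fun_cong)
  then show ?thesis using a by (auto simp: w_def mem_I)
qed

lemma prod_cs_nth:
  assumes "u \<in> U" "a \<in> R" "k < m a"
  shows "prod_cs r m (a, Suc k) (b, Suc i) (d, Suc j) u =
      (if a = b \<and> a = d \<and> i + j \<le> k then inverse (blk m u a) $ (k - i - j) else 0)"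
  using assms by (auto simp: inv_E_nth Suc_diff_le)

lemma blk_tmult_prod_cs:
  "u \<in> U \<Longrightarrow> a \<in> R \<Longrightarrow> blk m (tmult I (prod_cs r m) u x y) a = fps_cutoff (m a) (kap m True u a * blk m x a * blk m y a)"
  by (rule blk_tmult) (auto simp: kap_def prod_cs_nth simp del: prod_cs.simps)

end

section \<open>The connections in terms of power series\<close>

lemma fps_mult_nth_lessThan:
  fixes f h :: "'k::comm_ring_1 fps"
  assumes "k < M"
  shows "(h * f) $ k = (\<Sum>j<M. if j \<le> k then h $ (k - j) * f $ j else 0)"
proof -
  have "(h * f) $ k = (\<Sum>j=0..k. h $ (k - j) * f $ j)"
    unfolding mult.commute[of h f] fps_mult_nth by (simp add: mult.commute)
  also have "\<dots> = (\<Sum>j<M. if j \<le> k then h $ (k - j) * f $ j else 0)"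
    by (intro sum.mono_neutral_cong_left) (use assms in auto)
  finally show ?thesis .
qed

context block_data
begin

text \<open>The block \<open>a\<close> of the vector \<open>\<Gamma>(y, z)\<close>, for \<open>\<Gamma>\<close> or \<open>\<Gamma>\<^sup>*\<close> deformed by a multiple of the
  product, which goes into \<open>\<mu>\<close>. The argument \<open>z\<close> enters through its block \<open>zf\<close> and the leading
  coefficients \<open>zc\<close> of all its blocks.\<close>

definition conn_fps :: "bool \<Rightarrow> 'k \<Rightarrow> (nat \<times> nat \<Rightarrow> 'k) \<Rightarrow> (nat \<times> nat \<Rightarrow> 'k) \<Rightarrow> 'k fps \<Rightarrow> (nat \<Rightarrow> 'k) \<Rightarrow> nat \<Rightarrow> 'k fps" where
  "conn_fps s \<mu> u y zf zc a = - (\<Sum>b\<in>R. fps_const (c b) * quo m u y a b * (zf - fps_const (zc b)))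
     + fps_const \<mu> * kap m s u a * blk m y a * zf
     - fps_const (of_bool s * (\<Sum>b\<in>R. c b * kap m s u b $ 0 * y (b, 1) * zc b))"

abbreviation conn_blk where "conn_blk s \<mu> u y z a \<equiv> conn_fps s \<mu> u y (blk m z a) (\<lambda>b. z (b, 1)) a"

text \<open>The recursion solves, for its top coefficient, the equation that
  \<open>sep m u a b\<close> times the unknown series is the constant \<open>c b\<close>.\<close>

lemma gam_mixed_nth:
  assumes u: "u \<in> U" and ab: "a \<in> R" "b \<in> R" "a \<noteq> b" and k: "k < m a"
  shows "gam_mixed m \<epsilon> a b (Suc k) u = c b * inverse (sep m u a b) $ k"
  using k
proof (induction k rule: less_induct)
  case (less k)
  have s0: "sep m u a b $ 0 = u (a, 1) - u (b, 1)"
    using ab m_pos[OF ab(1)] by (simp add: sep_def)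
  show ?case
  proof (cases k)
    case 0
    then show ?thesis
      unfolding gam_mixed.simps[of m \<epsilon> a b "Suc k"] using s0
      by (simp add: c_def divide_inverse)
  next
    case (Suc l)
    have "(\<Sum>s\<in>{2..Suc k}. gam_mixed m \<epsilon> a b (Suc k + 1 - s) u * u (a, s)) =
        (\<Sum>i=1..k. gam_mixed m \<epsilon> a b (Suc (k - i)) u * u (a, Suc i))"
      by (rule sum.reindex_bij_witness[of _ Suc "\<lambda>i. i - 1"]) (auto simp: Suc_diff_le)
    also have "\<dots> = (\<Sum>i=1..k. c b * (sep m u a b $ i * inverse (sep m u a b) $ (k - i)))"
      using less ab by (intro sum.cong refl) (simp add: sep_def)
    finally have E: "(\<Sum>s\<in>{2..Suc k}. gam_mixed m \<epsilon> a b (Suc k + 1 - s) u * u (a, s)) =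
        c b * (\<Sum>i=1..k. sep m u a b $ i * inverse (sep m u a b) $ (k - i))"
      by (simp only: sum_distrib_left)
    have g: "gam_mixed m \<epsilon> a b (Suc k) u = - (1 / (u (a, 1) - u (b, 1))) *
        (\<Sum>s\<in>{2..Suc k}. gam_mixed m \<epsilon> a b (Suc k + 1 - s) u * u (a, s))"
      using Suc by (subst gam_mixed.simps) (simp only: if_False nat.distinct One_nat_def nat.inject simp_thms)
    have inv: "inverse (sep m u a b) $ k = - inverse (u (a, 1) - u (b, 1)) *
        (\<Sum>i=1..k. sep m u a b $ i * inverse (sep m u a b) $ (k - i))"
      unfolding Suc fps_inverse_nth_Suc s0 ..
    show ?thesis unfolding g E inv by (simp only: divide_inverse mult_1_left mult_minus_left mult_minus_right mult_ac)
  qed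
qed

lemma gam_mixed_diff:
  assumes "u \<in> U" "a \<in> R" "b \<in> R" "a \<noteq> b" "k < m a"
  shows "gam_mixed m \<epsilon> a b (Suc k - j) u = (if j \<le> k then c b * inverse (sep m u a b) $ (k - j) else 0)"
proof (cases "j \<le> k")
  case True
  then show ?thesis using gam_mixed_nth[OF assms(1-4), of "k - j"] assms(5) by (simp add: Suc_diff_le)
qed (simp add: gam_mixed.simps)

definition inv_sep_sum :: "(nat \<times> nat \<Rightarrow> 'k) \<Rightarrow> nat \<Rightarrow> 'k fps" where
  "inv_sep_sum u a = (\<Sum>b\<in>R - {a}. fps_const (c b) * inverse (sep m u a b))"

lemma sum_gam_mixed:
  assumes "u \<in> U" "a \<in> R" "k < m a"
  shows "(\<Sum>b\<in>R - {a}. gam_mixed m \<epsilon> a b (Suc k - j) u) = (if j \<le> k then inv_sep_sum u a $ (k - j) else 0)"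
proof -
  have "(\<Sum>b\<in>R - {a}. gam_mixed m \<epsilon> a b (Suc k - j) u) =
    (\<Sum>b\<in>R - {a}. if j \<le> k then c b * inverse (sep m u a b) $ (k - j) else 0)"
    by (intro sum.cong refl gam_mixed_diff assms) auto
  then show ?thesis by (simp add: inv_sep_sum_def fps_sum_nth)
qed

text \<open>The factor \<open>fps_X\<close> accounts for the shift between upper index
  \<open>n\<close> and coefficient n - 1, with value zero at index 0.\<close>

lemma gam_11_nth:
  assumes "u \<in> U" "a \<in> R" "n < m a"
  shows "gam_11 r m \<epsilon> a n u = - (fps_X * inv_sep_sum u a) $ n"
proof (cases n)
  case 0
  then show ?thesis by (simp add: gam_11_def gam_mixed.simps)
next
  case (Suc k)
  then show ?thesis using sum_gam_mixed[OF assms(1,2), of k 0] assms(3) by (simp add: gam_11_def)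
qed

text \<open>After subtraction of \<open>gam_11\<close> the recursion is the one for the reciprocal
  of \<open>sep m u a a\<close>, whose coefficients are the coordinates of the block from the second
  on, scaled by \<open>- c a\<close>.\<close>

lemma gam_22_nth:
  assumes u: "u \<in> U" and a: "a \<in> R" and n: "Suc n < m a"
  shows "gam_22 r m \<epsilon> a (n + 2) u = gam_11 r m \<epsilon> a n u - c a * inverse (sep m u a a) $ n"
  using n
proof (induction n rule: less_induct)
  case (less n)
  have s: "sep m u a a $ i = u (a, i + 2)" if "Suc i < m a" for i
    using that by (simp add: sep_def)
  have u2: "sep m u a a $ 0 = u (a, 2)" using less.prems by (simp add: s numeral_2_eq_2)
  have i0: "inverse (sep m u a a) $ 0 = inverse (u (a, 2))" using u2 by simp
  have g2: "gam_22 r m \<epsilon> a 2 u = - (c a / u (a, 2))" by (simp add: gam_22.simps c_def)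
  show ?case
  proof (cases n)
    case 0
    then show ?thesis using i0 g2 gam_11_nth[OF u a, of 0] less.prems
      by (simp add: divide_inverse numeral_2_eq_2)
  next
    case (Suc l)
    have "(\<Sum>l\<in>{1..n + 2 - 3}. (gam_22 r m \<epsilon> a (l + 2) u - gam_11 r m \<epsilon> a l u) * u (a, n + 2 - l)) =
        (\<Sum>l=1..<n. - (c a * (inverse (sep m u a a) $ l * sep m u a a $ (n - l))))"
      using less Suc by (intro sum.cong) (auto simp: s Suc_diff_le)
    \<comment> \<open>Reflecting the index brings the convolution into the order used by the
      recursion for reciprocals.\<close>
    also have "\<dots> = (\<Sum>i=1..<n. - (c a * (sep m u a a $ i * inverse (sep m u a a) $ (n - i))))"
      by (rule sum.reindex_bij_witness[of _ "\<lambda>i. n - i" "\<lambda>i. n - i"]) auto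
    also have "\<dots> = - (c a * (\<Sum>i=1..<n. sep m u a a $ i * inverse (sep m u a a) $ (n - i)))"
      by (simp add: sum_negf sum_distrib_left)
    finally have 1: "gam_22 r m \<epsilon> a (n + 2) u = gam_11 r m \<epsilon> a n u + c a / u (a, 2) * (u (a, n + 2) / u (a, 2))
      + 1 / u (a, 2) * (c a * (\<Sum>i=1..<n. sep m u a a $ i * inverse (sep m u a a) $ (n - i)))"
      unfolding gam_22.simps[of r m \<epsilon> a "n + 2"] using Suc g2 by simp
    \<comment> \<open>The top term of the convolution is the separate summand
      \<open>u (a, n + 2) / u (a, 2)\<close> in the definition of \<open>gam_22\<close>.\<close>
    have "{1..n} = insert n {1..<n}" using Suc by auto
    then have "(\<Sum>i=1..n. sep m u a a $ i * inverse (sep m u a a) $ (n - i)) =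
        u (a, n + 2) / u (a, 2) + (\<Sum>i=1..<n. sep m u a a $ i * inverse (sep m u a a) $ (n - i))"
      using less.prems i0 by (simp add: s divide_inverse)
    then have inv: "inverse (sep m u a a) $ n = - inverse (u (a, 2)) *
        (u (a, n + 2) / u (a, 2) + (\<Sum>i=1..<n. sep m u a a $ i * inverse (sep m u a a) $ (n - i)))"
      using fps_inverse_nth_Suc[of "sep m u a a" l] Suc u2 by simp
    show ?thesis unfolding 1 inv by (simp add: algebra_simps divide_inverse)
  qed
qed

context
  fixes a k u and y z :: "nat \<times> nat \<Rightarrow> 'k"
  assumes a: "a \<in> R" and k: "k < m a" and u: "u \<in> U"
begin

definition Gam_sum where
  "Gam_sum b d = (\<Sum>i<m b. \<Sum>j<m d. Gam r m \<epsilon> (a, Suc k) (b, Suc i) (d, Suc j) u * y (b, Suc i) * z (d, Suc j))"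

lemma sum_first:
  fixes f :: "nat \<Rightarrow> 'k" assumes "b \<in> R"
  shows "(\<Sum>i<m b. if i = 0 then f i else 0) = f 0"
  using m_pos[OF assms] by (simp add: sum.delta)

lemma Gam_sum_left:
  assumes b: "b \<in> R" "b \<noteq> a"
  shows "Gam_sum b a = (fps_const (c b) * fps_const (y (b, 1)) * inverse (sep m u a b) * blk m z a) $ k"
proof -
  have "Gam_sum b a = (\<Sum>i<m b. if i = 0 then (\<Sum>j<m a. (if j \<le> k then c b * inverse (sep m u a b) $ (k - j) else 0) * y (b, Suc i) * z (a, Suc j)) else 0)"
    unfolding Gam_sum_def by (intro sum.cong refl) (use b gam_mixed_diff[OF u a b(1) b(2)[symmetric] k] in \<open>auto intro!: sum.cong\<close>)
  also have "\<dots> = (\<Sum>j<m a. (if j \<le> k then c b * inverse (sep m u a b) $ (k - j) else 0) * y (b, 1) * z (a, Suc j))"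
    by (simp add: sum_first[OF b(1)])
  also have "\<dots> = c b * y (b, 1) * (inverse (sep m u a b) * blk m z a) $ k"
    unfolding fps_mult_nth_lessThan[OF k] sum_distrib_left by (intro sum.cong refl) auto
  finally show ?thesis by (simp add: mult.assoc)
qed

lemma Gam_sum_right:
  assumes b: "b \<in> R" "b \<noteq> a"
  shows "Gam_sum a b = (fps_const (c b) * fps_const (z (b, 1)) * inverse (sep m u a b) * blk m y a) $ k"
proof -
  have "Gam_sum a b = (\<Sum>i<m a. \<Sum>j<m b. if j = 0 then (if i \<le> k then c b * inverse (sep m u a b) $ (k - i) else 0) * y (a, Suc i) * z (b, Suc j) else 0)"
    unfolding Gam_sum_def by (intro sum.cong refl) (use b gam_mixed_diff[OF u a b(1) b(2)[symmetric] k] in auto)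
  also have "\<dots> = (\<Sum>i<m a. (if i \<le> k then c b * inverse (sep m u a b) $ (k - i) else 0) * y (a, Suc i) * z (b, 1))"
    by (simp add: sum_first[OF b(1)])
  also have "\<dots> = c b * z (b, 1) * (inverse (sep m u a b) * blk m y a) $ k"
    unfolding fps_mult_nth_lessThan[OF k] sum_distrib_left by (intro sum.cong refl) auto
  finally show ?thesis by (simp add: mult.assoc)
qed

lemma Gam_sum_diag:
  assumes b: "b \<in> R" "b \<noteq> a"
  shows "Gam_sum b b = - (fps_const (c b) * fps_const (y (b, 1)) * fps_const (z (b, 1)) * inverse (sep m u a b)) $ k"
proof -
  have "Gam_sum b b = (\<Sum>i<m b. if i = 0 then (\<Sum>j<m b. if j = 0 then - (c b * inverse (sep m u a b) $ k * y (b, Suc i) * z (b, Suc j)) else 0) else 0)"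
    unfolding Gam_sum_def by (intro sum.cong refl) (use b gam_mixed_nth[OF u a b(1) b(2)[symmetric] k] m_pos[OF b(1)] in \<open>auto simp: mult_delta_left\<close>)
  also have "\<dots> = - (c b * inverse (sep m u a b) $ k * y (b, 1) * z (b, 1))"
    by (simp add: sum_first[OF b(1)])
  finally show ?thesis by (simp add: mult_ac)
qed

lemma Gam_sum_zero: "b \<noteq> a \<Longrightarrow> d \<noteq> a \<Longrightarrow> b \<noteq> d \<Longrightarrow> Gam_sum b d = 0"
  by (simp add: Gam_sum_def)

text \<open>The three summands come from lower indices with i = 1, with j = 1 and i at least 2, and
  with both at least 2. In the last case each vector loses its leading coefficient, hence
  \<open>sep\<close>, and one power of the variable remains because the symbols depend on k + 4 - i
  - j.\<close>

lemma Gam_sum_main: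
  "Gam_sum a a = (- (fps_const (y (a, 1)) * inv_sep_sum u a * blk m z a)
     - fps_const (z (a, 1)) * inv_sep_sum u a * (blk m y a - fps_const (y (a, 1)))
     + fps_X * ((- (fps_X * inv_sep_sum u a) - fps_const (c a) * inverse (sep m u a a)) * sep m y a a * sep m z a a)) $ k"
proof -
  define g where "g i j = Gam r m \<epsilon> (a, Suc k) (a, Suc i) (a, Suc j) u" for i j
  define H where "H = - (fps_X * inv_sep_sum u a) - fps_const (c a) * inverse (sep m u a a)"
  obtain M where M: "m a = Suc M" using k by (cases "m a") auto
  have g0: "g 0 j = - (if j \<le> k then inv_sep_sum u a $ (k - j) else 0)" for j
    using sum_gam_mixed[OF u a k, of j] by (simp add: g_def)
  have g1: "g (Suc i) 0 = - (if Suc i \<le> k then inv_sep_sum u a $ (k - Suc i) else 0)" for i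
    using sum_gam_mixed[OF u a k, of "Suc i"] by (simp add: g_def)
  have g2: "g (Suc i) (Suc j) = (if k \<ge> 1 \<and> i + j \<le> k - 1 then H $ (k - 1 - i - j) else 0)" for i j
  proof (cases "k \<ge> 1 \<and> i + j \<le> k - 1")
    case True
    then obtain n where kn: "k = Suc (i + j + n)"
      by (metis Suc_diff_1 le_Suc_ex less_le_trans zero_less_one)
    then have "Suc n < m a" using k by simp
    then show ?thesis
      using gam_22_nth[OF u a, of n] gam_11_nth[OF u a, of n] by (simp add: g_def H_def kn)
  qed (auto simp: g_def)
  have "Gam_sum a a = (\<Sum>i<Suc M. \<Sum>j<m a. g i j * y (a, Suc i) * z (a, Suc j))"
    by (simp add: Gam_sum_def g_def M del: Gam.simps)
  also have "\<dots> = (\<Sum>j<m a. g 0 j * y (a, 1) * z (a, Suc j)) +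
     ((\<Sum>i<M. g (Suc i) 0 * y (a, Suc (Suc i)) * z (a, 1)) +
      (\<Sum>i<M. \<Sum>j<M. g (Suc i) (Suc j) * y (a, Suc (Suc i)) * z (a, Suc (Suc j))))"
    unfolding M sum.lessThan_Suc_shift by (simp add: sum.distrib)
  also have "(\<Sum>j<m a. g 0 j * y (a, 1) * z (a, Suc j)) = - (y (a, 1) * (inv_sep_sum u a * blk m z a) $ k)"
    unfolding fps_mult_nth_lessThan[OF k] sum_distrib_left sum_negf[symmetric]
    by (intro sum.cong refl) (auto simp: g0)
  also have "(\<Sum>i<M. g (Suc i) 0 * y (a, Suc (Suc i)) * z (a, 1)) =
      - (z (a, 1) * (inv_sep_sum u a * (blk m y a - fps_const (y (a, 1)))) $ k)"
    unfolding fps_mult_nth_lessThan[OF k] M sum.lessThan_Suc_shift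
    by (simp add: sum_distrib_left sum_negf[symmetric] M) (intro sum.cong refl, auto simp: g1 M)
  also have "(\<Sum>i<M. \<Sum>j<M. g (Suc i) (Suc j) * y (a, Suc (Suc i)) * z (a, Suc (Suc j))) =
      (fps_X * (H * sep m y a a * sep m z a a)) $ k"
  proof (cases "k = 0")
    case True
    then show ?thesis by (simp add: g2)
  next
    case False
    then have "k - 1 < M" using k M by auto
    then show ?thesis
      using False unfolding fps_X_mult_nth fps_triple_mult_nth[OF \<open>k - 1 < M\<close>]
      by (simp add: sep_def M) (intro sum.cong refl, auto simp: g2 sep_def M)
  qed
  finally show ?thesis unfolding H_def by (simp add: mult.assoc)
qed

text \<open>Write S for \<open>inv_sep_sum u a\<close>. In the closed formula the blocks b other
  than a give - S y z plus the mixed terms \<open>?T\<close>. Splitting y and z into leading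
  coefficient and rest, - S y z is the sum of the S terms of \<open>Gam_sum_main\<close>, and its
  term with \<open>c a\<close> is the summand b = a.\<close>

lemma tmult_Gam: "tmult I (Gam r m \<epsilon>) u y z (a, Suc k) = conn_blk False 0 u y z a $ k"
proof -
  let ?iv = "\<lambda>b. inverse (sep m u a b)"
  have row: "(\<Sum>d\<in>R. Gam_sum b d) = Gam_sum b a + Gam_sum b b" if b: "b \<in> R" "b \<noteq> a" for b
  proof -
    have "(\<Sum>d\<in>R. Gam_sum b d) = (\<Sum>d\<in>{a, b}. Gam_sum b d)"
      using a b by (intro sum.mono_neutral_right) (auto simp: Gam_sum_zero)
    then show ?thesis using b by simp
  qed
  have "tmult I (Gam r m \<epsilon>) u y z (a, Suc k) = (\<Sum>b\<in>R. \<Sum>i<m b. \<Sum>d\<in>R. \<Sum>j<m d.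
      Gam r m \<epsilon> (a, Suc k) (b, Suc i) (d, Suc j) u * y (b, Suc i) * z (d, Suc j))"
    using a k by (simp add: tmult_def sum_I mem_I del: Gam.simps)
  also have "\<dots> = (\<Sum>b\<in>R. \<Sum>d\<in>R. Gam_sum b d)"
    unfolding Gam_sum_def by (intro sum.cong refl sum.swap)
  also have "\<dots> = Gam_sum a a + (\<Sum>d\<in>R - {a}. Gam_sum a d) + (\<Sum>b\<in>R - {a}. Gam_sum b a + Gam_sum b b)"
  proof -
    have "(\<Sum>b\<in>R. \<Sum>d\<in>R. Gam_sum b d) = (\<Sum>d\<in>R. Gam_sum a d) + (\<Sum>b\<in>R - {a}. \<Sum>d\<in>R. Gam_sum b d)"
      by (rule sum.remove) (use a in auto)
    also have "(\<Sum>d\<in>R. Gam_sum a d) = Gam_sum a a + (\<Sum>d\<in>R - {a}. Gam_sum a d)"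
      by (rule sum.remove) (use a in auto)
    also have "(\<Sum>b\<in>R - {a}. \<Sum>d\<in>R. Gam_sum b d) = (\<Sum>b\<in>R - {a}. Gam_sum b a + Gam_sum b b)"
      by (intro sum.cong refl row) auto
    finally show ?thesis .
  qed
  also have "\<dots> = Gam_sum a a + (\<Sum>b\<in>R - {a}. fps_const (c b) * ?iv b * (fps_const (y (b, 1)) * blk m z a
      + fps_const (z (b, 1)) * blk m y a - fps_const (y (b, 1)) * fps_const (z (b, 1)))) $ k"
    unfolding fps_sum_nth add.assoc sum.distrib[symmetric]
    by (intro arg_cong2[of _ _ _ _ "(+)"] refl sum.cong)
      (simp add: Gam_sum_left Gam_sum_right Gam_sum_diag algebra_simps del: fps_const_mult fps_mult_left_const_nth)
  also have "\<dots> = conn_blk False 0 u y z a $ k"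
  proof -
    let ?T = "\<Sum>b\<in>R - {a}. fps_const (c b) * ?iv b * (fps_const (y (b, 1)) * blk m z a
      + fps_const (z (b, 1)) * blk m y a - fps_const (y (b, 1)) * fps_const (z (b, 1)))"
    have X: "blk m v a = fps_const (v (a, 1)) + fps_X * sep m v a a" for v :: "nat \<times> nat \<Rightarrow> 'k"
      using m_pos[OF a] by (auto simp: fps_eq_iff sep_def)
    have "- conn_blk False 0 u y z a = (\<Sum>b\<in>R. fps_const (c b) * quo m u y a b * (blk m z a - fps_const (z (b, 1))))"
      by (simp add: conn_fps_def)
    also have "\<dots> = fps_const (c a) * quo m u y a a * (blk m z a - fps_const (z (a, 1)))
       + (\<Sum>b\<in>R - {a}. fps_const (c b) * quo m u y a b * (blk m z a - fps_const (z (b, 1))))"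
      by (rule sum.remove) (use a in auto)
    also have "(\<Sum>b\<in>R - {a}. fps_const (c b) * quo m u y a b * (blk m z a - fps_const (z (b, 1)))) =
       inv_sep_sum u a * blk m y a * blk m z a - ?T"
      unfolding inv_sep_sum_def sum_distrib_right sum_subtractf[symmetric]
      by (intro sum.cong refl) (auto simp: quo_def sep_def algebra_simps)
    finally have E: "- conn_blk False 0 u y z a = fps_const (c a) * quo m u y a a * (blk m z a - fps_const (z (a, 1)))
       + (inv_sep_sum u a * blk m y a * blk m z a - ?T)" .
    have "conn_blk False 0 u y z a = - (fps_const (c a) * quo m u y a a * (blk m z a - fps_const (z (a, 1)))
       + (inv_sep_sum u a * blk m y a * blk m z a - ?T))"
      using arg_cong[OF E, of uminus] by (simp only: minus_minus)
    also have "\<dots> = (- (fps_const (y (a, 1)) * inv_sep_sum u a * blk m z a)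
     - fps_const (z (a, 1)) * inv_sep_sum u a * (blk m y a - fps_const (y (a, 1)))
     + fps_X * ((- (fps_X * inv_sep_sum u a) - fps_const (c a) * inverse (sep m u a a)) * sep m y a a * sep m z a a)) + ?T"
      unfolding quo_def X by (simp add: algebra_simps)
    finally show ?thesis unfolding Gam_sum_main by (simp only: fps_add_nth)
  qed
  finally show ?thesis .
qed

end

end

section \<open>Smooth families of power series, and contractions with basis vectors\<close>

definition smooth_fps :: "'i set \<Rightarrow> ('i \<Rightarrow> 'k::real_normed_field) set \<Rightarrow> (('i \<Rightarrow> 'k) \<Rightarrow> 'k fps) \<Rightarrow> bool" where
  "smooth_fps I U F \<longleftrightarrow> (\<forall>n. smooth_fn I U (\<lambda>u. F u $ n))"

lemma smooth_fps_nth: "smooth_fps I U F \<Longrightarrow> smooth_fn I U (\<lambda>u. F u $ n)"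
  by (simp add: smooth_fps_def)

lemma smooth_fps_const: "smooth_fps I U (\<lambda>u. f)"
  by (simp add: smooth_fps_def smooth_const)

lemma smooth_fps_fps_const: "smooth_fn I U f \<Longrightarrow> smooth_fps I U (\<lambda>u. fps_const (f u))"
  unfolding smooth_fps_def
proof
  fix n assume "smooth_fn I U f"
  then show "smooth_fn I U (\<lambda>u. fps_const (f u) $ n)" by (cases "n = 0") (simp_all add: smooth_const)
qed

lemma smooth_fps_add:
  "coord_domain I U \<Longrightarrow> smooth_fps I U F \<Longrightarrow> smooth_fps I U G \<Longrightarrow> smooth_fps I U (\<lambda>u. F u + G u)"
  by (simp add: smooth_fps_def smooth_add)

lemma smooth_fps_diff:
  "coord_domain I U \<Longrightarrow> smooth_fps I U F \<Longrightarrow> smooth_fps I U G \<Longrightarrow> smooth_fps I U (\<lambda>u. F u - G u)"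
  by (simp add: smooth_fps_def smooth_diff)

lemma smooth_fps_minus: "coord_domain I U \<Longrightarrow> smooth_fps I U F \<Longrightarrow> smooth_fps I U (\<lambda>u. - F u)"
  by (simp add: smooth_fps_def smooth_minus)

lemma smooth_fps_sum:
  assumes "coord_domain I U" "\<And>i. i \<in> A \<Longrightarrow> smooth_fps I U (F i)"
  shows "smooth_fps I U (\<lambda>u. \<Sum>i\<in>A. F i u)"
  unfolding smooth_fps_def fps_sum_nth
  by (intro allI smooth_sum[OF assms(1)] smooth_fps_nth assms(2))

lemma smooth_fps_mult:
  assumes "coord_domain I U" "smooth_fps I U F" "smooth_fps I U G"
  shows "smooth_fps I U (\<lambda>u. F u * G u)"
  unfolding smooth_fps_def fps_mult_nth
  by (intro allI smooth_sum[OF assms(1)] smooth_mult[OF assms(1)] smooth_fps_nth assms(2,3))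

lemma smooth_fps_inverse:
  assumes dom: "coord_domain I U" and F: "smooth_fps I U F" and nz: "\<And>u. u \<in> U \<Longrightarrow> F u $ 0 \<noteq> 0"
  shows "smooth_fps I U (\<lambda>u. inverse (F u))"
  unfolding smooth_fps_def
proof
  have i0: "smooth_fn I U (\<lambda>u. inverse (F u $ 0))"
    by (rule smooth_inverse[OF dom smooth_fps_nth[OF F] nz])
  fix n show "smooth_fn I U (\<lambda>u. inverse (F u) $ n)"
  proof (induction n rule: less_induct)
    case (less n)
    show ?case
    proof (cases n)
      case 0
      then show ?thesis using i0 by simp
    next
      case (Suc k)
      show ?thesis
        unfolding Suc fps_inverse_nth_Suc
      proof (rule smooth_mult[OF dom smooth_minus[OF dom i0]], rule smooth_sum[OF dom])
        fix i assume "i \<in> {1..Suc k}"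
        then show "smooth_fn I U (\<lambda>u. F u $ i * inverse (F u) $ (Suc k - i))"
          using Suc by (intro smooth_mult[OF dom] smooth_fps_nth[OF F] less.IH) auto
      qed
    qed
  qed
qed

lemma tmult_basis:
  fixes c :: "('i, 'k::real_normed_field) symbols"
  assumes "finite I" "i \<in> I" "j \<in> I" "k \<in> I"
  shows "tmult I c u (basis_vec i) (basis_vec j) k = c k i j u"
proof -
  have "tmult I c u (basis_vec i) (basis_vec j) k = (\<Sum>i'\<in>I. (\<Sum>j'\<in>I. c k i' j' u * basis_vec j j') * basis_vec i i')"
    using assms(4) unfolding tmult_def sum_distrib_right by (simp add: mult_ac)
  then show ?thesis
    using assms by (simp add: basis_vec_def sum_delta_left)
qed

lemma tmult_left_basis:
  fixes c :: "('i, 'k::real_normed_field) symbols"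
  assumes "finite I" "i \<in> I" "k \<in> I"
  shows "tmult I c u (basis_vec i) w k = (\<Sum>l\<in>I. c k i l u * w l)"
proof -
  have "tmult I c u (basis_vec i) w k = (\<Sum>i'\<in>I. (\<Sum>j'\<in>I. c k i' j' u * w j') * basis_vec i i')"
    using assms(3) unfolding tmult_def sum_distrib_right by (simp add: mult_ac)
  then show ?thesis
    using assms by (simp add: basis_vec_def sum_delta_left)
qed

section \<open>The pencils of the two connections as one family\<close>

context block_data
begin

definition csum where "csum = (\<Sum>t\<in>R. c t)"

text \<open>The case distinction on k = 1 in the definition only hides a uniform formula: the sum
  over the other blocks differs from the full sum by \<open>c a\<close>, and this excess, times the
  leading coefficient of the reciprocal, is the missing diagonal case of the last correction
  term.\<close>

lemma Gam_s_eq: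
  assumes u: "u \<in> U" and a: "a \<in> R" "k < m a" and b: "b \<in> R" "d \<in> R"
  shows "Gam_s r m \<epsilon> (a, Suc k) (b, Suc i) (d, Suc j) u = Gam r m \<epsilon> (a, Suc k) (b, Suc i) (d, Suc j) u
     - (1 - csum) * prod_cs r m (a, Suc k) (b, Suc i) (d, Suc j) u
     - (if k = 0 \<and> (b, i) = (d, j) \<and> i = 0 then c b / u (b, 1) else 0)"
proof -
  have C: "(\<Sum>t\<in>R - {a}. of_nat (m t) * \<epsilon> t) = csum - c a"
    using a by (simp add: csum_def c_def sum_diff1)
  have C': "(\<Sum>t\<in>R. of_nat (m t) * \<epsilon> t) = csum" by (simp add: csum_def c_def)
  show ?thesis
  proof (cases "a = b \<and> a = d")
    case True
    have i0: "inv_E r m (a, Suc 0) u = inverse (u (a, Suc 0))"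
      using inv_E_nth[OF u a(1), of 1] m_pos[OF a(1)] by simp
    have iz: "inv_E r m (a, 0) u = 0" using inv_E_nth[OF u a(1), of 0] by simp
    \<comment> \<open>With upper index 1 and a lower index above 1, truncated subtraction yields
      index 0, where \<open>inv_E\<close> vanishes.\<close>
    show ?thesis
    proof (cases "k = 0 \<and> (i \<noteq> 0 \<or> j \<noteq> 0)")
      case k: True
      then have "Suc k + 2 - Suc i - Suc j = 0" by auto
      with True k show ?thesis using iz by (auto simp del: Gam.simps)
    next
      case False
      with True show ?thesis using i0 unfolding Gam_s.simps C C'
        by (auto simp: algebra_simps divide_inverse simp del: Gam.simps)
    qed
  next
    case False
    then show ?thesis unfolding Gam_s.simps C C' by (auto simp: c_def simp del: Gam.simps)
  qed
qed

lemma sum_first_index: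
  fixes f :: "nat \<Rightarrow> 'k"
  shows "(\<Sum>i\<in>I. \<Sum>j\<in>I. (if i = j \<and> snd i = Suc 0 then f (fst i) else 0) * y i * z j) =
    (\<Sum>b\<in>R. f b * y (b, 1) * z (b, 1))"
proof -
  have "(\<Sum>i\<in>I. \<Sum>j\<in>I. (if i = j \<and> snd i = Suc 0 then f (fst i) else 0) * y i * z j) =
    (\<Sum>i\<in>I. if snd i = Suc 0 then f (fst i) * y i * z i else 0)"
    by (intro sum.cong refl) (simp add: mult_delta_left)
  also have "\<dots> = (\<Sum>b\<in>R. f b * y (b, 1) * z (b, 1))"
    unfolding sum_I
  proof (rule sum.cong[OF refl])
    fix b assume "b \<in> R"
    then show "(\<Sum>k<m b. if snd (b, Suc k) = Suc 0 then f (fst (b, Suc k)) * y (b, Suc k) * z (b, Suc k) else 0) =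
      f b * y (b, 1) * z (b, 1)"
      using m_pos[of b] by (simp add: sum.delta)
  qed
  finally show ?thesis .
qed

definition conn :: "bool \<Rightarrow> 'k \<Rightarrow> (nat \<times> nat, 'k) symbols" where
  "conn s l = (\<lambda>k i j u. (if s then Gam_s r m \<epsilon> else Gam r m \<epsilon>) k i j u - l * (if s then prod_cs r m else prod_c) k i j u)"

text \<open>The total coefficient of the product in \<open>conn s l\<close>. The part
  \<open>- (1 - csum)\<close> is the value that makes \<open>E\<close> parallel for the dual
  connection.\<close>

definition mu :: "bool \<Rightarrow> 'k \<Rightarrow> 'k" where
  "mu s l = (if s then - (1 - csum) - l else - l)"

lemma tmult_diff_scale:
  assumes "k \<in> I" "\<And>i j. i \<in> I \<Longrightarrow> j \<in> I \<Longrightarrow> cc k i j u = c1 k i j u - t * c2 k i j u - h i j"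
  shows "tmult I cc u y z k = tmult I c1 u y z k - t * tmult I c2 u y z k - (\<Sum>i\<in>I. \<Sum>j\<in>I. h i j * y i * z j)"
  using assms by (simp add: tmult_def left_diff_distrib sum_subtractf sum_distrib_left mult.assoc)

lemma tmult_Gam_s:
  assumes u: "u \<in> U" and a: "a \<in> R" "k < m a"
  shows "tmult I (Gam_s r m \<epsilon>) u y z (a, Suc k) = tmult I (Gam r m \<epsilon>) u y z (a, Suc k)
     - (1 - csum) * tmult I (prod_cs r m) u y z (a, Suc k)
     - (if k = 0 then \<Sum>b\<in>R. c b / u (b, 1) * y (b, 1) * z (b, 1) else 0)"
proof -
  have "tmult I (Gam_s r m \<epsilon>) u y z (a, Suc k) = tmult I (Gam r m \<epsilon>) u y z (a, Suc k)
     - (1 - csum) * tmult I (prod_cs r m) u y z (a, Suc k)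
     - (\<Sum>i\<in>I. \<Sum>j\<in>I. (if i = j \<and> snd i = Suc 0 then (if k = 0 then c (fst i) / u (fst i, 1) else 0) else 0) * y i * z j)"
  proof (rule tmult_diff_scale)
    show "(a, Suc k) \<in> I" using a by (simp add: mem_I)
    fix i j assume "i \<in> I" "j \<in> I"
    then show "Gam_s r m \<epsilon> (a, Suc k) i j u = Gam r m \<epsilon> (a, Suc k) i j u
      - (1 - csum) * prod_cs r m (a, Suc k) i j u
      - (if i = j \<and> snd i = Suc 0 then (if k = 0 then c (fst i) / u (fst i, 1) else 0) else 0)"
      by (elim idx_cases) (simp add: Gam_s_eq[OF u a] del: Gam_s.simps Gam.simps prod_cs.simps)
  qed
  also have "(\<Sum>i\<in>I. \<Sum>j\<in>I. (if i = j \<and> snd i = Suc 0 then (if k = 0 then c (fst i) / u (fst i, 1) else 0) else 0) * y i * z j)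
    = (if k = 0 then \<Sum>b\<in>R. c b / u (b, 1) * y (b, 1) * z (b, 1) else 0)"
    by (subst sum_first_index) simp
  finally show ?thesis .
qed

lemma kap_0:
  assumes "u \<in> U" "a \<in> R"
  shows "kap m s u a $ 0 = (if s then inverse (u (a, 1)) else 1)"
  using m_pos[OF assms(2)] by (simp add: kap_def)

lemma blk_prod:
  assumes "u \<in> U" "a \<in> R"
  shows "blk m (tmult I (if s then prod_cs r m else prod_c) u x y) a =
    fps_cutoff (m a) (kap m s u a * blk m x a * blk m y a)"
  by (cases s) (simp_all add: blk_tmult_prod_c[OF assms(2)] blk_tmult_prod_cs[OF assms])

lemma blk_conn:
  assumes u: "u \<in> U" and a: "a \<in> R"
  shows "blk m (tmult I (conn s l) u y z) a = fps_cutoff (m a) (conn_blk s (mu s l) u y z a)"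
proof (rule fps_ext)
  fix k
  show "blk m (tmult I (conn s l) u y z) a $ k = fps_cutoff (m a) (conn_blk s (mu s l) u y z a) $ k"
  proof (cases "k < m a")
    case k: True
    then have ak: "(a, Suc k) \<in> I" using a by (simp add: mem_I)
    define P where "P = (kap m s u a * blk m y a * blk m z a) $ k"
    have p: "tmult I (if s then prod_cs r m else prod_c) u y z (a, Suc k) = P"
      unfolding P_def using arg_cong[OF blk_prod[OF u a, of s y z], of "\<lambda>f. f $ k"] k by simp
    have "tmult I (conn s l) u y z (a, Suc k) = tmult I (if s then Gam_s r m \<epsilon> else Gam r m \<epsilon>) u y z (a, Suc k)
      - l * tmult I (if s then prod_cs r m else prod_c) u y z (a, Suc k) - (\<Sum>i\<in>I. \<Sum>j\<in>I. 0 * y i * z j)"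
      by (rule tmult_diff_scale[OF ak]) (simp add: conn_def)
    also have "tmult I (if s then Gam_s r m \<epsilon> else Gam r m \<epsilon>) u y z (a, Suc k) =
      conn_blk False 0 u y z a $ k - (if s then (1 - csum) * P
        + (if k = 0 then \<Sum>b\<in>R. c b / u (b, 1) * y (b, 1) * z (b, 1) else 0) else 0)"
      using p by (cases s) (auto simp: tmult_Gam[OF a k u] tmult_Gam_s[OF u a k])
    finally have "tmult I (conn s l) u y z (a, Suc k) = conn_blk False 0 u y z a $ k
      + mu s l * P
      - of_bool s * (if k = 0 then \<Sum>b\<in>R. c b / u (b, 1) * y (b, 1) * z (b, 1) else 0)"
      unfolding p by (cases s) (simp_all add: mu_def algebra_simps)
    moreover have "(\<Sum>b\<in>R. c b * kap m s u b $ 0 * y (b, 1) * z (b, 1)) =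
        (\<Sum>b\<in>R. c b / u (b, 1) * y (b, 1) * z (b, 1))" if s
      using that by (intro sum.cong refl) (simp add: kap_0[OF u] divide_inverse)
    ultimately show ?thesis
      using k by (simp add: conn_fps_def mult.assoc P_def)
  qed simp
qed

lemma tmult_conn_nth:
  assumes "u \<in> U" "a \<in> R" "k < m a"
  shows "tmult I (conn s l) u y z (a, Suc k) = conn_blk s (mu s l) u y z a $ k"
  using arg_cong[OF blk_conn[OF assms(1,2), of s l y z], of "\<lambda>f. f $ k"] assms(3) by simp

lemma conn_nth:
  assumes "u \<in> U" "a \<in> R" "k < m a" "i \<in> I" "j \<in> I"
  shows "conn s l (a, Suc k) i j u = conn_blk s (mu s l) u (basis_vec i) (basis_vec j) a $ k"
  using tmult_conn_nth[OF assms(1-3), of s l "basis_vec i" "basis_vec j"] assms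
  by (simp add: tmult_basis mem_I)

lemma smooth_fps_blk: "smooth_fps I U (\<lambda>u. blk m u a)"
  unfolding smooth_fps_def
proof
  fix n show "smooth_fn I U (\<lambda>u. blk m u a $ n)"
    by (cases "n < m a") (simp_all add: smooth_coord smooth_const)
qed

lemma smooth_fps_quo:
  assumes "a \<in> R" "b \<in> R"
  shows "smooth_fps I U (\<lambda>u. quo m u y a b)"
proof (cases "a = b \<and> m a = 1")
  case True
  then show ?thesis by (auto simp: quo_def sep_degenerate smooth_fps_const)
next
  case False
  have "smooth_fps I U (\<lambda>u. sep m u a b)"
  proof (cases "a = b")
    case True
    then show ?thesis using smooth_fps_blk[of a] by (simp add: sep_def smooth_fps_def)
  next
    case False
    then show ?thesis
      using smooth_fps_diff[OF coord_domain_U smooth_fps_blk smooth_fps_fps_const[OF smooth_coord]]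
      by (simp add: sep_def)
  qed
  then show ?thesis
    unfolding quo_def using sep_unit[OF _ assms] False
    by (intro smooth_fps_mult[OF coord_domain_U] smooth_fps_const smooth_fps_inverse[OF coord_domain_U]) auto
qed

lemma smooth_fps_kap:
  assumes "a \<in> R"
  shows "smooth_fps I U (\<lambda>u. kap m s u a)"
proof (cases s)
  case True
  then show ?thesis
    unfolding kap_def using U_nonzero[OF _ assms] m_pos[OF assms]
    by (simp add: smooth_fps_inverse[OF coord_domain_U smooth_fps_blk])
qed (simp add: kap_def smooth_fps_const)

lemma smooth_fps_conn_blk:
  assumes "a \<in> R"
  shows "smooth_fps I U (\<lambda>u. conn_blk s \<mu> u y z a)"
proof -
  note dom = coord_domain_U
  have s1: "smooth_fps I U (\<lambda>u. \<Sum>b\<in>R. fps_const (c b) * quo m u y a b * (blk m z a - fps_const (z (b, 1))))"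
    by (rule smooth_fps_sum[OF dom])
      (intro smooth_fps_mult[OF dom] smooth_fps_const smooth_fps_quo assms)
  have s2: "smooth_fps I U (\<lambda>u. fps_const \<mu> * kap m s u a * blk m y a * blk m z a)"
    by (intro smooth_fps_mult[OF dom] smooth_fps_const smooth_fps_kap assms)
  have s3: "smooth_fps I U (\<lambda>u. fps_const (of_bool s * (\<Sum>b\<in>R. c b * kap m s u b $ 0 * y (b, 1) * z (b, 1))))"
    by (intro smooth_fps_fps_const smooth_mult[OF dom] smooth_const smooth_sum[OF dom]
        smooth_fps_nth smooth_fps_kap)
  show ?thesis
    unfolding conn_fps_def
    by (rule smooth_fps_diff[OF dom smooth_fps_add[OF dom smooth_fps_minus[OF dom s1] s2] s3])
qed

lemma is_symbols_conn: "is_symbols I U (conn s l)"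
  unfolding is_symbols_def
proof (intro ballI)
  fix q i j assume q: "q \<in> I" and ij: "i \<in> I" "j \<in> I"
  from q show "smooth_fn I U (conn s l q i j)"
  proof (cases rule: idx_cases)
    case (1 a k)
    show ?thesis
      by (rule smooth_cong[OF coord_domain_U smooth_fps_nth[OF smooth_fps_conn_blk[OF 1(2)], of s "mu s l" "basis_vec i" "basis_vec j" k]])
        (simp add: 1(1) conn_nth[OF _ 1(2,3) ij])
  qed
qed

section \<open>Derivatives and curvature of the family\<close>

definition conn_blk_pd where
  "conn_blk_pd s \<mu> u x y z a = (\<Sum>b\<in>R. fps_const (c b) * (quo m u x a b * quo m u y a b) * (blk m z a - fps_const (z (b, 1))))
    - of_bool s * (fps_const \<mu> * (kap m s u a * blk m x a * kap m s u a) * blk m y a * blk m z a)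
    + fps_const (of_bool s * (\<Sum>b\<in>R. c b * (kap m s u b $ 0 * x (b, 1) * kap m s u b $ 0) * y (b, 1) * z (b, 1)))"

lemma conn_blk_pd_commute: "conn_blk_pd s \<mu> u x y z a = conn_blk_pd s \<mu> u y x z a"
  by (simp add: conn_blk_pd_def mult_ac)

text \<open>The vectors \<open>y\<close> and \<open>z\<close> are constant, so the point enters only
  through \<open>quo\<close> and \<open>kap\<close>; each of these is differentiated into minus a
  product containing the direction symmetrically with \<open>y\<close>.\<close>

lemma has_fps_pd_conn_blk:
  assumes u: "u \<in> U" and a: "a \<in> R"
  shows "has_fps_pd p (\<lambda>u. conn_blk s \<mu> u y z a) u (conn_blk_pd s \<mu> u (basis_vec p) y z a)"
proof -
  let ?x = "basis_vec p"
  have cm: "has_fps_pd p (\<lambda>u. f * F u * g) u (f * D * g)" if "has_fps_pd p F u D" for f g F D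
    using has_fps_pd_mult[OF has_fps_pd_mult[OF has_fps_pd_const that] has_fps_pd_const] by simp
  have s1: "has_fps_pd p (\<lambda>u. \<Sum>b\<in>R. fps_const (c b) * quo m u y a b * (blk m z a - fps_const (z (b, 1)))) u
      (\<Sum>b\<in>R. fps_const (c b) * (- (quo m u ?x a b * quo m u y a b)) * (blk m z a - fps_const (z (b, 1))))"
    by (intro has_fps_pd_sum cm has_fps_pd_quo u a)
  have s2: "has_fps_pd p (\<lambda>u. fps_const \<mu> * kap m s u a * (blk m y a * blk m z a)) u
      (fps_const \<mu> * (- (of_bool s * kap m s u a * blk m ?x a * kap m s u a)) * (blk m y a * blk m z a))"
    by (intro cm has_fps_pd_kap u a)
  have k0: "has_pd p (\<lambda>u. kap m s u b $ 0) u (- (of_bool s * kap m s u b $ 0 * ?x (b, 1) * kap m s u b $ 0))"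
    if b: "b \<in> R" for b
    using has_fps_pd_nth[OF has_fps_pd_kap[OF u b, of p s], of 0] m_pos[OF b] by (cases s) simp_all
  have cm': "has_pd p (\<lambda>u. f * F u * g * h) u (f * D * g * h)" if "has_pd p F u D" for f g h F D
    using has_pd_mult[OF has_pd_mult[OF has_pd_mult[OF has_pd_const that] has_pd_const] has_pd_const] by simp
  have "has_pd p (\<lambda>u. \<Sum>b\<in>R. c b * kap m s u b $ 0 * y (b, 1) * z (b, 1)) u
    (\<Sum>b\<in>R. c b * (- (of_bool s * kap m s u b $ 0 * ?x (b, 1) * kap m s u b $ 0)) * y (b, 1) * z (b, 1))"
    by (intro has_pd_sum cm' k0)
  from has_fps_pd_fps_const[OF has_pd_mult[OF has_pd_const[of p "of_bool s"] this]]
  have s3: "has_fps_pd p (\<lambda>u. fps_const (of_bool s * (\<Sum>b\<in>R. c b * kap m s u b $ 0 * y (b, 1) * z (b, 1)))) u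
    (fps_const (of_bool s * (\<Sum>b\<in>R. c b * (- (of_bool s * kap m s u b $ 0 * ?x (b, 1) * kap m s u b $ 0)) * y (b, 1) * z (b, 1))))"
    by simp
  from has_fps_pd_diff[OF has_fps_pd_add[OF has_fps_pd_minus[OF s1] s2] s3] show ?thesis
    unfolding conn_fps_def conn_blk_pd_def
    by (cases s) (simp_all add: sum_negf mult.assoc fps_const_neg[symmetric] del: fps_const_neg)
qed

lemma pd_conn:
  assumes u: "u \<in> U" and a: "a \<in> R" "k < m a" and "p \<in> I" "i \<in> I" "j \<in> I"
  shows "pd p (conn s l (a, Suc k) i j) u = conn_blk_pd s (mu s l) u (basis_vec p) (basis_vec i) (basis_vec j) a $ k"
proof (rule has_pd_imp_pd)
  have "has_pd p (\<lambda>u. conn_blk s (mu s l) u (basis_vec i) (basis_vec j) a $ k) u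
      (conn_blk_pd s (mu s l) u (basis_vec p) (basis_vec i) (basis_vec j) a $ k)"
    by (rule has_fps_pd_nth[OF has_fps_pd_conn_blk[OF u a(1)]])
  then show "has_pd p (conn s l (a, Suc k) i j) u
      (conn_blk_pd s (mu s l) u (basis_vec p) (basis_vec i) (basis_vec j) a $ k)"
    by (rule has_pd_cong[OF coord_domain_U u \<open>p \<in> I\<close>, THEN iffD1, rotated])
      (simp add: conn_nth[OF _ a assms(5,6)])
qed

text \<open>Lets the inner connection be inserted untruncated into the outer one, so that the
  curvature can be treated in the full ring of power series.\<close>

lemma conn_fps_cutoff:
  "k < m a \<Longrightarrow> conn_fps s \<mu> u y (fps_cutoff (m a) zf) zc a $ k = conn_fps s \<mu> u y zf zc a $ k"
proof -
  assume k: "k < m a"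
  have *: "(f * (fps_cutoff (m a) zf - g)) $ k = (f * (zf - g)) $ k" "(f * fps_cutoff (m a) zf) $ k = (f * zf) $ k" for f g
    using k by (simp_all add: right_diff_distrib fps_cutoff_right_mult_nth)
  show ?thesis by (simp add: conn_fps_def fps_sum_nth *)
qed

lemma conn_fps_cong:
  assumes "\<And>b. b \<in> R \<Longrightarrow> zc b = zc' b"
  shows "conn_fps s \<mu> u y zf zc a = conn_fps s \<mu> u y zf zc' a"
  unfolding conn_fps_def by (simp only: assms cong: sum.cong)

text \<open>The abstract identity for W_b = u - u_b and V_gb = 1 / (u_g - u_b). The relations for
  kappa are 1/u_b - 1/u = (u - u_b) / (u u_b) and its analogue for two leading coefficients; for the
  first connection kappa = 1 and nu = 0 make them trivial.\<close>

lemma conn_fps_outer_commute: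
  assumes u: "u \<in> U" and a: "a \<in> R"
  shows "conn_fps s \<mu> u x (conn_blk s \<mu> u y z a) (\<lambda>b. conn_blk s \<mu> u y z b $ 0) a =
    conn_fps s \<mu> u y (conn_blk s \<mu> u x z a) (\<lambda>b. conn_blk s \<mu> u x z b $ 0) a"
proof -
  define V where "V g b = fps_const (inverse (u (g, 1) - u (b, 1)))" for g b
  define W where "W b = blk m u a - fps_const (u (b, 1))" for b
  define \<kappa>' where "\<kappa>' b = fps_const (kap m s u b $ 0)" for b
  define C where "C b = fps_const (c b)" for b
  have qd: "quotient_data R (\<lambda>b. fps_const (x (b, 1))) (\<lambda>b. fps_const (y (b, 1))) (quo m u x a) (quo m u y a) W \<kappa>' V
     (blk m x a) (blk m y a) (kap m s u a) (of_bool s)" for x y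
  proof
    show "f = 0" if "f + f = 0" for f :: "'k fps"
      using that by (auto simp: fps_eq_iff simp flip: mult_2)
    show "blk m x a = fps_const (x (b, 1)) + W b * quo m u x a b" if "b \<in> R" for b
      unfolding W_def by (rule blk_eq_quo[OF u a that])
    show "blk m y a = fps_const (y (b, 1)) + W b * quo m u y a b" if "b \<in> R" for b
      unfolding W_def by (rule blk_eq_quo[OF u a that])
    show "V b g = - V g b" for g b
      using inverse_minus_eq[of "u (g, 1) - u (b, 1)"] by (simp add: V_def)
    show "V g b * (W b - W g) = 1" if "g \<in> R" "b \<in> R" "g \<noteq> b" for g b
    proof -
      have "W b - W g = fps_const (u (g, 1) - u (b, 1))"
        unfolding W_def by (simp add: fps_eq_iff)
      then show ?thesis using U_distinct[OF u that] by (simp add: V_def)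
    qed
    show "\<kappa>' b - kap m s u a = of_bool s * kap m s u a * \<kappa>' b * W b" if b: "b \<in> R" for b
    proof (cases s)
      case True
      have "inverse (blk m u a) * fps_const (inverse (u (b, 1))) * W b =
        fps_const (inverse (u (b, 1))) * (blk m u a * inverse (blk m u a)) -
        inverse (blk m u a) * (fps_const (inverse (u (b, 1))) * fps_const (u (b, 1)))"
        by (simp add: W_def algebra_simps del: fps_const_mult)
      also have "\<dots> = fps_const (inverse (u (b, 1))) - inverse (blk m u a)"
        using inverse_blk[OF u a] U_nonzero[OF u b] by simp
      finally show ?thesis using True kap_0[OF u b, of s] by (simp add: \<kappa>'_def kap_def)
    next
      case False
      then show ?thesis by (simp add: \<kappa>'_def kap_def)
    qed
    show "of_bool s * V g b * (\<kappa>' b - \<kappa>' g) = of_bool s * of_bool s * \<kappa>' g * \<kappa>' b"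
      if "g \<in> R" "b \<in> R" "g \<noteq> b" for g b
    proof (cases s)
      case True
      have "inverse (u (g, 1) - u (b, 1)) * (inverse (u (b, 1)) - inverse (u (g, 1))) = inverse (u (g, 1)) * inverse (u (b, 1))"
        using U_distinct[OF u that] U_nonzero[OF u that(1)] U_nonzero[OF u that(2)]
        by (simp add: field_simps)
      then show ?thesis using True by (simp add: V_def \<kappa>'_def kap_0[OF u that(1)] kap_0[OF u that(2)])
    qed simp
  qed
  have out: "conn_fps s \<mu> u x (conn_blk s \<mu> u y z a) (\<lambda>b. conn_blk s \<mu> u y z b $ 0) a =
    quotient_data.outer R C (\<lambda>b. fps_const (x (b, 1))) (\<lambda>b. fps_const (y (b, 1))) (\<lambda>b. fps_const (z (b, 1)))
      (quo m u x a) (quo m u y a) \<kappa>' V (blk m x a) (blk m y a) (blk m z a) (kap m s u a) (fps_const \<mu>) (of_bool s)" for x y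
  proof -
    interpret q: quotient_data R C "\<lambda>b. fps_const (x (b, 1))" "\<lambda>b. fps_const (y (b, 1))" "\<lambda>b. fps_const (z (b, 1))"
      "quo m u x a" "quo m u y a" W \<kappa>' V "blk m x a" "blk m y a" "blk m z a" "kap m s u a" "fps_const \<mu>" "of_bool s"
      by (rule qd)
    have fb: "of_bool s = (fps_const (of_bool s) :: 'k fps)" by (cases s) simp_all
    have sc: "(\<Sum>b\<in>A. fps_const (f b)) = fps_const (\<Sum>b\<in>A. f b)" for f :: "nat \<Rightarrow> 'k" and A
      by (simp add: fps_eq_iff fps_sum_nth)
    have inner: "q.inner = conn_blk s \<mu> u y z a"
      unfolding q.inner_def conn_fps_def by (simp add: C_def \<kappa>'_def fb sc)
    have inner0: "q.inner0 g = fps_const (conn_blk s \<mu> u y z g $ 0)" if g: "g \<in> R" for g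
    proof -
      \<comment> \<open>For b = g both sides vanish through the factor in \<open>z\<close>, so the
        different form of \<open>quo\<close> on the diagonal does no harm.\<close>
      have Q: "quo m u y g b $ 0 * (z (g, 1) - z (b, 1)) = inverse (u (g, 1) - u (b, 1)) * ((y (g, 1) - y (b, 1)) * (z (g, 1) - z (b, 1)))" for b
        using m_pos[OF g] by (cases "g = b") (simp_all add: quo_def sep_def)
      have "(\<Sum>b\<in>R. c b * (quo m u y g b $ 0 * (z (g, 1) - z (b, 1)))) =
        (\<Sum>b\<in>R. c b * (inverse (u (g, 1) - u (b, 1)) * ((y (g, 1) - y (b, 1)) * (z (g, 1) - z (b, 1)))))"
        by (simp only: Q)
      then have "conn_blk s \<mu> u y z g $ 0 = - (\<Sum>b\<in>R. c b * (inverse (u (g, 1) - u (b, 1)) * (y (g, 1) - y (b, 1)) * (z (g, 1) - z (b, 1))))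
          + \<mu> * kap m s u g $ 0 * y (g, 1) * z (g, 1)
          - of_bool s * (\<Sum>b\<in>R. c b * kap m s u b $ 0 * y (b, 1) * z (b, 1))"
        using m_pos[OF g] by (simp add: conn_fps_def fps_sum_nth mult.assoc)
      then show ?thesis
        unfolding q.inner0_def by (simp add: C_def \<kappa>'_def V_def fb sc mult.assoc)
    qed
    have "q.outer = - (\<Sum>g\<in>R. C g * quo m u x a g * (conn_blk s \<mu> u y z a - fps_const (conn_blk s \<mu> u y z g $ 0)))
      + fps_const \<mu> * kap m s u a * blk m x a * conn_blk s \<mu> u y z a
     - of_bool s * (\<Sum>g\<in>R. C g * \<kappa>' g * fps_const (x (g, 1)) * fps_const (conn_blk s \<mu> u y z g $ 0))"
      unfolding q.outer_def inner by (simp only: inner0 cong: sum.cong)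
    then show ?thesis
      unfolding conn_fps_def[of s \<mu> u x "conn_blk s \<mu> u y z a"] by (simp add: C_def \<kappa>'_def fb sc)
  qed
  show ?thesis unfolding out by (rule quotient_data.outer_sym[OF qd])
qed

text \<open>Derivative terms and quadratic terms vanish separately: each is symmetric in the two
  directions, for every value of the deformation parameter.\<close>

lemma curv_conn:
  assumes u: "u \<in> U" and q: "q \<in> I" and i: "i \<in> I" and j: "j \<in> I" and t: "t \<in> I"
  shows "curv I (conn s l) q i j t u = 0"
  using q
proof (cases rule: idx_cases)
  case (1 a k)
  have prod: "(\<Sum>l'\<in>I. conn s l q i l' u * conn s l l' j t u) =
    conn_fps s (mu s l) u (basis_vec i) (conn_blk s (mu s l) u (basis_vec j) (basis_vec t) a)
      (\<lambda>b. conn_blk s (mu s l) u (basis_vec j) (basis_vec t) b $ 0) a $ k" if i: "i \<in> I" and j: "j \<in> I" for i j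
  proof -
    \<comment> \<open>The contraction of two symbols is the connection applied to the vector
      \<open>?w\<close>, which itself is a value of the connection.\<close>
    let ?w = "tmult I (conn s l) u (basis_vec j) (basis_vec t)"
    have "(\<Sum>l'\<in>I. conn s l q i l' u * conn s l l' j t u) = (\<Sum>l'\<in>I. conn s l q i l' u * ?w l')"
      by (intro sum.cong refl) (simp add: tmult_basis j t)
    also have "\<dots> = conn_blk s (mu s l) u (basis_vec i) ?w a $ k"
      unfolding tmult_left_basis[OF finite_I i q, symmetric] unfolding 1(1) by (rule tmult_conn_nth[OF u 1(2,3)])
    also have "\<dots> = conn_fps s (mu s l) u (basis_vec i) (blk m ?w a)
      (\<lambda>b. conn_blk s (mu s l) u (basis_vec j) (basis_vec t) b $ 0) a $ k"
    proof -
      have "?w (b, 1) = conn_blk s (mu s l) u (basis_vec j) (basis_vec t) b $ 0" if "b \<in> R" for b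
        using tmult_conn_nth[OF u that, of 0] m_pos[OF that] by simp
      then show ?thesis by (intro arg_cong[where f = "\<lambda>f. f $ k"] conn_fps_cong)
    qed
    finally show ?thesis unfolding blk_conn[OF u 1(2)] conn_fps_cutoff[OF 1(3)] .
  qed
  show ?thesis
    unfolding curv_def prod[OF i j] prod[OF j i]
    unfolding 1(1) pd_conn[OF u 1(2,3) i j t] pd_conn[OF u 1(2,3) j i t] conn_blk_pd_commute[of s "mu s l" u "basis_vec i"]
      conn_fps_outer_commute[OF u 1(2), of s "mu s l" "basis_vec i"]
    by simp
qed

end

lemma mult_tensor_eq_tmult:
  assumes "finite I" "i \<in> I" "k \<in> I"
  shows "mult_tensor I c X i k u = tmult I c u (\<lambda>j. X j u) (basis_vec k) i"
proof -
  have "tmult I c u (\<lambda>j. X j u) (basis_vec k) i = (\<Sum>j\<in>I. \<Sum>k'\<in>I. (c i j k' u * X j u) * basis_vec k k')"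
    using assms(2) by (simp add: tmult_def)
  then show ?thesis
    using assms by (simp add: mult_tensor_def basis_vec_def sum_delta_left)
qed

lemma tensor_app_mult_tensor:
  "i \<in> I \<Longrightarrow> tensor_app I (mult_tensor I c X) Y i u = tmult I c u (\<lambda>j. X j u) (\<lambda>j. Y j u) i"
  unfolding tensor_app_def mult_tensor_def tmult_def sum_distrib_right
  by (subst sum.swap) simp

lemma sum_symbols_tensor:
  fixes \<Gamma> :: "('i, 'k::real_normed_field) symbols"
  assumes "finite I" "i \<in> I" "j \<in> I"
  shows "(\<Sum>p\<in>I. \<Gamma> i j p u * v p) = tmult I \<Gamma> u (basis_vec j) v i"
  by (rule tmult_left_basis[OF assms(1,3,2), symmetric])

lemma fps_cutoff_mult_middle:
  fixes a b d :: "'k::comm_ring_1 fps"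
  shows "fps_cutoff n (a * fps_cutoff n b * d) = fps_cutoff n (a * b * d)"
  using fps_cutoff_mult_left[of n b "a * d"] by (simp add: mult_ac)

section \<open>The axioms of the two flat structures\<close>

context block_data
begin

abbreviation prod_s :: "bool \<Rightarrow> (nat \<times> nat, 'k) symbols" where
  "prod_s s \<equiv> if s then prod_cs r m else prod_c"

abbreviation unit_s :: "bool \<Rightarrow> (nat \<times> nat, 'k) vfield" where
  "unit_s s \<equiv> if s then euler_E else unit_e"

abbreviation Gam_of :: "bool \<Rightarrow> (nat \<times> nat, 'k) symbols" where
  "Gam_of s \<equiv> if s then Gam_s r m \<epsilon> else Gam r m \<epsilon>"

lemma conn_0: "conn s 0 = Gam_of s"
  by (simp add: conn_def)

text \<open>As a difference of two members of the pencil, the product inherits smoothness and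
  derivatives from \<open>conn\<close>.\<close>

lemma prod_s_conn: "prod_s s k i j = (\<lambda>u. conn s 0 k i j u - conn s 1 k i j u)"
  by (simp add: conn_def)

lemma is_symbols_prod: "is_symbols I U (prod_s s)"
  unfolding is_symbols_def prod_s_conn
  using is_symbols_conn by (intro ballI smooth_diff[OF coord_domain_U]) (auto simp: is_symbols_def)

lemma tmult_eqI:
  assumes "\<And>a. a \<in> R \<Longrightarrow> blk m (tmult I cc u x y) a = blk m (tmult I cc' u x' y') a"
  shows "tmult I cc u x y = tmult I cc' u x' y'"
proof
  fix k show "tmult I cc u x y k = tmult I cc' u x' y' k"
  proof (cases "k \<in> I")
    case True
    show ?thesis by (rule vec_eqI[OF _ True]) (rule assms)
  qed (simp add: tmult_def)
qed

lemma prod_comm: "u \<in> U \<Longrightarrow> tmult I (prod_s s) u x y = tmult I (prod_s s) u y x"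
  by (rule tmult_eqI) (simp only: blk_prod mult.assoc mult.commute mult.left_commute)

lemma prod_assoc:
  "u \<in> U \<Longrightarrow> tmult I (prod_s s) u (tmult I (prod_s s) u x y) z = tmult I (prod_s s) u x (tmult I (prod_s s) u y z)"
  by (rule tmult_eqI, simp only: blk_prod fps_cutoff_mult_right fps_cutoff_mult_middle) (simp only: mult_ac)

lemma blk_unit_s:
  assumes "u \<in> U" "a \<in> R"
  shows "kap m s u a * blk m (\<lambda>q. unit_s s q u) a = 1"
proof (cases s)
  case True
  then show ?thesis using inverse_blk[OF assms] by (simp add: kap_def euler_E_def[abs_def] mult.commute)
next
  case False
  then show ?thesis using blk_unit[OF assms(2)] by (simp add: kap_def)
qed

lemma blk_tvec: "a \<in> R \<Longrightarrow> blk m (tvec I u X) a = blk m (\<lambda>q. X q u) a"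
  by (rule blk_cong) (auto simp: tvec_def)

lemma prod_unit:
  assumes u: "u \<in> U" and k: "k \<in> I"
  shows "tmult I (prod_s s) u (tvec I u (unit_s s)) x k = x k"
proof (rule vec_eqI[OF _ k])
  fix a assume a: "a \<in> R"
  show "blk m (tmult I (prod_s s) u (tvec I u (unit_s s)) x) a = blk m x a"
    unfolding blk_prod[OF u a] blk_tvec[OF a] blk_unit_s[OF u a] by simp
qed

lemma conn_blk_pd_diff:
  "conn_blk_pd s \<mu> u x y z a - conn_blk_pd s \<mu>' u x y z a =
    - of_bool s * (fps_const (\<mu> - \<mu>') * (kap m s u a * blk m x a * (kap m s u a * blk m y a * blk m z a)))"
  by (simp add: conn_blk_pd_def algebra_simps flip: fps_const_sub)

text \<open>Differentiating y z / u along x gives - x y z / u^2, which is minus the dual product of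
  the three vectors; the first product has constant structure constants.\<close>

lemma pd_prod:
  assumes u: "u \<in> U" and p: "p \<in> I" and k: "k \<in> I" and i: "i \<in> I" and j: "j \<in> I"
  shows "pd p (prod_s s k i j) u =
    - of_bool s * tmult I (prod_s s) u (basis_vec p) (tmult I (prod_s s) u (basis_vec i) (basis_vec j)) k"
  using k
proof (cases rule: idx_cases)
  case (1 a n)
  have sm: "smooth_fn I U (conn s l k i j)" for l
    using is_symbols_conn[of s l] k i j by (simp add: is_symbols_def)
  have "pd p (prod_s s k i j) u = pd p (conn s 0 k i j) u - pd p (conn s 1 k i j) u"
    unfolding prod_s_conn by (rule has_pd_imp_pd[OF has_pd_diff]) (rule smooth_has_pd[OF sm u p])+
  also have "\<dots> = - of_bool s * (kap m s u a * blk m (basis_vec p) a * (kap m s u a * blk m (basis_vec i) a * blk m (basis_vec j) a)) $ n"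
    unfolding 1(1) pd_conn[OF u 1(2,3) p i j]
    unfolding fps_sub_nth[symmetric] conn_blk_pd_diff by (cases s) (simp_all add: mu_def mult_ac)
  also have "(kap m s u a * blk m (basis_vec p) a * (kap m s u a * blk m (basis_vec i) a * blk m (basis_vec j) a)) $ n
     = blk m (tmult I (prod_s s) u (basis_vec p) (tmult I (prod_s s) u (basis_vec i) (basis_vec j))) a $ n"
    unfolding blk_prod[OF u 1(2)] fps_cutoff_mult_right using 1(3) by simp
  also have "\<dots> = tmult I (prod_s s) u (basis_vec p) (tmult I (prod_s s) u (basis_vec i) (basis_vec j)) k"
    using 1 by simp
  finally show ?thesis .
qed

lemma is_vfield_unit_s: "is_vfield I U (unit_s s)"
proof -
  have "smooth_fn I U (euler_E k :: _ \<Rightarrow> 'k)" for k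
    using smooth_coord[of I U k] by (simp add: euler_E_def[abs_def])
  moreover have "smooth_fn I U (unit_e k :: _ \<Rightarrow> 'k)" for k
    by (cases k) (simp add: unit_e.simps[abs_def] smooth_const)
  ultimately show ?thesis by (simp add: is_vfield_def)
qed

lemma F_manifold_prod: "F_manifold I U (prod_s s) (unit_s s)"
  by (rule F_manifoldI[OF coord_domain_U is_symbols_prod is_vfield_unit_s prod_comm prod_assoc prod_unit pd_prod])

text \<open>By \<open>blk_eq_quo\<close> each summand is (u - u_b) Q_b(y) Q_b(z) up to a
  constant.\<close>

lemma conn_blk_commute:
  assumes u: "u \<in> U" and a: "a \<in> R"
  shows "conn_blk s \<mu> u y z a = conn_blk s \<mu> u z y a"
proof -
  have z: "blk m z a - fps_const (z (b, 1)) = (blk m u a - fps_const (u (b, 1))) * quo m u z a b" if "b \<in> R" for b z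
    using blk_eq_quo[OF u a that, of z] by (metis add_diff_cancel_left')
  have "(\<Sum>b\<in>R. fps_const (c b) * quo m u y a b * (blk m z a - fps_const (z (b, 1)))) =
     (\<Sum>b\<in>R. fps_const (c b) * quo m u z a b * (blk m y a - fps_const (y (b, 1))))"
    by (intro sum.cong refl) (simp only: z[of _ y] z[of _ z], simp only: mult_ac)
  moreover have "(\<Sum>b\<in>R. c b * kap m s u b $ 0 * y (b, 1) * z (b, 1)) = (\<Sum>b\<in>R. c b * kap m s u b $ 0 * z (b, 1) * y (b, 1))"
    by (simp only: mult_ac)
  ultimately show ?thesis unfolding conn_fps_def by (simp only: mult_ac)
qed

lemma conn_commute:
  assumes u: "u \<in> U" and k: "k \<in> I" and ij: "i \<in> I" "j \<in> I"
  shows "conn s l k i j u = conn s l k j i u"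
  using k
proof (cases rule: idx_cases)
  case (1 a n)
  show ?thesis
    unfolding 1(1) conn_nth[OF u 1(2,3) ij] conn_nth[OF u 1(2,3) ij(2,1)] by (simp only: conn_blk_commute[OF u 1(2)])
qed

text \<open>For the first connection every difference of \<open>unit_e\<close> with its leading
  coefficients is zero. For the dual one (u - u_b) Q_b(y) = y - y_b, the constants cancel, and the
  value of \<open>mu\<close> leaves - y, which offsets the derivative of \<open>E\<close> along
  y.\<close>

lemma conn_blk_unit_s:
  assumes u: "u \<in> U" and a: "a \<in> R"
  shows "conn_blk s (mu s 0) u y (\<lambda>q. unit_s s q u) a = - of_bool s * blk m y a"
proof (cases s)
  case False
  then show ?thesis by (simp add: conn_fps_def mu_def blk_unit[OF a])
next
  case True
  have "(\<Sum>b\<in>R. fps_const (c b) * quo m u y a b * (blk m u a - fps_const (u (b, 1)))) =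
    (\<Sum>b\<in>R. fps_const (c b) * (blk m y a - fps_const (y (b, 1))))"
  proof (intro sum.cong refl)
    fix b assume "b \<in> R"
    from blk_eq_quo[OF u a this, of y]
    show "fps_const (c b) * quo m u y a b * (blk m u a - fps_const (u (b, 1))) = fps_const (c b) * (blk m y a - fps_const (y (b, 1)))"
      by (simp add: mult.assoc mult.commute)
  qed
  also have "\<dots> = fps_const csum * blk m y a - fps_const (\<Sum>b\<in>R. c b * y (b, 1))"
    by (simp add: csum_def fps_eq_iff fps_sum_nth right_diff_distrib sum_subtractf sum_distrib_right)
  finally have 1: "(\<Sum>b\<in>R. fps_const (c b) * quo m u y a b * (blk m u a - fps_const (u (b, 1)))) =
    fps_const csum * blk m y a - fps_const (\<Sum>b\<in>R. c b * y (b, 1))" .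
  have 2: "(\<Sum>b\<in>R. c b * kap m s u b $ 0 * y (b, 1) * u (b, 1)) = (\<Sum>b\<in>R. c b * y (b, 1))"
  proof (intro sum.cong refl)
    fix b assume "b \<in> R"
    then show "c b * kap m s u b $ 0 * y (b, 1) * u (b, 1) = c b * y (b, 1)"
      using True U_nonzero[OF u] kap_0[OF u] by simp
  qed
  have 3: "fps_const (mu s 0) * kap m s u a * blk m y a * blk m u a = - (1 - fps_const csum) * blk m y a"
  proof -
    have "fps_const (mu s 0) * kap m s u a * blk m y a * blk m u a =
      fps_const (mu s 0) * blk m y a * (blk m u a * inverse (blk m u a))"
      using True by (simp add: kap_def mult_ac)
    also have "\<dots> = - (1 - fps_const csum) * blk m y a"
      unfolding inverse_blk[OF u a] using True by (simp add: mu_def fps_eq_iff algebra_simps)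
    finally show ?thesis .
  qed
  show ?thesis
    using True unfolding euler_E_def if_P[OF True] conn_fps_def 1 2 3
    by (simp add: algebra_simps)
qed

lemma pd_unit_s:
  assumes "i \<in> I" "k \<in> I"
  shows "pd i (unit_s s k) u = of_bool s * basis_vec i k"
proof (cases s)
  case True
  then show ?thesis using has_pd_imp_pd[OF has_pd_basis, of i k u] by (simp add: euler_E_def[abs_def])
next
  case False
  obtain a n where "k = (a, n)" by fastforce
  then have "unit_e k = (\<lambda>u. (if n = 1 then 1 else 0) :: 'k)" by auto
  then show ?thesis using False by (simp only: has_pd_imp_pd[OF has_pd_const] if_False) simp
qed

lemma cov_unit_s:
  assumes u: "u \<in> U" and k: "k \<in> I"
  shows "cov I (Gam_of s) X (unit_s s) k u = 0"
  using k
proof (cases rule: idx_cases)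
  case (1 a n)
  have "pd i (unit_s s k) u + (\<Sum>j\<in>I. Gam_of s k i j u * unit_s s j u) = 0" if i: "i \<in> I" for i
  proof -
    have "(\<Sum>j\<in>I. Gam_of s k i j u * unit_s s j u) = tmult I (conn s 0) u (basis_vec i) (\<lambda>q. unit_s s q u) k"
      unfolding conn_0 by (rule sum_symbols_tensor[OF finite_I k i])
    also have "\<dots> = (- of_bool s * blk m (basis_vec i) a) $ n"
      unfolding 1(1) tmult_conn_nth[OF u 1(2,3)] conn_blk_unit_s[OF u 1(2)] ..
    finally show ?thesis unfolding pd_unit_s[OF i k] using 1 by (cases s) simp_all
  qed
  then show ?thesis by (simp add: cov_def)
qed

lemma flat_F_manifold_prod: "flat_F_manifold I U (Gam_of s) (prod_s s) (unit_s s)"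
proof -
  have d: "deformed_cov I (Gam_of s) (prod_s s) l = cov I (conn s l)" for l
    unfolding deformed_cov_eq_cov conn_def ..
  have "flat I U (cov I (conn s l))" for l
    unfolding flat_cov_iff[OF coord_domain_U is_symbols_conn] by (intro ballI curv_conn)
  moreover have "torsionless I U (cov I (conn s l))" for l
    unfolding torsionless_cov_iff[OF finite_I] by (intro ballI conn_commute)
  moreover have "is_symbols I U (Gam_of s)"
    using is_symbols_conn[of s 0] by (simp only: conn_0)
  ultimately show ?thesis
    unfolding flat_F_manifold_def d vf_eq_def using F_manifold_prod[of s] cov_unit_s[of _ _ s] by blast
qed

section \<open>The inverse of \<open>E\<close> and the compatibility of the two structures\<close>

lemma blk_inv_E:
  "u \<in> U \<Longrightarrow> a \<in> R \<Longrightarrow> blk m (\<lambda>q. inv_E r m q u) a = fps_cutoff (m a) (inverse (blk m u a))"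
  by (auto simp: fps_eq_iff inv_E_nth)

lemma smooth_inv_E: "q \<in> I \<Longrightarrow> smooth_fn I U (inv_E r m q)"
proof (erule idx_cases)
  fix a k assume q: "q = (a, Suc k)" "a \<in> R" "k < m a"
  have "smooth_fn I U (\<lambda>u. kap m True u a $ k)"
    by (rule smooth_fps_nth[OF smooth_fps_kap[OF q(2)]])
  then show "smooth_fn I U (inv_E r m q)"
    by (rule smooth_cong[OF coord_domain_U]) (use q in \<open>simp add: inv_E_nth kap_def\<close>)
qed

definition inv_L :: "(nat \<times> nat, 'k) tensor11" where
  "inv_L = mult_tensor I prod_c (inv_E r m)"

lemma tensor_inverse_inv_L: "tensor_inverse I U (mult_tensor I prod_c euler_E) inv_L"
proof -
  have aux: "tensor_app I (mult_tensor I prod_c X) (tensor_app I (mult_tensor I prod_c Y) Z) k u = Z k u"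
    if u: "u \<in> U" and k: "k \<in> I" and XY: "\<And>a. a \<in> R \<Longrightarrow>
      fps_cutoff (m a) (blk m (\<lambda>q. X q u) a * blk m (\<lambda>q. Y q u) a) = fps_cutoff (m a) 1" for X Y Z k u
  proof -
    have "tensor_app I (mult_tensor I prod_c X) (tensor_app I (mult_tensor I prod_c Y) Z) k u =
      tmult I prod_c u (\<lambda>j. X j u) (tmult I prod_c u (\<lambda>j. Y j u) (\<lambda>j. Z j u)) k"
      unfolding tensor_app_mult_tensor[OF k]
      by (intro fun_cong[OF tmult_cong] refl) (simp add: tensor_app_mult_tensor)
    also have "\<dots> = Z k u"
    proof (rule vec_eqI[OF _ k, where w = "\<lambda>q. Z q u"])
      fix a assume a: "a \<in> R"
      have "blk m (tmult I prod_c u (\<lambda>j. X j u) (tmult I prod_c u (\<lambda>j. Y j u) (\<lambda>j. Z j u))) a =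
        fps_cutoff (m a) (fps_cutoff (m a) (blk m (\<lambda>q. X q u) a * blk m (\<lambda>q. Y q u) a) * blk m (\<lambda>q. Z q u) a)"
        unfolding blk_tmult_prod_c[OF a] by (simp add: kap_def fps_cutoff_mult_right fps_cutoff_mult_left mult.assoc)
      also have "\<dots> = blk m (\<lambda>q. Z q u) a"
        unfolding XY[OF a] by (simp add: fps_cutoff_mult_left)
      finally show "blk m (tmult I prod_c u (\<lambda>j. X j u) (tmult I prod_c u (\<lambda>j. Y j u) (\<lambda>j. Z j u))) a = blk m (\<lambda>q. Z q u) a" .
    qed
    finally show ?thesis .
  qed
  show ?thesis
    unfolding tensor_inverse_def vf_eq_def inv_L_def
  proof (intro allI impI conjI ballI)
    fix X k u assume "k \<in> I" and u: "u \<in> U"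
    have E: "blk m (\<lambda>q. euler_E q u) a = blk m u a" for a by (simp add: euler_E_def)
    have "fps_cutoff (m a) (blk m u a * inverse (blk m u a)) = fps_cutoff (m a) 1" if "a \<in> R" for a
      by (simp add: inverse_blk[OF u that])
    then show "tensor_app I (mult_tensor I prod_c euler_E) (tensor_app I (mult_tensor I prod_c (inv_E r m)) X) k u = X k u"
      "tensor_app I (mult_tensor I prod_c (inv_E r m)) (tensor_app I (mult_tensor I prod_c euler_E) X) k u = X k u"
      using \<open>k \<in> I\<close> u by (intro aux; simp only: E blk_inv_E fps_cutoff_mult_right fps_cutoff_mult_left mult.commute)+
  qed
qed

lemma is_tensor11_inv_L: "is_tensor11 I U inv_L"
  unfolding is_tensor11_def inv_L_def mult_tensor_def
proof (intro ballI)
  fix i k assume "i \<in> I" "k \<in> I"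
  then show "smooth_fn I U (\<lambda>u. \<Sum>j\<in>I. prod_c i j k u * inv_E r m j u :: 'k)"
    using is_symbols_prod[of False] smooth_inv_E
    by (intro smooth_sum[OF coord_domain_U] smooth_mult[OF coord_domain_U]) (auto simp: is_symbols_def)
qed

lemma prod_cs_inv_L:
  assumes u: "u \<in> U" and k: "k \<in> I"
  shows "vprod I (prod_cs r m) X Y k u = tensor_app I inv_L (vprod I prod_c X Y) k u"
proof -
  let ?x = "\<lambda>q. X q u" and ?y = "\<lambda>q. Y q u"
  have "vprod I (prod_cs r m) X Y k u = tmult I (prod_cs r m) u ?x ?y k"
    using k by (simp add: vprod_def tmult_def)
  also have "tmult I (prod_cs r m) u ?x ?y = tmult I prod_c u (\<lambda>q. inv_E r m q u) (tmult I prod_c u ?x ?y)"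
    by (rule tmult_eqI) (simp add: blk_tmult_prod_cs[OF u] blk_tmult_prod_c blk_inv_E[OF u] kap_def
        fps_cutoff_mult_right fps_cutoff_mult_left mult.assoc)
  also have "\<dots> = tmult I prod_c u (\<lambda>q. inv_E r m q u) (\<lambda>q. vprod I prod_c X Y q u)"
    by (rule tmult_cong) (simp_all add: vprod_def tmult_def)
  finally show ?thesis unfolding inv_L_def by (simp only: tensor_app_mult_tensor[OF k])
qed

lemma tder_euler:
  fixes u :: "nat \<times> nat \<Rightarrow> 'k"
  shows "tder I u X euler_E = tvec I u X"
proof
  fix k
  have "(\<Sum>i\<in>I. X i u * pd i (euler_E k) u) = X k u" if k: "k \<in> I"
  proof -
    have "(\<Sum>i\<in>I. X i u * pd i (euler_E k) u) = (\<Sum>i\<in>I. X i u * (if i = k then 1 else 0))"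
      using pd_unit_s[of _ k True u] k by (intro sum.cong refl) (auto simp: basis_vec_def)
    then show ?thesis using k by (simp add: sum_delta_left)
  qed
  then show "tder I u X euler_E k = tvec I u X k" by (simp add: tder_def tvec_def)
qed

lemma bracket_unit_euler:
  fixes u :: "nat \<times> nat \<Rightarrow> 'k"
  assumes k: "k \<in> I"
  shows "bracket I unit_e euler_E k u = unit_e k u"
proof -
  have "tder I u euler_E unit_e k = (0::'k)"
    using pd_unit_s[of _ k False u] k by (simp add: tder_def)
  moreover have "bracket I unit_e euler_E k u = tder I u unit_e euler_E k - tder I u euler_E unit_e k"
    using k by (simp add: bracket_def tder_def sum_subtractf)
  ultimately show ?thesis using k by (simp add: tder_euler tvec_def)
qed

text \<open>The derivative of \<open>E\<close> along any field is that field, so each bracket with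
  \<open>E\<close> contributes minus its second argument; the product is counted - 1 + 1 + 1 times,
  and the other derivatives cancel by the Leibniz rule.\<close>

lemma Lie_euler_prod:
  assumes X: "is_vfield I U X" and Y: "is_vfield I U Y" and u: "u \<in> U" and k: "k \<in> I"
  shows "bracket I euler_E (vprod I prod_c X Y) k u - vprod I prod_c (bracket I euler_E X) Y k u
     - vprod I prod_c X (bracket I euler_E Y) k u = vprod I prod_c X Y k u"
proof -
  have dc: "pd p (prod_c k i j) u = 0 * tmult I prod_c u (basis_vec p) (tmult I prod_c u (basis_vec i) (basis_vec j)) k"
    if "p \<in> I" "k \<in> I" "i \<in> I" "j \<in> I" for p k i j
    using pd_prod[OF u that, of False] by simp
  have d: "tder I u euler_E (vprod I prod_c X Y) = (\<lambda>k. tmult I prod_c u (tder I u euler_E X) (tvec I u Y) k +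
    tmult I prod_c u (tvec I u X) (tder I u euler_E Y) k)"
  proof -
    have "is_symbols I U (prod_c :: (nat \<times> nat, 'k) symbols)"
      using is_symbols_prod[of False] by simp
    from tder_vprod[OF coord_domain_U this u X Y dc, of euler_E] show ?thesis by simp
  qed
  have v: "V k u = tvec I u V k" for V :: "(nat \<times> nat, 'k) vfield" using k by (simp add: tvec_def)
  show ?thesis
    unfolding v[of "bracket _ _ _"] v[of "vprod _ _ _ _"] tvec_bracket tvec_vprod d tder_euler
    by (simp add: tvec_bracket tder_euler tvec_vprod tmult_diff)
qed

text \<open>On (x, X y) the two connections differ by a multiple of x X y / u and by a sum of c_b
  x_b X_b y_b / u_b, both symmetric in x and y; the derivative terms do not involve the
  connection.\<close>

lemma d_nabla_mult_tensor:
  assumes u: "u \<in> U" and ijk: "i \<in> I" "j \<in> I" "k \<in> I"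
  shows "d_nabla I (Gam r m \<epsilon>) (mult_tensor I prod_c X) i j k u = d_nabla I (Gam_s r m \<epsilon>) (mult_tensor I prod_c X) i j k u"
  using ijk(1)
proof (cases rule: idx_cases)
  case (1 a n)
  define w where "w k = tmult I prod_c u (\<lambda>q. X q u) (basis_vec k)" for k
  have V: "(\<Sum>p\<in>I. \<Gamma> i j p u * mult_tensor I prod_c X p k u) = tmult I \<Gamma> u (basis_vec j) (w k) i"
    if "j \<in> I" "k \<in> I" for \<Gamma> j k
    unfolding sum_symbols_tensor[where \<Gamma> = \<Gamma> and u = u, OF finite_I ijk(1) that(1)]
    by (rule fun_cong[OF tmult_cong]) (simp_all add: w_def mult_tensor_eq_tmult that)
  have bw: "blk m (w k) b = fps_cutoff (m b) (blk m (\<lambda>q. X q u) b * blk m (basis_vec k) b)" if "b \<in> R" for b k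
    using blk_tmult_prod_c[OF that] by (simp add: w_def kap_def)
  \<comment> \<open>Taking leading coefficients is multiplicative.\<close>
  have w1: "w k (b, 1) = X (b, 1) u * basis_vec k (b, 1)" if "b \<in> R" for b k
    using arg_cong[OF bw[OF that, of k], of "\<lambda>f. f $ 0"] m_pos[OF that] by simp
  define P where "P k = fps_cutoff (m a) (blk m (\<lambda>q. X q u) a * blk m (basis_vec k) a)" for k
  have D: "tmult I (Gam_s r m \<epsilon>) u (basis_vec j) (w k) i - tmult I (Gam r m \<epsilon>) u (basis_vec j) (w k) i =
    tmult I (Gam_s r m \<epsilon>) u (basis_vec k) (w j) i - tmult I (Gam r m \<epsilon>) u (basis_vec k) (w j) i"
  proof -
    have "tmult I (Gam_s r m \<epsilon>) u (basis_vec j) (w k) i - tmult I (Gam r m \<epsilon>) u (basis_vec j) (w k) i =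
      (fps_const (mu True 0) * kap m True u a * (blk m (basis_vec j) a * (blk m (\<lambda>q. X q u) a * blk m (basis_vec k) a))
        - fps_const (\<Sum>b\<in>R. c b * kap m True u b $ 0 * (X (b, 1) u * (basis_vec j (b, 1) * basis_vec k (b, 1))))) $ n"
      for j k
    proof -
      have g: "tmult I (Gam_s r m \<epsilon>) u (basis_vec j) (w k) i = conn_blk True (mu True 0) u (basis_vec j) (w k) a $ n"
        "tmult I (Gam r m \<epsilon>) u (basis_vec j) (w k) i = conn_blk False 0 u (basis_vec j) (w k) a $ n"
        unfolding 1(1) using tmult_conn_nth[OF u 1(2,3), of True 0] tmult_Gam[OF 1(2,3) u]
        by (simp_all add: conn_def)
      have "(\<Sum>b\<in>R. c b * kap m True u b $ 0 * basis_vec j (b, 1) * w k (b, 1)) =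
        (\<Sum>b\<in>R. c b * kap m True u b $ 0 * (X (b, 1) u * (basis_vec j (b, 1) * basis_vec k (b, 1))))"
        by (intro sum.cong refl) (simp only: w1 mult_ac)
      moreover have "(fps_const (mu True 0) * kap m True u a * blk m (basis_vec j) a * blk m (w k) a) $ n =
        (fps_const (mu True 0) * kap m True u a * (blk m (basis_vec j) a * (blk m (\<lambda>q. X q u) a * blk m (basis_vec k) a))) $ n"
        unfolding bw[OF 1(2)] fps_cutoff_right_mult_nth[OF 1(3)] by (simp only: mult.assoc)
      ultimately show ?thesis
        unfolding g conn_fps_def[of True] conn_fps_def[of False] by simp
    qed
    then show ?thesis by (simp only: mult.left_commute mult.commute)
  qed
  show ?thesis
    unfolding d_nabla_def V[OF ijk(2,3)] V[OF ijk(3,2)] using D by (simp add: algebra_simps)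
qed

text \<open>From Q_b(x) (u y - u_b y_b) = (x - x_b) y + u_b Q_b(x) (y - y_b), the second part being
  symmetric in x and y, one gets \<open>\<Gamma>(x, E y) - \<Gamma>(y, E x)\<close> = da0(x) y -
  da0(y) x. This is offset by the derivative of the term \<open>a0\<close>.\<close>

lemma d_nabla_L_a0:
  assumes u: "u \<in> U" and ijk: "i \<in> I" "j \<in> I" "k \<in> I"
  shows "d_nabla I (Gam r m \<epsilon>) (tensor_L_a0 r m \<epsilon>) i j k u = 0"
  using ijk(1)
proof (cases rule: idx_cases)
  case (1 a n)
  define w where "w k = tmult I prod_c u u (basis_vec k)" for k
  define \<alpha> where "\<alpha> j = (\<Sum>b\<in>R. c b * basis_vec j (b, 1))" for j :: "nat \<times> nat"
  have L: "tensor_L r m p k u = w k p" if "p \<in> I" "k \<in> I" for p k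
    using mult_tensor_eq_tmult[OF finite_I that, of prod_c euler_E u] by (simp add: tensor_L_def w_def euler_E_def)
  have pdL: "has_pd j (\<lambda>v. tensor_L r m i k v) u (prod_c i j k u)" if "j \<in> I" "k \<in> I" for j k
  proof -
    have cst: "prod_c i l k = (\<lambda>v. prod_c i l k u)" for l
      by (cases i; cases l; cases k) auto
    have "has_pd j (\<lambda>v. \<Sum>l\<in>I. prod_c i l k u * v l) u (\<Sum>l\<in>I. 0 * u l + prod_c i l k u * basis_vec j l)"
      by (intro has_pd_sum has_pd_mult has_pd_const has_pd_basis)
    moreover have "(\<lambda>v. tensor_L r m i k v) = (\<lambda>v. \<Sum>l\<in>I. prod_c i l k u * v l)"
      unfolding tensor_L_def mult_tensor_def euler_E_def by (intro ext sum.cong refl) (subst cst, rule refl)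
    ultimately show ?thesis using that by (simp add: basis_vec_def sum_delta_left)
  qed
  have pda: "has_pd j (a0 r m \<epsilon>) u (\<alpha> j)" for j
  proof -
    have "has_pd j (\<lambda>v. \<Sum>b\<in>R. c b * v (b, 1)) u (\<Sum>b\<in>R. 0 * u (b, 1) + c b * basis_vec j (b, 1))"
      by (intro has_pd_sum has_pd_mult has_pd_const has_pd_basis)
    then show ?thesis by (simp add: a0_def[abs_def] c_def \<alpha>_def)
  qed
  have pdV: "pd j (tensor_L_a0 r m \<epsilon> i k) u = prod_c i j k u - \<alpha> j * basis_vec k i" if "j \<in> I" "k \<in> I" for j k
    using has_pd_imp_pd[OF has_pd_diff[OF pdL[OF that] has_pd_mult[OF pda has_pd_const[of _ "basis_vec k i"]]]]
    by (simp add: tensor_L_a0_def[abs_def] basis_vec_def)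
  have sV: "(\<Sum>p\<in>I. Gam r m \<epsilon> i j p u * tensor_L_a0 r m \<epsilon> p k u) =
     conn_blk False 0 u (basis_vec j) (w k) a $ n - a0 r m \<epsilon> u * conn_blk False 0 u (basis_vec j) (basis_vec k) a $ n"
    if "j \<in> I" "k \<in> I" for j k
  proof -
    have "(\<Sum>p\<in>I. Gam r m \<epsilon> i j p u * tensor_L_a0 r m \<epsilon> p k u) =
      tmult I (Gam r m \<epsilon>) u (basis_vec j) (\<lambda>p. w k p - a0 r m \<epsilon> u * basis_vec k p) i"
      unfolding sum_symbols_tensor[where \<Gamma> = "Gam r m \<epsilon>" and u = u, OF finite_I ijk(1) that(1)]
      by (rule fun_cong[OF tmult_cong]) (simp_all add: L tensor_L_a0_def that basis_vec_def)
    then show ?thesis unfolding tmult_diff tmult_scale unfolding 1(1) tmult_Gam[OF 1(2,3) u] .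
  qed
  have bw: "blk m (w k) b = fps_cutoff (m b) (blk m u b * blk m (basis_vec k) b)" if "b \<in> R" for b k
    using blk_tmult_prod_c[OF that] by (simp add: w_def kap_def)
  have w1: "w k (b, 1) = u (b, 1) * basis_vec k (b, 1)" if "b \<in> R" for b k
    using arg_cong[OF bw[OF that, of k], of "\<lambda>f. f $ 0"] m_pos[OF that] by simp
  have sc: "(\<Sum>b\<in>A. fps_const (f b)) = fps_const (\<Sum>b\<in>A. f b)" for f :: "nat \<Rightarrow> 'k" and A
    by (simp add: fps_eq_iff fps_sum_nth)
  have key: "conn_blk False 0 u (basis_vec j) (w k) a $ n = (fps_const (\<alpha> j) * blk m (basis_vec k) a
      - (fps_const csum * (blk m (basis_vec j) a * blk m (basis_vec k) a)
      + (\<Sum>b\<in>R. fps_const (c b * u (b, 1)) * (quo m u (basis_vec j) a b * (blk m (basis_vec k) a - fps_const (basis_vec k (b, 1))))))) $ n" for j k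
  proof -
    let ?J = "blk m (basis_vec j) a" and ?K = "blk m (basis_vec k) a"
    have "conn_blk False 0 u (basis_vec j) (w k) a $ n =
      conn_fps False 0 u (basis_vec j) (blk m u a * ?K) (\<lambda>b. u (b, 1) * basis_vec k (b, 1)) a $ n"
      unfolding bw[OF 1(2)] conn_fps_cutoff[OF 1(3)]
      by (intro arg_cong[where f = "\<lambda>f. f $ n"] conn_fps_cong w1)
    also have "conn_fps False 0 u (basis_vec j) (blk m u a * ?K) (\<lambda>b. u (b, 1) * basis_vec k (b, 1)) a =
      - (\<Sum>b\<in>R. fps_const (c b) * (?J - fps_const (basis_vec j (b, 1))) * ?K
        + fps_const (c b * u (b, 1)) * (quo m u (basis_vec j) a b * (?K - fps_const (basis_vec k (b, 1)))))"
    proof -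
      have "fps_const (c b) * quo m u (basis_vec j) a b * (blk m u a * ?K - fps_const (u (b, 1) * basis_vec k (b, 1))) =
        fps_const (c b) * (?J - fps_const (basis_vec j (b, 1))) * ?K
        + fps_const (c b * u (b, 1)) * (quo m u (basis_vec j) a b * (?K - fps_const (basis_vec k (b, 1))))"
        if "b \<in> R" for b
        unfolding blk_eq_quo[OF u 1(2) that, of "basis_vec j"]
        by (simp add: algebra_simps flip: fps_const_mult)
      then have "(\<Sum>b\<in>R. fps_const (c b) * quo m u (basis_vec j) a b * (blk m u a * ?K - fps_const (u (b, 1) * basis_vec k (b, 1)))) =
        (\<Sum>b\<in>R. fps_const (c b) * (?J - fps_const (basis_vec j (b, 1))) * ?K
        + fps_const (c b * u (b, 1)) * (quo m u (basis_vec j) a b * (?K - fps_const (basis_vec k (b, 1)))))"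
        by (rule sum.cong[OF refl])
      then show ?thesis by (simp add: conn_fps_def)
    qed
    also have "\<dots> = fps_const (\<alpha> j) * ?K - (fps_const csum * (?J * ?K)
      + (\<Sum>b\<in>R. fps_const (c b * u (b, 1)) * (quo m u (basis_vec j) a b * (?K - fps_const (basis_vec k (b, 1))))))"
    proof -
      have "(\<Sum>b\<in>R. fps_const (c b) * (?J - fps_const (basis_vec j (b, 1))) * ?K) =
        fps_const csum * (?J * ?K) - fps_const (\<alpha> j) * ?K"
        by (simp add: csum_def \<alpha>_def right_diff_distrib left_diff_distrib sum_subtractf sum_distrib_right
            mult.assoc flip: sc)
      then show ?thesis by (simp add: sum.distrib)
    qed
    finally show ?thesis .
  qed
  have q: "quo m u (basis_vec j) a b * (blk m (basis_vec k) a - fps_const (basis_vec k (b, 1))) =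
    quo m u (basis_vec k) a b * (blk m (basis_vec j) a - fps_const (basis_vec j (b, 1)))" if "b \<in> R" for b
    unfolding blk_eq_quo[OF u 1(2) that, of "basis_vec j"] blk_eq_quo[OF u 1(2) that, of "basis_vec k"]
    by (simp add: mult_ac)
  have "conn_blk False 0 u (basis_vec j) (w k) a $ n - conn_blk False 0 u (basis_vec k) (w j) a $ n =
    \<alpha> j * basis_vec k i - \<alpha> k * basis_vec j i"
  proof -
    have sq: "(\<Sum>b\<in>R. fps_const (c b * u (b, 1)) * (quo m u (basis_vec j) a b * (blk m (basis_vec k) a - fps_const (basis_vec k (b, 1))))) =
      (\<Sum>b\<in>R. fps_const (c b * u (b, 1)) * (quo m u (basis_vec k) a b * (blk m (basis_vec j) a - fps_const (basis_vec j (b, 1)))))"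
      by (intro sum.cong refl arg_cong2[of _ _ _ _ "(*)"] q)
    show ?thesis
      unfolding key sq mult.commute[of "blk m (basis_vec j) a"] using 1 by simp
  qed
  moreover have "prod_c i j k u = (prod_c i k j u :: 'k)"
    by (cases i; cases j; cases k) auto
  ultimately show ?thesis
    unfolding d_nabla_def sV[OF ijk(2,3)] sV[OF ijk(3,2)] pdV[OF ijk(2,3)] pdV[OF ijk(3,2)]
      conn_blk_commute[OF u 1(2), of False 0 "basis_vec k" "basis_vec j"]
    by (simp add: algebra_simps)
qed

text \<open>Multiplication by a series is a Toeplitz matrix, with the leading coefficient all along
  the diagonal.\<close>

lemma a0_trace:
  "a0 r m \<epsilon> u = (\<Sum>a\<in>R. \<epsilon> a * (\<Sum>i\<in>{1..m a}. tensor_L r m (a, i) (a, i) u))"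
proof -
  have "tensor_L r m (a, i) (a, i) u = u (a, 1)" if "a \<in> R" "i \<in> {1..m a}" for a i
  proof -
    have "tensor_L r m (a, i) (a, i) u = (\<Sum>l\<in>I. if l = (a, 1) then u l else 0)"
      unfolding tensor_L_def mult_tensor_def euler_E_def
      by (intro sum.cong refl) (use that in \<open>auto simp: mem_I split: if_splits\<close>)
    then show ?thesis using m_pos[OF that(1)] that(1) by (simp add: mem_I)
  qed
  then show ?thesis by (simp add: a0_def mult_ac)
qed

lemma bi_flat: "bi_flat_F_manifold I U (Gam r m \<epsilon>) (Gam_s r m \<epsilon>) prod_c (prod_cs r m) unit_e euler_E"
  unfolding bi_flat_F_manifold_def
proof (intro conjI allI impI)
  show "flat_F_manifold I U (Gam r m \<epsilon>) prod_c unit_e"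
    using flat_F_manifold_prod[of False] by simp
  show "flat_F_manifold I U (Gam_s r m \<epsilon>) (prod_cs r m) euler_E"
    using flat_F_manifold_prod[of True] by simp
  show "\<exists>W. is_tensor11 I U W \<and> tensor_inverse I U (mult_tensor I prod_c euler_E) W \<and>
        (\<forall>X Y. is_vfield I U X \<longrightarrow> is_vfield I U Y \<longrightarrow>
           vf_eq I U (vprod I (prod_cs r m) X Y) (tensor_app I W (vprod I prod_c X Y)))"
    by (intro exI[of _ inv_L]) (simp add: is_tensor11_inv_L tensor_inverse_inv_L vf_eq_def prod_cs_inv_L)
  show "vf_eq I U (bracket I unit_e euler_E) unit_e"
    by (simp add: vf_eq_def bracket_unit_euler)
next
  fix X Y assume "is_vfield I U X" "is_vfield I U Y"
  then show "vf_eq I U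
          (\<lambda>k u. bracket I euler_E (vprod I prod_c X Y) k u - vprod I prod_c (bracket I euler_E X) Y k u
                 - vprod I prod_c X (bracket I euler_E Y) k u)
          (vprod I prod_c X Y)"
    unfolding vf_eq_def by (intro ballI Lie_euler_prod)
next
  fix X assume "is_vfield I U X"
  show "symbols_eq I U (d_nabla I (Gam r m \<epsilon>) (mult_tensor I prod_c X)) (d_nabla I (Gam_s r m \<epsilon>) (mult_tensor I prod_c X))"
    unfolding symbols_eq_def by (intro ballI d_nabla_mult_tensor)
qed

end

section \<open>Uniqueness\<close>

lemma tmult_expand_left:
  assumes "finite I"
  shows "tmult I c u x y k = (\<Sum>i\<in>I. x i * tmult I c u (basis_vec i) y k)"
proof -
  have "tmult I c u x y = tmult I c u (\<lambda>i. \<Sum>p\<in>I. x p * basis_vec p i) y"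
    by (rule tmult_cong) (simp_all add: basis_expand[OF assms, symmetric])
  then show ?thesis by (simp add: tmult_sum_left tmult_scale)
qed

lemma tmult_expand_right:
  assumes "finite I"
  shows "tmult I c u x y k = (\<Sum>i\<in>I. y i * tmult I c u x (basis_vec i) k)"
proof -
  have "tmult I c u x y = tmult I c u x (\<lambda>i. \<Sum>p\<in>I. y p * basis_vec p i)"
    by (rule tmult_cong) (simp_all add: basis_expand[OF assms, symmetric])
  then show ?thesis by (simp add: tmult_sum_right tmult_scale)
qed

lemma tmult_compose_expand:
  assumes "finite I"
  shows "tmult I \<Gamma> u x (tmult I c u w y) k = (\<Sum>i\<in>I. \<Sum>j\<in>I. x i * y j * tmult I \<Gamma> u (basis_vec i) (tmult I c u w (basis_vec j)) k)"
proof -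
  have "tmult I \<Gamma> u x (tmult I c u w y) k = (\<Sum>i\<in>I. x i * tmult I \<Gamma> u (basis_vec i) (tmult I c u w y) k)"
    by (rule tmult_expand_left[OF assms])
  also have "\<dots> = (\<Sum>i\<in>I. x i * tmult I \<Gamma> u (basis_vec i) (\<lambda>l. \<Sum>j\<in>I. y j * tmult I c u w (basis_vec j) l) k)"
    using tmult_expand_right[OF assms, of c u w y] by presburger
  finally show ?thesis by (simp add: tmult_sum_right tmult_scale sum_distrib_left mult.assoc)
qed

lemma flat_F_manifold_symmetric:
  assumes "flat_F_manifold I U \<Gamma> c e" "u \<in> U" "k \<in> I" "i \<in> I" "j \<in> I"
  shows "\<Gamma> k i j u = \<Gamma> k j i u"
proof -
  have "torsionless I U (deformed_cov I \<Gamma> c 0)"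
    using assms(1) unfolding flat_F_manifold_def by blast
  moreover have "finite I"
    using assms(1) by (intro coord_domain_finite[of I U]) (simp add: flat_F_manifold_def F_manifold_def)
  ultimately show ?thesis
    using assms(2-5) by (simp add: deformed_cov_eq_cov torsionless_cov_iff)
qed

lemma flat_F_manifold_unit:
  fixes \<Gamma> :: "('i, 'k::real_normed_field) symbols"
  assumes "flat_F_manifold I U \<Gamma> c e" "u \<in> U" "k \<in> I" "p \<in> I"
  shows "tmult I \<Gamma> u (basis_vec p) (\<lambda>q. e q u) k = - pd p (e k) u"
proof -
  have fin: "finite I"
    using assms(1) by (intro coord_domain_finite[of I U]) (simp add: flat_F_manifold_def F_manifold_def)
  have "cov I \<Gamma> (\<lambda>i u. basis_vec p i) e k u = 0"
    using assms is_vfield_const[of I U "basis_vec p"] unfolding flat_F_manifold_def vf_eq_def by blast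
  then have "(\<Sum>i\<in>I. (if i = p then 1 else 0) * (pd i (e k) u + (\<Sum>j\<in>I. \<Gamma> k i j u * e j u))) = 0"
    by (simp only: cov_def basis_vec_def)
  then have "pd p (e k) u + (\<Sum>j\<in>I. \<Gamma> k p j u * e j u) = 0"
    by (simp only: sum_delta_left[OF fin assms(4)])
  then show ?thesis
    unfolding tmult_left_basis[OF fin assms(4,3)] by (simp add: add_eq_0_iff)
qed

text \<open>The coefficient of the deformation parameter in the curvature of the deformed connection
  vanishes, for a product with constant structure constants.\<close>

lemma flat_F_manifold_compatible:
  fixes \<Gamma> :: "('i, 'k::real_normed_field) symbols"
  assumes F: "flat_F_manifold I U \<Gamma> c e" and c0: "\<And>k i j u v. c k i j u = c k i j v"
    and u: "u \<in> U" and k: "k \<in> I" and i: "i \<in> I" and j: "j \<in> I" and s: "s \<in> I"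
  shows "tmult I \<Gamma> u (basis_vec i) (tmult I c u (basis_vec j) (basis_vec s)) k +
      tmult I c u (basis_vec i) (tmult I \<Gamma> u (basis_vec j) (basis_vec s)) k =
      tmult I \<Gamma> u (basis_vec j) (tmult I c u (basis_vec i) (basis_vec s)) k +
      tmult I c u (basis_vec j) (tmult I \<Gamma> u (basis_vec i) (basis_vec s)) k"
proof -
  have dom: "coord_domain I U" and sG: "is_symbols I U \<Gamma>" and sc: "is_symbols I U c"
    using F by (simp_all add: flat_F_manifold_def F_manifold_def)
  note fin = coord_domain_finite[OF dom]
  have curv0: "curv I (\<lambda>k i j u. \<Gamma> k i j u - l * c k i j u) k i j s u = 0" for l
  proof -
    have "flat I U (deformed_cov I \<Gamma> c l)" using F unfolding flat_F_manifold_def by blast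
    then show ?thesis
      using flat_cov_iff[OF dom is_symbols_deformed[OF dom sG sc, of l]] u k i j s
      by (simp add: deformed_cov_eq_cov)
  qed
  have pd: "pd p (\<lambda>u. \<Gamma> k q s u - l * c k q s u) u = pd p (\<Gamma> k q s) u" if "p \<in> I" "q \<in> I" for p q l
  proof -
    have "has_pd p (\<Gamma> k q s) u (pd p (\<Gamma> k q s) u)"
      using sG k s that u by (auto simp: is_symbols_def intro: smooth_has_pd)
    from has_pd_diff[OF this has_pd_const[of p "l * c k q s u"]]
    have "has_pd p (\<lambda>v. \<Gamma> k q s v - l * c k q s u) u (pd p (\<Gamma> k q s) u)" by simp
    moreover have "(\<lambda>v. \<Gamma> k q s v - l * c k q s u) = (\<lambda>v. \<Gamma> k q s v - l * c k q s v)"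
      using c0 by metis
    ultimately show ?thesis using has_pd_imp_pd by metis
  qed
  have t: "(\<Sum>p\<in>I. A k i p u * B p j s u) = tmult I A u (basis_vec i) (tmult I B u (basis_vec j) (basis_vec s)) k"
    if "i \<in> I" "j \<in> I" for i j and A B :: "('i, 'k) symbols"
    unfolding tmult_left_basis[OF fin that(1) k]
    by (intro sum.cong refl) (simp add: tmult_basis[OF fin that(2) s])
  let ?t = "\<lambda>A B i j. tmult I A u (basis_vec i) (tmult I B u (basis_vec j) (basis_vec s)) k"
  have e: "(\<Sum>p\<in>I. (\<Gamma> k i p u - l * c k i p u) * (\<Gamma> p j s u - l * c p j s u)) =
     ?t \<Gamma> \<Gamma> i j - l * (?t \<Gamma> c i j + ?t c \<Gamma> i j) + l * l * ?t c c i j" if "i \<in> I" "j \<in> I" for i j l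
    unfolding t[OF that, symmetric] by (simp add: algebra_simps sum.distrib sum_subtractf sum_distrib_left)
  \<comment> \<open>Commutativity and associativity make the part quadratic in \<open>l\<close>
    disappear, so the curvature is affine in \<open>l\<close>.\<close>
  have cc: "?t c c i j = ?t c c j i"
  proof -
    let ?b = "\<lambda>p q (u::'i \<Rightarrow> 'k). basis_vec p q :: 'k"
    have bf: "is_vfield I U (?b p)" for p by (rule is_vfield_const)
    have "\<forall>X Y Z. is_vfield I U X \<longrightarrow> is_vfield I U Y \<longrightarrow> is_vfield I U Z \<longrightarrow>
        vf_eq I U (vprod I c (vprod I c X Y) Z) (vprod I c X (vprod I c Y Z))"
      and "\<forall>X Y. is_vfield I U X \<longrightarrow> is_vfield I U Y \<longrightarrow> vf_eq I U (vprod I c X Y) (vprod I c Y X)"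
      using F unfolding flat_F_manifold_def F_manifold_def by blast+
    then have as: "vf_eq I U (vprod I c (vprod I c (?b p) (?b q)) (?b s)) (vprod I c (?b p) (vprod I c (?b q) (?b s)))"
      and co: "vf_eq I U (vprod I c (?b p) (?b q)) (vprod I c (?b q) (?b p))" for p q
      using bf by blast+
    have eq: "tvec I u X = tvec I u Y" if "vf_eq I U X Y" for X Y
      using that u by (auto simp: tvec_def vf_eq_def)
    have tm: "tmult I c u (tvec I u (?b p)) w = tmult I c u (basis_vec p) w"
      "tmult I c u w (tvec I u (?b p)) = tmult I c u w (basis_vec p)" for p w
      by (rule tmult_cong; simp add: tvec_def)+
    have "tmult I c u (tmult I c u (basis_vec p) (basis_vec q)) (basis_vec s) = tmult I c u (basis_vec p) (tmult I c u (basis_vec q) (basis_vec s))" for p q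
      using eq[OF as[of p q]] by (simp only: tvec_vprod tm)
    moreover have "tmult I c u (basis_vec p) (basis_vec q) = tmult I c u (basis_vec q) (basis_vec p)" for p q
      using eq[OF co[of p q]] by (simp only: tvec_vprod tm)
    ultimately show ?thesis by metis
  qed
  have "curv I (\<lambda>k i j u. \<Gamma> k i j u - l * c k i j u) k i j s u =
    pd i (\<Gamma> k j s) u - pd j (\<Gamma> k i s) u + ?t \<Gamma> \<Gamma> i j - ?t \<Gamma> \<Gamma> j i
    - l * (?t \<Gamma> c i j + ?t c \<Gamma> i j - (?t \<Gamma> c j i + ?t c \<Gamma> j i))" for l
    unfolding curv_def e[OF i j] e[OF j i] pd[OF i j] pd[OF j i] cc by (simp add: algebra_simps)
  \<comment> \<open>An affine function vanishing at two points has zero slope.\<close>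
  from this[of 0] this[of 1] show ?thesis
    unfolding curv0 by (simp add: algebra_simps)
qed

section \<open>Generation by \<open>E\<close> and vanishing of the difference of two
  connections\<close>

context block_data
begin

definition vec :: "(nat \<Rightarrow> 'k fps) \<Rightarrow> nat \<times> nat \<Rightarrow> 'k" where
  "vec f q = f (fst q) $ (snd q - 1)"

lemma blk_vec: "blk m (vec f) a = fps_cutoff (m a) (f a)"
  by (simp add: fps_eq_iff vec_def)

text \<open>Multiplying the unit by powers of \<open>E - u\<^sup>1\<^sup>(\<^sup>d\<^sup>)\<close> for all \<open>d \<noteq> a\<close> gives a tangent
  vector that is supported and invertible in block \<open>a\<close>; its multiples by powers of
  \<open>E - u\<^sup>1\<^sup>(\<^sup>a\<^sup>)\<close> form a triangular basis of that block.\<close>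

lemma euler_generates:
  assumes u: "u \<in> U"
    and one: "P (\<lambda>q. unit_e q u)" and E: "\<And>z. P z \<Longrightarrow> P (tmult I prod_c u u z)"
    and add: "\<And>z w. P z \<Longrightarrow> P w \<Longrightarrow> P (\<lambda>i. z i + w i)" and scale: "\<And>t z. P z \<Longrightarrow> P (\<lambda>i. t * z i)"
    and cong: "\<And>z w. P z \<Longrightarrow> (\<And>i. i \<in> I \<Longrightarrow> z i = w i) \<Longrightarrow> P w"
  shows "P z"
proof -
  \<comment> \<open>The property is moved to tuples of untruncated series; \<open>Qcong\<close>
    allows changing them modulo the block sizes.\<close>
  define Q where "Q f = P (vec f)" for f
  have Qcong: "Q g" if f: "Q f" and eq: "\<And>a. a \<in> R \<Longrightarrow> fps_cutoff (m a) (f a) = fps_cutoff (m a) (g a)" for f g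
    unfolding Q_def
  proof (rule cong[OF f[unfolded Q_def]])
    fix q assume "q \<in> I"
    then show "vec f q = vec g q" by (rule vec_eqI[rotated]) (simp only: blk_vec eq)
  qed
  have Qadd: "Q (\<lambda>a. f a + g a)" if "Q f" "Q g" for f g
    using add[OF that[unfolded Q_def]] by (simp add: Q_def vec_def[abs_def])
  have Qscale: "Q (\<lambda>a. fps_const t * f a)" if "Q f" for t f
    using scale[OF that[unfolded Q_def], of t] by (simp add: Q_def vec_def[abs_def])
  have Q0: "Q (\<lambda>a. 0)" if "Q f" for f using Qscale[OF that, of 0] by simp
  have Q1: "Q (\<lambda>a. 1)"
    unfolding Q_def
  proof (rule cong[OF one], erule vec_eqI[rotated])
    fix a assume "a \<in> R"
    then show "blk m (\<lambda>q. unit_e q u) a = blk m (vec (\<lambda>a. 1)) a"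
      using m_pos[of a] by (simp only: blk_vec blk_unit) (simp add: fps_cutoff_one)
  qed
  have QE: "Q (\<lambda>a. blk m u a * f a)" if "Q f" for f
    unfolding Q_def
    by (rule cong[OF E[OF that[unfolded Q_def]]], erule vec_eqI[rotated])
      (simp only: blk_tmult_prod_c blk_vec kap_def if_False fps_cutoff_mult_right mult_1_left)
  have Qshift: "Q (\<lambda>a. (blk m u a - fps_const t) ^ n * f a)" if "Q f" for t f n
    using that
  proof (induction n arbitrary: f)
    case (Suc n)
    have "Q (\<lambda>a. blk m u a * f a + fps_const (- t) * f a)"
      by (intro Qadd QE Qscale Suc.prems)
    then have "Q (\<lambda>a. (blk m u a - fps_const t) * f a)"
      by (rule Qcong) (simp add: algebra_simps flip: fps_const_neg)
    from Suc.IH[OF this] show ?case by (simp add: mult_ac)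
  qed simp
  have Qprod: "Q (\<lambda>a. \<Prod>b\<in>B. (blk m u a - fps_const (u (b, 1))) ^ m b)" if "finite B" for B
    using that
  proof (induction B rule: finite_induct)
    case (insert b B)
    then show ?case using Qshift[OF insert.IH, of "u (b, 1)" "m b"] by simp
  qed (simp add: Q1)
  define single where "single a f b = (if b = a then f else 0)" for a b :: nat and f :: "'k fps"
  have X: "blk m u a - fps_const (u (a, 1)) = fps_X * sep m u a a" if "a \<in> R" for a
    using m_pos[OF that] by (auto simp: fps_eq_iff sep_def)
  have Qsingle: "Q (single a f)" if a: "a \<in> R" for a f
  proof -
    define h where "h b = (\<Prod>d\<in>R - {a}. (blk m u b - fps_const (u (d, 1))) ^ m d)" for b
    have h0: "h a $ 0 \<noteq> 0"
    proof -
      have "h a $ 0 = (\<Prod>d\<in>R - {a}. (u (a, 1) - u (d, 1)) ^ m d)"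
      proof -
        have "(\<Prod>d\<in>B. F d) $ 0 = (\<Prod>d\<in>B. F d $ 0)" for F :: "nat \<Rightarrow> 'k fps" and B
          by (induction B rule: infinite_finite_induct) simp_all
        then show ?thesis using m_pos[OF a] by (simp add: h_def fps_power_zeroth)
      qed
      also have "\<dots> \<noteq> 0"
        using U_distinct[OF u a] by (auto simp: prod_zero_iff)
      finally show ?thesis .
    qed
    \<comment> \<open>The factor of \<open>h b\<close> belonging to block b itself is divisible by
      the variable to the power \<open>m b\<close>.\<close>
    have hz: "fps_cutoff (m b) (h b * f) = 0" if b: "b \<in> R" "b \<noteq> a" for b f
    proof -
      have "h b = (fps_X * sep m u b b) ^ m b * (\<Prod>d\<in>R - {a} - {b}. (blk m u b - fps_const (u (d, 1))) ^ m d)"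
        unfolding h_def X[OF b(1), symmetric] by (rule prod.remove) (use b in auto)
      then have "h b * f = fps_X ^ m b * (sep m u b b ^ m b * (\<Prod>d\<in>R - {a} - {b}. (blk m u b - fps_const (u (d, 1))) ^ m d) * f)"
        by (simp add: power_mult_distrib mult_ac)
      then show ?thesis by (simp add: fps_eq_iff fps_X_power_mult_nth)
    qed
    have Qh: "Q (single a ((fps_X * sep m u a a) ^ j * h a))" for j
    proof (rule Qcong)
      show "Q (\<lambda>b. (blk m u b - fps_const (u (a, 1))) ^ j * h b)"
        unfolding h_def by (intro Qshift Qprod) simp
      show "fps_cutoff (m b) ((blk m u b - fps_const (u (a, 1))) ^ j * h b) =
          fps_cutoff (m b) (single a ((fps_X * sep m u a a) ^ j * h a) b)" if "b \<in> R" for b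
        using hz[OF that, of "(blk m u b - fps_const (u (a, 1))) ^ j"]
        by (cases "b = a") (simp_all add: single_def X[OF a, symmetric] mult.commute)
    qed
    \<comment> \<open>Downward induction on \<open>j\<close>: at j = \<open>m a\<close> the series
      is zero modulo the block size.\<close>
    have "Q (single a (fps_X ^ j * f))" if "j \<le> m a" for j f
      using that
    proof (induction "m a - j" arbitrary: j f)
      case 0
      have "Q (\<lambda>a. 0)" by (rule Q0[OF Q1])
      then show ?case
        by (rule Qcong) (use 0 in \<open>auto simp: single_def fps_eq_iff fps_X_power_mult_nth\<close>)
    next
      case (Suc l)
      define g where "g = sep m u a a ^ j * h a"
      have g0: "g $ 0 \<noteq> 0"
      proof (cases "j = 0")
        case True
        then show ?thesis using h0 by (simp add: g_def)
      next
        case False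
        then have "m a \<noteq> 1" using Suc by auto
        then have "sep m u a a $ 0 \<noteq> 0" using sep_unit[OF u a a] by auto
        then show ?thesis using h0 by (simp add: g_def fps_power_zeroth)
      qed
      \<comment> \<open>The multiple of \<open>g\<close> with the leading coefficient of
        \<open>f\<close> is split off; the rest has one more factor of the variable and falls under
        the induction hypothesis.\<close>
      define t where "t = f $ 0 / g $ 0"
      define f' where "f' = fps_shift 1 (f - fps_const t * g)"
      have f: "f = fps_const t * g + fps_X * f'"
      proof (rule fps_ext)
        fix n show "f $ n = (fps_const t * g + fps_X * f') $ n"
          using g0 by (cases n) (simp_all add: f'_def t_def)
      qed
      have "Q (\<lambda>b. fps_const t * single a ((fps_X * sep m u a a) ^ j * h a) b + single a (fps_X ^ Suc j * f') b)"
      proof (intro Qadd Qscale Qh)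
        show "Q (single a (fps_X ^ Suc j * f'))"
          by (rule Suc.hyps(1)) (use Suc.hyps(2) in auto)
      qed
      then show ?case
        by (rule Qcong) (auto simp: single_def f g_def power_mult_distrib algebra_simps)
    qed
    from this[of 0] show ?thesis by simp
  qed
  have "Q (\<lambda>b. \<Sum>a\<in>A. single a (blk m z a) b)" if "finite A" "A \<subseteq> R" for A
    using that
  proof (induction A rule: finite_induct)
    case empty
    show ?case using Q0[OF Q1] by simp
  next
    case (insert x A)
    have "Q (\<lambda>b. single x (blk m z x) b + (\<Sum>a\<in>A. single a (blk m z a) b))"
      by (intro Qadd insert.IH Qsingle) (use insert in auto)
    then show ?case using insert by simp
  qed
  from this[of R] have "Q (\<lambda>b. \<Sum>a\<in>R. single a (blk m z a) b)" by simp
  then show "P z"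
    unfolding Q_def
    by (rule cong, erule_tac vec_eqI[rotated]) (simp add: blk_vec single_def sum.delta')
qed

lemma unit_mult:
  assumes "u \<in> U"
  shows "tmult I prod_c u (\<lambda>q. unit_e q u) (tmult I \<Gamma> u x y) = tmult I \<Gamma> u x y"
proof
  fix k
  show "tmult I prod_c u (\<lambda>q. unit_e q u) (tmult I \<Gamma> u x y) k = tmult I \<Gamma> u x y k"
  proof (cases "k \<in> I")
    case True
    have "tmult I prod_c u (\<lambda>q. unit_e q u) (tmult I \<Gamma> u x y) = tmult I prod_c u (tvec I u unit_e) (tmult I \<Gamma> u x y)"
      by (rule tmult_cong) (simp_all add: tvec_def)
    then show ?thesis using prod_unit[OF assms True, of False] by simp
  qed (simp add: tmult_def)
qed

text \<open>The point \<open>u\<close>, read as a tangent vector, is the value of \<open>E\<close>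
  there. Once T(x, .) commutes with multiplication by \<open>E\<close>, its kernel contains the unit
  and is stable under \<open>E\<close>, hence is everything.\<close>

lemma connection_difference_zero:
  fixes T :: "(nat \<times> nat, 'k) symbols"
  assumes u: "u \<in> U"
    and sym: "\<And>x y. tmult I T u x y = tmult I T u y x"
    and unit: "\<And>x. tmult I T u x (\<lambda>q. unit_e q u) = (\<lambda>k. 0)"
    and comp: "\<And>x y z k. tmult I T u x (tmult I prod_c u y z) k + tmult I prod_c u x (tmult I T u y z) k =
      tmult I T u y (tmult I prod_c u x z) k + tmult I prod_c u y (tmult I T u x z) k"
    and euler: "\<And>x y. tmult I T u x (tmult I prod_c u u y) = tmult I T u y (tmult I prod_c u u x)"
  shows "tmult I T u x y = (\<lambda>k. 0)"
proof -
  let ?e = "\<lambda>q. unit_e q u :: 'k"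
  have comm: "tmult I prod_c u x y = tmult I prod_c u y x" for x y
    using prod_comm[OF u, of False] by simp
  have zero: "tmult I prod_c u x (\<lambda>k. 0) = (\<lambda>k. 0)" for x :: "nat \<times> nat \<Rightarrow> 'k"
    by (auto simp: tmult_def)
  have TE: "tmult I T u x u = (\<lambda>k. 0)" for x
  proof
    fix k
    \<comment> \<open>In \<open>comp\<close> for x, the unit and \<open>E\<close>, the terms T(x, E)
      and T(e, x E) agree by \<open>euler\<close>; what remains is x T(e, E) = T(x, E), and T(e, E)
      vanishes by symmetry and \<open>unit\<close>.\<close>
    have "tmult I prod_c u x (tmult I T u ?e u) k = tmult I prod_c u ?e (tmult I T u x u) k"
      using comp[of x ?e u k] euler[of x ?e] comm[of ?e u] comm[of x u] by simp
    then show "tmult I T u x u k = 0"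
      unfolding unit_mult[OF u] sym[of ?e u] unit zero by simp
  qed
  have T0: "tmult I T u u y = (\<lambda>k. 0)" for y using sym[of u y] TE by simp
  have TEz: "tmult I T u x (tmult I prod_c u u z) = tmult I prod_c u u (tmult I T u x z)" for z
  proof
    fix k
    show "tmult I T u x (tmult I prod_c u u z) k = tmult I prod_c u u (tmult I T u x z) k"
      using comp[of x u z k] by (simp add: T0 zero)
  qed
  show ?thesis
  proof (rule euler_generates[OF u, where P = "\<lambda>y. tmult I T u x y = (\<lambda>k. 0)"])
    show "tmult I T u x ?e = (\<lambda>k. 0)" by (rule unit)
    show "tmult I T u x (tmult I prod_c u u z) = (\<lambda>k. 0)" if "tmult I T u x z = (\<lambda>k. 0)" for z
      unfolding TEz that by (rule zero)
    show "tmult I T u x (\<lambda>i. z i + w i) = (\<lambda>k. 0)" if "tmult I T u x z = (\<lambda>k. 0)" "tmult I T u x w = (\<lambda>k. 0)" for z w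
      by (simp add: tmult_add that)
    show "tmult I T u x (\<lambda>i. t * z i) = (\<lambda>k. 0)" if "tmult I T u x z = (\<lambda>k. 0)" for t z
      by (simp add: tmult_scale that)
    show "tmult I T u x w = (\<lambda>k. 0)" if "tmult I T u x z = (\<lambda>k. 0)" "\<And>i. i \<in> I \<Longrightarrow> z i = w i" for z w
      using tmult_cong[of I x x z w T u] that by simp
  qed
qed

section \<open>Uniqueness of both connections and of the dual product\<close>

lemma tmult_symbols_diff:
  "tmult I (\<lambda>k i j u. A k i j u - B k i j u) u x y = (\<lambda>k. tmult I A u x y k - tmult I B u x y k)"
  by (auto simp: tmult_def fun_eq_iff left_diff_distrib sum_subtractf)

lemma tmult_symbols_sym:
  assumes "\<And>k i j. k \<in> I \<Longrightarrow> i \<in> I \<Longrightarrow> j \<in> I \<Longrightarrow> A k i j u = A k j i u"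
  shows "tmult I A u x y = tmult I A u y x"
proof
  fix k
  show "tmult I A u x y k = tmult I A u y x k"
  proof (cases "k \<in> I")
    case True
    have "(\<Sum>i\<in>I. \<Sum>j\<in>I. A k i j u * x i * y j) = (\<Sum>i\<in>I. \<Sum>j\<in>I. A k j i u * y j * x i)"
      by (intro sum.cong refl) (simp add: assms[OF True] mult_ac)
    then show ?thesis using True by (simp add: tmult_def) (subst (2) sum.swap, simp)
  qed (simp add: tmult_def)
qed

lemma prod_c_const: "prod_c k i j u = prod_c k i j v"
  by (cases k; cases i; cases j) simp

lemma d_nabla_tmult:
  assumes ijk: "i \<in> I" "j \<in> I" "k \<in> I"
    and V: "\<And>p k. p \<in> I \<Longrightarrow> k \<in> I \<Longrightarrow> V p k u = w k p"
  shows "d_nabla I \<Gamma> V i j k u = pd j (V i k) u - pd k (V i j) u +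
    (tmult I \<Gamma> u (basis_vec j) (w k) i - tmult I \<Gamma> u (basis_vec k) (w j) i)"
proof -
  have "(\<Sum>p\<in>I. \<Gamma> i j p u * V p k u) = tmult I \<Gamma> u (basis_vec j) (w k) i" if "j \<in> I" "k \<in> I" for j k
    unfolding tmult_left_basis[OF finite_I that(1) ijk(1)]
    by (intro sum.cong refl) (simp add: V that)
  then show ?thesis using ijk by (simp add: d_nabla_def)
qed

text \<open>Torsion, the parallel unit, the coefficient of the deformation parameter and the
  condition on \<open>tensor_L_a0\<close> are affine in the connection with the same inhomogeneous
  part for both candidates, so their difference satisfies the linear versions.\<close>

lemma connection_unique:
  assumes F: "flat_F_manifold I U \<Gamma> prod_c unit_e"
    and d0: "symbols_eq I U (d_nabla I \<Gamma> (tensor_L_a0 r m \<epsilon>)) (\<lambda>_ _ _ _. 0)"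
  shows "symbols_eq I U \<Gamma> (Gam r m \<epsilon>)"
  unfolding symbols_eq_def
proof (intro ballI)
  fix k i j u assume k: "k \<in> I" and ij: "i \<in> I" "j \<in> I" and u: "u \<in> U"
  have F0: "flat_F_manifold I U (Gam r m \<epsilon>) prod_c unit_e"
    using flat_F_manifold_prod[of False] by simp
  define T :: "(nat \<times> nat, 'k) symbols" where "T = (\<lambda>k i j u. \<Gamma> k i j u - Gam r m \<epsilon> k i j u)"
  have sym: "tmult I T u x y = tmult I T u y x" for x y
    by (rule tmult_symbols_sym)
      (simp add: T_def flat_F_manifold_symmetric[OF F u] flat_F_manifold_symmetric[OF F0 u] del: Gam.simps)
  have Td: "tmult I T u x y = (\<lambda>k. tmult I \<Gamma> u x y k - tmult I (Gam r m \<epsilon>) u x y k)" for x y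
    unfolding T_def by (rule tmult_symbols_diff)
  have "tmult I T u x y = (\<lambda>k. 0)" for x y
  proof (rule connection_difference_zero[OF u sym])
    fix x y z
    show "tmult I T u x (\<lambda>q. unit_e q u) = (\<lambda>k. 0)"
    proof
      fix k
      have "tmult I T u (basis_vec i) (\<lambda>q. unit_e q u) k = 0" if "i \<in> I" for i
      proof (cases "k \<in> I")
        case True
        then show ?thesis
          unfolding Td flat_F_manifold_unit[OF F u True that] flat_F_manifold_unit[OF F0 u True that] by simp
      qed (simp add: tmult_def)
      then show "tmult I T u x (\<lambda>q. unit_e q u) k = 0"
        by (simp add: tmult_expand_left[OF finite_I, of T u x])
    qed
    show "tmult I T u x (tmult I prod_c u u y) = tmult I T u y (tmult I prod_c u u x)"
    proof
      fix k
      have b: "tmult I T u (basis_vec i) (tmult I prod_c u u (basis_vec j)) k = tmult I T u (basis_vec j) (tmult I prod_c u u (basis_vec i)) k"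
        if ij: "i \<in> I" "j \<in> I" for i j
      proof (cases "k \<in> I")
        case k: True
        define w where "w p = (\<lambda>q. tmult I prod_c u u (basis_vec p) q - a0 r m \<epsilon> u * basis_vec p q)" for p
        have L: "tensor_L_a0 r m \<epsilon> p q u = w q p" if "p \<in> I" "q \<in> I" for p q
          using mult_tensor_eq_tmult[OF finite_I that, of prod_c euler_E u]
          by (simp add: tensor_L_a0_def w_def tensor_L_def euler_E_def basis_vec_def)
        have "d_nabla I \<Gamma> (tensor_L_a0 r m \<epsilon>) k i j u = d_nabla I (Gam r m \<epsilon>) (tensor_L_a0 r m \<epsilon>) k i j u"
          using d0 d_nabla_L_a0[OF u k ij] k ij u by (simp add: symbols_eq_def)
        moreover have "d_nabla I G (tensor_L_a0 r m \<epsilon>) k i j u =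
            pd i (tensor_L_a0 r m \<epsilon> k j) u - pd j (tensor_L_a0 r m \<epsilon> k i) u +
            (tmult I G u (basis_vec i) (w j) k - tmult I G u (basis_vec j) (w i) k)" for G
          by (rule d_nabla_tmult[OF k ij]) (rule L)
        ultimately have "tmult I T u (basis_vec i) (w j) k = tmult I T u (basis_vec j) (w i) k"
          unfolding Td by (simp add: algebra_simps)
        \<comment> \<open>The part with \<open>a0\<close> is a multiple of T on two basis vectors
          and drops out by symmetry.\<close>
        then show ?thesis
          unfolding w_def tmult_diff tmult_scale sym[of "basis_vec i" "basis_vec j"] by simp
      qed (simp add: tmult_def)
      show "tmult I T u x (tmult I prod_c u u y) k = tmult I T u y (tmult I prod_c u u x) k"
        unfolding tmult_compose_expand[OF finite_I, of T u x] tmult_compose_expand[OF finite_I, of T u y]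
        by (subst sum.swap) (intro sum.cong refl, simp add: b mult.commute)
    qed
    fix k
    show "tmult I T u x (tmult I prod_c u y z) k + tmult I prod_c u x (tmult I T u y z) k =
      tmult I T u y (tmult I prod_c u x z) k + tmult I prod_c u y (tmult I T u x z) k"
    proof -
      define S where "S x y z = tmult I T u x (tmult I prod_c u y z) k + tmult I prod_c u x (tmult I T u y z) k" for x y z
      have b: "S (basis_vec p) (basis_vec q) (basis_vec s) = S (basis_vec q) (basis_vec p) (basis_vec s)"
        if "p \<in> I" "q \<in> I" "s \<in> I" for p q s
      proof (cases "k \<in> I")
        case True
        show ?thesis
          using flat_F_manifold_compatible[OF F prod_c_const u True that]
            flat_F_manifold_compatible[OF F0 prod_c_const u True that]
          by (simp add: S_def Td tmult_diff algebra_simps)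
      qed (simp add: S_def tmult_def)
      have ex: "tmult I A u x (tmult I B u y z) k = (\<Sum>p\<in>I. \<Sum>q\<in>I. \<Sum>s\<in>I. x p * y q * z s *
          tmult I A u (basis_vec p) (tmult I B u (basis_vec q) (basis_vec s)) k)" for A B :: "(nat \<times> nat, 'k) symbols" and x y z
      proof -
        have B: "tmult I B u y z = (\<lambda>l. \<Sum>q\<in>I. \<Sum>s\<in>I. y q * z s * tmult I B u (basis_vec q) (basis_vec s) l)"
          by (rule ext, rule tmult_expand[OF finite_I])
        have "tmult I A u (basis_vec p) (tmult I B u y z) k = (\<Sum>q\<in>I. \<Sum>s\<in>I. y q * z s *
            tmult I A u (basis_vec p) (tmult I B u (basis_vec q) (basis_vec s)) k)" for p
          unfolding B by (simp only: tmult_sum_right tmult_scale)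
        then show ?thesis
          by (subst tmult_expand_left[OF finite_I]) (simp add: sum_distrib_left mult.assoc)
      qed
      have "S x y z = (\<Sum>p\<in>I. \<Sum>q\<in>I. \<Sum>s\<in>I. x p * y q * z s * S (basis_vec p) (basis_vec q) (basis_vec s))" for x y z
        unfolding S_def ex[of T x prod_c y z] ex[of prod_c x T y z] by (simp add: distrib_left sum.distrib)
      note ex = this
      have "S x y z = (\<Sum>q\<in>I. \<Sum>p\<in>I. \<Sum>s\<in>I. x p * y q * z s * S (basis_vec p) (basis_vec q) (basis_vec s))"
        unfolding ex[of x y z] by (rule sum.swap)
      also have "\<dots> = S y x z"
        unfolding ex[of y x z] by (intro sum.cong refl) (simp only: b mult_ac)
      finally show ?thesis by (simp only: S_def)
    qed
  qed
  then have "tmult I T u (basis_vec i) (basis_vec j) k = 0" by simp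
  then show "\<Gamma> k i j u = Gam r m \<epsilon> k i j u"
    using k ij by (simp add: tmult_basis T_def del: Gam.simps)
qed

text \<open>With the first connection known, the condition on \<open>d_nabla\<close> for constant
  fields w gives T(x, w y) = T(y, w x), while the parallel \<open>E\<close> gives T(x, E) =
  0.\<close>

lemma dual_connection_unique:
  assumes G: "symbols_eq I U \<Gamma> (Gam r m \<epsilon>)" and F: "flat_F_manifold I U \<Gamma>s cs euler_E"
    and d: "\<And>X. is_vfield I U X \<Longrightarrow>
      symbols_eq I U (d_nabla I \<Gamma> (mult_tensor I prod_c X)) (d_nabla I \<Gamma>s (mult_tensor I prod_c X))"
  shows "symbols_eq I U \<Gamma>s (Gam_s r m \<epsilon>)"
  unfolding symbols_eq_def
proof (intro ballI)
  fix k i j u assume k: "k \<in> I" and ij: "i \<in> I" "j \<in> I" and u: "u \<in> U"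
  have F0: "flat_F_manifold I U (Gam_s r m \<epsilon>) (prod_cs r m) euler_E"
    using flat_F_manifold_prod[of True] by simp
  define T :: "(nat \<times> nat, 'k) symbols" where "T = (\<lambda>k i j u. \<Gamma>s k i j u - Gam_s r m \<epsilon> k i j u)"
  have sym: "tmult I T u x y = tmult I T u y x" for x y
    by (rule tmult_symbols_sym)
      (simp add: T_def flat_F_manifold_symmetric[OF F u] flat_F_manifold_symmetric[OF F0 u] del: Gam_s.simps)
  have Td: "tmult I T u x y = (\<lambda>k. tmult I \<Gamma>s u x y k - tmult I (Gam_s r m \<epsilon>) u x y k)" for x y
    unfolding T_def by (rule tmult_symbols_diff)
  have TE: "tmult I T u x u k = 0" for x k
  proof -
    have "tmult I T u (basis_vec i) u k = 0" if "i \<in> I" for i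
    proof (cases "k \<in> I")
      case True
      then show ?thesis
        using flat_F_manifold_unit[OF F u True that] flat_F_manifold_unit[OF F0 u True that]
        by (simp add: Td euler_E_def)
    qed (simp add: tmult_def)
    then show ?thesis by (simp add: tmult_expand_left[OF finite_I, of T u x])
  qed
  have comp: "tmult I T u x (tmult I prod_c u w y) k = tmult I T u y (tmult I prod_c u w x) k" for x y w
  proof -
    have b: "tmult I T u (basis_vec i) (tmult I prod_c u w (basis_vec j)) k = tmult I T u (basis_vec j) (tmult I prod_c u w (basis_vec i)) k"
      if ij: "i \<in> I" "j \<in> I" for i j
    proof -
      let ?X = "\<lambda>q (v::nat \<times> nat \<Rightarrow> 'k). w q" and ?w = "\<lambda>p. tmult I prod_c u w (basis_vec p)"
      have V: "mult_tensor I prod_c ?X p q u = ?w q p" if "p \<in> I" "q \<in> I" for p q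
        using mult_tensor_eq_tmult[OF finite_I that, of prod_c ?X u] by simp
      have dt: "d_nabla I G (mult_tensor I prod_c ?X) k i j u =
          pd i (mult_tensor I prod_c ?X k j) u - pd j (mult_tensor I prod_c ?X k i) u +
          (tmult I G u (basis_vec i) (?w j) k - tmult I G u (basis_vec j) (?w i) k)" for G
        by (rule d_nabla_tmult[OF k ij]) (rule V)
      have 1: "d_nabla I \<Gamma> (mult_tensor I prod_c ?X) k i j u = d_nabla I \<Gamma>s (mult_tensor I prod_c ?X) k i j u"
        using d[OF is_vfield_const[of I U w]] k ij u by (simp add: symbols_eq_def)
      have 2: "d_nabla I (Gam r m \<epsilon>) (mult_tensor I prod_c ?X) k i j u = d_nabla I (Gam_s r m \<epsilon>) (mult_tensor I prod_c ?X) k i j u"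
        by (rule d_nabla_mult_tensor[OF u k ij])
      have "tmult I \<Gamma> u x y = tmult I (Gam r m \<epsilon>) u x y" for x y
        using G u by (intro ext) (simp add: tmult_def symbols_eq_def del: Gam.simps)
      then have "tmult I \<Gamma>s u (basis_vec i) (?w j) k - tmult I \<Gamma>s u (basis_vec j) (?w i) k =
          tmult I (Gam_s r m \<epsilon>) u (basis_vec i) (?w j) k - tmult I (Gam_s r m \<epsilon>) u (basis_vec j) (?w i) k"
        using 1 2 unfolding dt by simp
      then show ?thesis unfolding Td by (simp add: algebra_simps)
    qed
    show ?thesis
      unfolding tmult_compose_expand[OF finite_I, of T u x] tmult_compose_expand[OF finite_I, of T u y]
      by (subst sum.swap) (intro sum.cong refl, simp add: b mult.commute)
  qed
  have "tmult I T u x y k = 0" for x y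
  proof -
    \<comment> \<open>The quotient of \<open>y\<close> by \<open>E\<close>: then T(x, y) = T(x, w E)
      = T(E, w x) = 0.\<close>
    define w where "w = tmult I prod_c u y (\<lambda>q. inv_E r m q u)"
    have "tmult I T u x y k = tmult I T u x (tmult I prod_c u w u) k"
    proof (rule fun_cong[OF tmult_cong[OF refl]], rule vec_eqI)
      fix a assume a: "a \<in> R"
      have "fps_cutoff (m a) (blk m y a * inverse (blk m u a) * blk m u a) = fps_cutoff (m a) (blk m y a * (blk m u a * inverse (blk m u a)))"
        by (simp only: mult_ac)
      then show "blk m y a = blk m (tmult I prod_c u w u) a"
        unfolding w_def blk_tmult_prod_c[OF a] blk_inv_E[OF u a] inverse_blk[OF u a]
        by (simp add: kap_def fps_cutoff_mult_left fps_cutoff_mult_right fps_cutoff_mult_middle)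
    qed
    also have "\<dots> = 0" unfolding comp[of x w u] sym[of u] by (rule TE)
    finally show ?thesis .
  qed
  then have "tmult I T u (basis_vec i) (basis_vec j) k = 0" by simp
  then show "\<Gamma>s k i j u = Gam_s r m \<epsilon> k i j u"
    using k ij by (simp add: tmult_basis T_def del: Gam_s.simps)
qed

text \<open>Any inverse \<open>W\<close> undoes multiplication by \<open>E\<close>, and that
  multiplication sends the dual product of two basis fields to their first product.\<close>

lemma dual_product_unique:
  assumes W: "tensor_inverse I U (mult_tensor I prod_c euler_E) W"
    and cs: "\<And>X Y. is_vfield I U X \<Longrightarrow> is_vfield I U Y \<Longrightarrow>
      vf_eq I U (vprod I cs X Y) (tensor_app I W (vprod I prod_c X Y))"
  shows "symbols_eq I U cs (prod_cs r m)"
  unfolding symbols_eq_def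
proof (intro ballI)
  fix k i j u assume k: "k \<in> I" and ij: "i \<in> I" "j \<in> I" and u: "u \<in> U"
  let ?b = "\<lambda>p q (v::nat \<times> nat \<Rightarrow> 'k). basis_vec p q :: 'k"
  let ?L = "mult_tensor I prod_c euler_E"
  define Z :: "(nat \<times> nat, 'k) vfield" where "Z k = prod_c k i j" for k
  define Z' :: "(nat \<times> nat, 'k) vfield" where "Z' k = prod_cs r m k i j" for k
  have vp: "vprod I A (?b i) (?b j) k u = A k i j u" if "k \<in> I" for A :: "(nat \<times> nat, 'k) symbols" and k
    using tmult_basis[OF finite_I ij that, of A u] that by (simp add: tmult_def vprod_def)
  have fZ: "is_vfield I U Z" "is_vfield I U Z'"
    using is_symbols_prod[of False] is_symbols_prod[of True] ij by (simp_all add: is_vfield_def Z_def Z'_def is_symbols_def)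
  have app: "tensor_app I V X k u = tensor_app I V Y k u" if "\<And>q. q \<in> I \<Longrightarrow> X q u = Y q u" for V X Y k
    unfolding tensor_app_def using that by simp
  have Z': "tensor_app I inv_L Z q u = Z' q u" if "q \<in> I" for q
  proof -
    have "Z' q u = tensor_app I inv_L (vprod I prod_c (?b i) (?b j)) q u"
      using prod_cs_inv_L[OF u that, of "?b i" "?b j"] vp[OF that, of "prod_cs r m"] by (simp add: Z'_def)
    also have "\<dots> = tensor_app I inv_L Z q u"
      by (rule app) (simp add: vp Z_def)
    finally show ?thesis by simp
  qed
  have LZ: "tensor_app I ?L Z' q u = Z q u" if "q \<in> I" for q
  proof -
    have "tensor_app I ?L Z' q u = tensor_app I ?L (tensor_app I inv_L Z) q u"
      by (rule app) (simp add: Z')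
    then show ?thesis
      using tensor_inverse_inv_L fZ(1) that u by (simp add: tensor_inverse_def vf_eq_def)
  qed
  have "cs k i j u = tensor_app I W (vprod I prod_c (?b i) (?b j)) k u"
    using cs[OF is_vfield_const[of I U "basis_vec i"] is_vfield_const[of I U "basis_vec j"]] k u vp[OF k, of cs]
    by (simp add: vf_eq_def)
  also have "\<dots> = tensor_app I W (tensor_app I ?L Z') k u"
    by (rule app) (simp add: vp LZ Z_def)
  also have "\<dots> = Z' k u"
    using W fZ(2) k u by (simp add: tensor_inverse_def vf_eq_def)
  finally show "cs k i j u = prod_cs r m k i j u" by (simp only: Z'_def)
qed

end

theorem theorem8p18:
  fixes r :: nat and m :: "nat \<Rightarrow> nat" and \<epsilon> :: "nat \<Rightarrow> 'k::real_normed_field"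
  assumes "r \<ge> 1"
    and "\<And>\<alpha>. \<alpha> \<in> {1..r} \<Longrightarrow> m \<alpha> \<ge> 1"
    and "(\<Sum>\<alpha>\<in>{1..r}. m \<alpha>) \<ge> 2"
  shows
    "(\<forall>u\<in>dom_U r m. a0 r m \<epsilon> u =
        (\<Sum>\<alpha>\<in>{1..r}. \<epsilon> \<alpha> * (\<Sum>i\<in>{1..m \<alpha>}. tensor_L r m (\<alpha>, i) (\<alpha>, i) u)))
     \<and> bi_flat_F_manifold (idx r m) (dom_U r m)
         (Gam r m \<epsilon>) (Gam_s r m \<epsilon>) prod_c (prod_cs r m) unit_e euler_E
     \<and> symbols_eq (idx r m) (dom_U r m)
         (d_nabla (idx r m) (Gam r m \<epsilon>) (tensor_L_a0 r m \<epsilon>)) (\<lambda>_ _ _ _. 0)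
     \<and> (\<forall>\<Gamma>' \<Gamma>s' cs'.
          bi_flat_F_manifold (idx r m) (dom_U r m) \<Gamma>' \<Gamma>s' prod_c cs' unit_e euler_E \<longrightarrow>
          symbols_eq (idx r m) (dom_U r m)
            (d_nabla (idx r m) \<Gamma>' (tensor_L_a0 r m \<epsilon>)) (\<lambda>_ _ _ _. 0) \<longrightarrow>
          symbols_eq (idx r m) (dom_U r m) \<Gamma>' (Gam r m \<epsilon>) \<and>
          symbols_eq (idx r m) (dom_U r m) \<Gamma>s' (Gam_s r m \<epsilon>) \<and>
          symbols_eq (idx r m) (dom_U r m) cs' (prod_cs r m))"
proof -
  interpret block_data r m \<epsilon>
    by unfold_locales (rule assms(2))
  show ?thesis
  proof (intro conjI allI impI)
    show "\<forall>u\<in>U. a0 r m \<epsilon> u = (\<Sum>\<alpha>\<in>R. \<epsilon> \<alpha> * (\<Sum>i\<in>{1..m \<alpha>}. tensor_L r m (\<alpha>, i) (\<alpha>, i) u))"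
      by (intro ballI a0_trace)
    show "bi_flat_F_manifold I U (Gam r m \<epsilon>) (Gam_s r m \<epsilon>) prod_c (prod_cs r m) unit_e euler_E"
      by (rule bi_flat)
    show "symbols_eq I U (d_nabla I (Gam r m \<epsilon>) (tensor_L_a0 r m \<epsilon>)) (\<lambda>_ _ _ _. 0)"
      unfolding symbols_eq_def by (intro ballI d_nabla_L_a0)
  next
    fix \<Gamma>' \<Gamma>s' cs' :: "(nat \<times> nat, 'k) symbols"
    assume B: "bi_flat_F_manifold I U \<Gamma>' \<Gamma>s' prod_c cs' unit_e euler_E"
      and d: "symbols_eq I U (d_nabla I \<Gamma>' (tensor_L_a0 r m \<epsilon>)) (\<lambda>_ _ _ _. 0)"
    have F: "flat_F_manifold I U \<Gamma>' prod_c unit_e" "flat_F_manifold I U \<Gamma>s' cs' euler_E"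
      and D: "\<And>X. is_vfield I U X \<Longrightarrow>
        symbols_eq I U (d_nabla I \<Gamma>' (mult_tensor I prod_c X)) (d_nabla I \<Gamma>s' (mult_tensor I prod_c X))"
      using B unfolding bi_flat_F_manifold_def by blast+
    obtain W where W: "tensor_inverse I U (mult_tensor I prod_c euler_E) W"
      "\<And>X Y. is_vfield I U X \<Longrightarrow> is_vfield I U Y \<Longrightarrow>
           vf_eq I U (vprod I cs' X Y) (tensor_app I W (vprod I prod_c X Y))"
      using B unfolding bi_flat_F_manifold_def by blast
    show G: "symbols_eq I U \<Gamma>' (Gam r m \<epsilon>)"
      by (rule connection_unique[OF F(1) d])
    show "symbols_eq I U \<Gamma>s' (Gam_s r m \<epsilon>)"
      by (rule dual_connection_unique[OF G F(2) D])
    show "symbols_eq I U cs' (prod_cs r m)"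
      by (rule dual_product_unique[OF W])
  qed
qed

end
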